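(* Let $\lambda\in\mathbb{R}^n$ be strictly decreasing, and set $N:=-\mathrm{i}\,\mathrm{Diag}(\lambda)\in\mathfrak{u}_n$. (i) The full symmetric Toda flow on $\mathcal{O}_\lambda$ weakly preserves positivity in both the positive and negative time directions. That is, if $L(t)$ evolves according to $\dot L(t)=[L(t),\pi_{\mathfrak u}(-\mathrm{i}L(t))]$ beginning at $L_0\in\mathcal{O}_\lambda^{\ge0}$, then $L(t)\in\mathcal{O}_\lambda^{\ge0}$ for all $t\in\mathbb{R}$. Moreover, $L(t)$ (for $t\in\mathbb{R}$) is contained in a single cell of the cell decomposition of $\mathcal{O}_\lambda^{\ge0}$. (ii) The full symmetric Toda flow restricted to $\mathcal{O}_\lambda^{\ge0}$ is the twisted gradient flow with respect to $N$ in the Kähler metric. That is, if $L(t)$ evolves according to $\dot L(t)=[L(t),\pi_{\mathfrak u}(-\mathrm{i}L(t))]$ beginning at $L_0\in\mathcal{O}_\lambda^{\ge0}$, then $\vartheta_\lambda(L(t))$ is the gradient flow with respect to $N$ in the Kähler metric beginning at $\vartheta_\lambda(L_0)\in\mathcal{O}_\lambda^{\ge0}$.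
   Context: Here $\mathrm{i}=\sqrt{-1}$; $\mathrm{U}_n$ is the unitary group and $\mathfrak{u}_n$ the Lie algebra of skew-Hermitian $n\times n$ matrices. $\pi_{\mathfrak u}:\mathfrak{gl}_n(\mathbb{C})\to\mathfrak{u}_n$ is the $\mathbb{R}$-linear projection onto the first summand of $\mathfrak{gl}_n(\mathbb{C})=\mathfrak{u}_n\oplus\{\text{real diagonal matrices}\}\oplus\{\text{strictly upper-triangular complex matrices}\}$. $\mathcal{O}_\lambda=\{g(\mathrm{i}\,\mathrm{Diag}(\lambda))g^{-1}:g\in\mathrm{U}_n\}$. $\mathrm{U}_n^{\ge 0}$ is the set of $g\in\mathrm{U}_n$ all of whose left-justified minors (row set $I$, column set $\{1,\dots,|I|\}$) are nonnegative real numbers, and $\mathcal{O}_\lambda^{\ge 0}=\{g(\mathrm{i}\,\mathrm{Diag}(\lambda))g^{-1}:g\in\mathrm{U}_n^{\ge 0}\}$. For strictly decreasing $\lambda$ each element of $\mathcal{O}_\lambda^{\ge 0}$ equals $g(\mathrm{i}\,\mathrm{Diag}(\lambda))g^{-1}$ for a unique $g\in\mathrm{U}_n^{\ge0}$; the twist map $\vartheta_\lambda:\mathcal{O}_\lambda^{\ge0}\to\mathcal{O}_\lambda^{\ge0}$ is $g(\mathrm{i}\,\mathrm{Diag}(\lambda))g^{-1}\mapsto\delta_ng^{-1}(\mathrm{i}\,\mathrm{Diag}(\lambda))g\delta_n$ for $g\in\mathrm{U}_n^{\ge0}$, with $\delta_n=\mathrm{Diag}(1,-1,1,\dots,(-1)^{n-1})$.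 Cell decomposition: for $w\in\mathfrak{S}_n$ let $\mathring w$ be the signed permutation matrix with entries $\pm1$ at positions $(w(j),j)$, signs chosen so that all left-justified minors are nonnegative. With $\mathrm{B}_n(\mathbb{C})$, $\mathrm{B}_n^-(\mathbb{C})$ the invertible upper-/lower-triangular matrices, the cells of $\mathcal{O}_\lambda^{\ge0}$ are, for $v\le w$ in Bruhat order on $\mathfrak{S}_n$, the sets of $g(\mathrm{i}\,\mathrm{Diag}(\lambda))g^{-1}$ with $g\in\mathrm{U}_n^{\ge0}\cap \mathrm{B}_n^-(\mathbb{C})\mathring v\mathrm{B}_n(\mathbb{C})\cap\mathrm{B}_n(\mathbb{C})\mathring w\mathrm{B}_n(\mathbb{C})$; $\mathcal{O}_\lambda^{\ge0}$ is their disjoint union. Metric: let $\kappa(L,M)=2n\,\mathrm{tr}(LM)-2\,\mathrm{tr}(L)\mathrm{tr}(M)$ and $\mathrm{ad}_L(X)=[L,X]=LX-XL$. The tangent space of $\mathcal{O}_\lambda$ at $L$ is $\{[L,X]:X\in\mathfrak{u}_n\}$. For $X\in\mathfrak{u}_n$ write $X=X^L+X_L$ with $X^L\in\mathrm{im}(\mathrm{ad}_L)$, $X_L\in\ker(\mathrm{ad}_L)$ (uniquely). The normal metric is $\langle[L,X],[L,Y]\rangle_{\mathrm{normal}}=-\kappa(X^L,Y^L)$, and the Kähler metric is $\langle[L,X],[L,Y]\rangle_{\mathrm{K\ddot ahler}}=\langle\sqrt{-\mathrm{ad}_L^2}\,([L,X]),[L,Y]\rangle_{\mathrm{normal}}$,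 with $\sqrt{-\mathrm{ad}_L^2}$ the positive square root. The gradient flow with respect to $N$ is $\dot L(t)=\mathrm{grad}(H)(L(t))$ with $H(M)=\kappa(M,N)$ (steepest ascent). *)

theory Defs
  imports
    "Jordan_Normal_Form.Schur_Decomposition"
    "Jordan_Normal_Form.DL_Submatrix"
    "HOL-Combinatorics.Permutations"
    "HOL-Library.FuncSet"
begin

text \<open>
  Matrices and vectors are those of Jordan_Normal_Form, so rows and columns are indexed by
  \<open>0, \<dots>, n - 1\<close>; accordingly the symmetric group consists of the permutations of \<open>{..<n}\<close>.
\<close>

definition strictly_decreasing :: "real vec \<Rightarrow> bool" where
  "strictly_decreasing lam \<longleftrightarrow> (\<forall>i j. i < j \<longrightarrow> j < dim_vec lam \<longrightarrow> lam $ j < lam $ i)"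

definition Diag :: "nat \<Rightarrow> real vec \<Rightarrow> complex mat" where
  "Diag n lam = mat_diag n (\<lambda>i. complex_of_real (lam $ i))"

definition tr :: "complex mat \<Rightarrow> complex" where
  "tr A = (\<Sum>i<dim_row A. A $$ (i, i))"

text \<open>Only ever applied to invertible matrices, where \<open>mat_inverse\<close> returns \<open>Some\<close>.\<close>

definition minv :: "complex mat \<Rightarrow> complex mat" where
  "minv g = the (mat_inverse g)"

definition bracket :: "complex mat \<Rightarrow> complex mat \<Rightarrow> complex mat" where
  "bracket L X = L * X - X * L"

definition unitary_group :: "nat \<Rightarrow> complex mat set" where
  "unitary_group n =
     {g \<in> carrier_mat n n. g * mat_adjoint g = 1\<^sub>m n \<and> mat_adjoint g * g = 1\<^sub>m n}"

definition skew_hermitian :: "nat \<Rightarrow> complex mat set" where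
  "skew_hermitian n = {X \<in> carrier_mat n n. mat_adjoint X = - X}"

definition real_diagonal :: "nat \<Rightarrow> complex mat set" where
  "real_diagonal n = {D \<in> carrier_mat n n. diagonal_mat D \<and> (\<forall>i<n. D $$ (i, i) \<in> \<real>)}"

definition strictly_upper :: "nat \<Rightarrow> complex mat set" where
  "strictly_upper n = {R \<in> carrier_mat n n. \<forall>i<n. \<forall>j\<le>i. R $$ (i, j) = 0}"

definition proj_u :: "nat \<Rightarrow> complex mat \<Rightarrow> complex mat" where
  "proj_u n A = (THE U. U \<in> skew_hermitian n \<and>
     (\<exists>D\<in>real_diagonal n. \<exists>R\<in>strictly_upper n. A = U + D + R))"

definition left_minors_nonneg :: "nat \<Rightarrow> complex mat \<Rightarrow> bool" where
  "left_minors_nonneg n g \<longleftrightarrow>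
     (\<forall>I \<subseteq> {..<n}. det (submatrix g I {..<card I}) \<in> \<real> \<and> 0 \<le> Re (det (submatrix g I {..<card I})))"

definition unitary_nonneg :: "nat \<Rightarrow> complex mat set" where
  "unitary_nonneg n = {g \<in> unitary_group n. left_minors_nonneg n g}"

definition orbit_point :: "nat \<Rightarrow> real vec \<Rightarrow> complex mat \<Rightarrow> complex mat" where
  "orbit_point n lam g = g * (\<i> \<cdot>\<^sub>m Diag n lam) * minv g"

definition orbit :: "nat \<Rightarrow> real vec \<Rightarrow> complex mat set" where
  "orbit n lam = orbit_point n lam ` unitary_group n"

definition orbit_nonneg :: "nat \<Rightarrow> real vec \<Rightarrow> complex mat set" where
  "orbit_nonneg n lam = orbit_point n lam ` unitary_nonneg n"

definition delta :: "nat \<Rightarrow> complex mat" where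
  "delta n = mat_diag n (\<lambda>i. (- 1) ^ i)"

text \<open>The twist map; meaningful on \<open>orbit_nonneg n lam\<close> for strictly decreasing \<open>lam\<close>, where the
  representative \<open>g\<close> is unique.\<close>

definition twist :: "nat \<Rightarrow> real vec \<Rightarrow> complex mat \<Rightarrow> complex mat" where
  "twist n lam M = (THE M'. \<exists>g\<in>unitary_nonneg n. M = orbit_point n lam g \<and>
     M' = delta n * minv g * (\<i> \<cdot>\<^sub>m Diag n lam) * g * delta n)"

definition upper_borel :: "nat \<Rightarrow> complex mat set" where
  "upper_borel n = {b \<in> carrier_mat n n. upper_triangular b \<and> invertible_mat b}"

definition lower_borel :: "nat \<Rightarrow> complex mat set" where
  "lower_borel n = {b \<in> carrier_mat n n. upper_triangular (transpose_mat b) \<and> invertible_mat b}"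

definition signed_perm_mat :: "nat \<Rightarrow> (nat \<Rightarrow> nat) \<Rightarrow> complex mat" where
  "signed_perm_mat n w = (THE A. A \<in> carrier_mat n n \<and>
     (\<forall>i<n. \<forall>j<n. if i = w j then A $$ (i, j) \<in> {1, - 1} else A $$ (i, j) = 0) \<and>
     left_minors_nonneg n A)"

definition perm_length :: "nat \<Rightarrow> (nat \<Rightarrow> nat) \<Rightarrow> nat" where
  "perm_length n w = card {(i, j). i < j \<and> j < n \<and> w j < w i}"

definition bruhat_step :: "nat \<Rightarrow> (nat \<Rightarrow> nat) \<Rightarrow> (nat \<Rightarrow> nat) \<Rightarrow> bool" where
  "bruhat_step n u v \<longleftrightarrow> u permutes {..<n} \<and>
     (\<exists>a<n. \<exists>b<n. a \<noteq> b \<and> v = u \<circ> Transposition.transpose a b) \<and>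
     perm_length n u < perm_length n v"

definition bruhat_le :: "nat \<Rightarrow> (nat \<Rightarrow> nat) \<Rightarrow> (nat \<Rightarrow> nat) \<Rightarrow> bool" where
  "bruhat_le n v w \<longleftrightarrow>
     v permutes {..<n} \<and> w permutes {..<n} \<and> rtranclp (bruhat_step n) v w"

definition cell :: "nat \<Rightarrow> real vec \<Rightarrow> (nat \<Rightarrow> nat) \<Rightarrow> (nat \<Rightarrow> nat) \<Rightarrow> complex mat set" where
  "cell n lam v w = orbit_point n lam `
     (unitary_nonneg n
      \<inter> {a * signed_perm_mat n v * b | a b. a \<in> lower_borel n \<and> b \<in> upper_borel n}
      \<inter> {a * signed_perm_mat n w * b | a b. a \<in> upper_borel n \<and> b \<in> upper_borel n})"

definition cells :: "nat \<Rightarrow> real vec \<Rightarrow> complex mat set set" where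
  "cells n lam = {cell n lam v w | v w. bruhat_le n v w}"

text \<open>For skew-Hermitian \<open>L\<close> and \<open>M\<close> the argument of \<open>Re\<close> is already real.\<close>

definition kappa :: "nat \<Rightarrow> complex mat \<Rightarrow> complex mat \<Rightarrow> real" where
  "kappa n L M = Re (2 * of_nat n * tr (L * M) - 2 * tr L * tr M)"

text \<open>The image of \<open>ad L\<close> on the skew-Hermitian matrices; for \<open>L\<close> in the orbit this is also the
  tangent space at \<open>L\<close>.\<close>

definition ad_image :: "nat \<Rightarrow> complex mat \<Rightarrow> complex mat set" where
  "ad_image n L = bracket L ` skew_hermitian n"

definition ad_kernel :: "nat \<Rightarrow> complex mat \<Rightarrow> complex mat set" where
  "ad_kernel n L = {X \<in> skew_hermitian n. bracket L X = 0\<^sub>m n n}"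

definition im_part :: "nat \<Rightarrow> complex mat \<Rightarrow> complex mat \<Rightarrow> complex mat" where
  "im_part n L X = (THE Y. Y \<in> ad_image n L \<and> (\<exists>Z\<in>ad_kernel n L. X = Y + Z))"

definition normal_metric :: "nat \<Rightarrow> complex mat \<Rightarrow> complex mat \<Rightarrow> complex mat \<Rightarrow> real" where
  "normal_metric n L U V = (THE r. \<exists>X\<in>skew_hermitian n. \<exists>Y\<in>skew_hermitian n.
     U = bracket L X \<and> V = bracket L Y \<and> r = - kappa n (im_part n L X) (im_part n L Y))"

text \<open>The positive square root of \<open>- (ad L)\<^sup>2\<close> as an operator on \<open>ad_image n L\<close>: the real-linear
  operator that is self-adjoint and positive semidefinite for the form \<open>- kappa\<close> (positive definite
  on this space of traceless skew-Hermitian matrices) and squares to \<open>- (ad L)\<^sup>2\<close>. Extensionality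
  makes it unique as a total function.\<close>

definition sqrt_neg_ad_sq :: "nat \<Rightarrow> complex mat \<Rightarrow> complex mat \<Rightarrow> complex mat" where
  "sqrt_neg_ad_sq n L = (THE S. let T = ad_image n L in
     S \<in> T \<rightarrow>\<^sub>E T \<and>
     (\<forall>U\<in>T. \<forall>V\<in>T. S (U + V) = S U + S V) \<and>
     (\<forall>c. \<forall>U\<in>T. S (complex_of_real c \<cdot>\<^sub>m U) = complex_of_real c \<cdot>\<^sub>m S U) \<and>
     (\<forall>U\<in>T. \<forall>V\<in>T. - kappa n (S U) V = - kappa n U (S V)) \<and>
     (\<forall>U\<in>T. 0 \<le> - kappa n (S U) U) \<and>
     (\<forall>U\<in>T. S (S U) = - bracket L (bracket L U)))"

definition kaehler_metric :: "nat \<Rightarrow> complex mat \<Rightarrow> complex mat \<Rightarrow> complex mat \<Rightarrow> real" where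
  "kaehler_metric n L U V = normal_metric n L (sqrt_neg_ad_sq n L U) V"

definition has_mat_derivative :: "nat \<Rightarrow> (real \<Rightarrow> complex mat) \<Rightarrow> complex mat \<Rightarrow> real \<Rightarrow> bool" where
  "has_mat_derivative n L L' t \<longleftrightarrow> L' \<in> carrier_mat n n \<and>
     (\<forall>i<n. \<forall>j<n. ((\<lambda>s. L s $$ (i, j)) has_vector_derivative L' $$ (i, j)) (at t))"

text \<open>\<open>G\<close> is the gradient at \<open>L\<close>, for the Kaehler metric, of the restriction of \<open>H\<close> to the orbit:
  \<open>G\<close> is tangent and represents the differential of \<open>H\<close> on the tangent space. \<open>H\<close> is given on
  all matrices, so its differential along a tangent vector is a directional derivative.\<close>

definition is_kaehler_gradient ::
  "nat \<Rightarrow> (complex mat \<Rightarrow> real) \<Rightarrow> complex mat \<Rightarrow> complex mat \<Rightarrow> bool" where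
  "is_kaehler_gradient n H L G \<longleftrightarrow> G \<in> ad_image n L \<and>
     (\<forall>V\<in>ad_image n L.
        ((\<lambda>s. H (L + complex_of_real s \<cdot>\<^sub>m V)) has_real_derivative kaehler_metric n L G V) (at 0))"

definition kaehler_gradient_flow ::
  "nat \<Rightarrow> real vec \<Rightarrow> complex mat \<Rightarrow> complex mat \<Rightarrow> (real \<Rightarrow> complex mat) \<Rightarrow> bool" where
  "kaehler_gradient_flow n lam N M0 M \<longleftrightarrow> M 0 = M0 \<and>
     (\<forall>t. M t \<in> orbit n lam \<and>
        (\<exists>G. is_kaehler_gradient n (\<lambda>A. kappa n A N) (M t) G \<and> has_mat_derivative n M G t))"

definition toda_flow :: "nat \<Rightarrow> complex mat \<Rightarrow> (real \<Rightarrow> complex mat) \<Rightarrow> bool" where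
  "toda_flow n L0 L \<longleftrightarrow> L 0 = L0 \<and>
     (\<forall>t. L t \<in> carrier_mat n n \<and>
        has_mat_derivative n L (bracket (L t) (proj_u n (- \<i> \<cdot>\<^sub>m L t))) t)"

end

theory Submission
  imports Defs
begin

text \<open>
  Put \<open>\<Lambda> = Diag \<lambda>\<close>, \<open>L\<^sub>0 = g\<^sub>0 (\<i> \<Lambda>) g\<^sub>0\<^sup>*\<close> and \<open>h\<^sub>0 = \<delta> g\<^sub>0\<^sup>* \<delta>\<close>. The QR factorization
  \<open>exp(t \<Lambda>) h\<^sub>0 = h(t) c(t)\<close> integrates both flows: \<open>h (\<i> \<Lambda>) h\<^sup>*\<close> is the Kaehler gradient
  flow, and \<open>g (\<i> \<Lambda>) g\<^sup>*\<close> with \<open>g = \<delta> h\<^sup>* \<delta>\<close> is the Toda flow. Multiplication by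
  positive diagonal matrices on the left and by upper triangular matrices with positive diagonal on
  the right preserves the signs of left-justified minors, so \<open>h(t)\<close> stays nonnegative as soon as
  \<open>h\<^sub>0\<close> is; and solving for \<open>g\<close> gives \<open>g(t) \<in> B g\<^sub>0 B \<inter> B\<^sup>- g\<^sub>0 B\<close>, so the cell is constant.

  What remains is that \<open>g \<mapsto> \<delta> g\<^sup>* \<delta>\<close> preserves nonnegativity of unitary matrices. When all minors
  on consecutive rows are positive, Neville elimination writes \<open>g\<close> as a totally nonnegative lower
  triangular matrix times an upper triangular one, and unitarity forces the inverse of the upper
  factor to be totally nonnegative up to \<open>\<delta>\<close>-conjugation. The general case follows by
  perturbation.
\<close>

subsection \<open>Complex matrices, unitarity and triangularity\<close>

text \<open>The detour through \<open>h\<close> is what gives sign control. Written for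
  \<open>g(t)\<close> directly, the outer triangular factors have off-diagonal entries of unknown
  sign, whereas \<open>h\<close> only meets the positive diagonal matrix
  \<open>exp(t \<Lambda>)\<close> on the left, for every real time. The price is the statement on
  sign-conjugated adjoints. Elimination for it needs strictly positive minors, which boundary points
  such as permutation matrices lack. The form of the claim adds three obligations. The Toda flow is
  an arbitrary solution, so the QR solution must be shown to be the only one. A cell is indexed by a
  Bruhat-comparable pair, and comparability is extracted from the nonempty intersection of the two
  double cosets, not from positivity. The Kaehler metric is built from definite descriptions, each
  of which must be evaluated; in the eigenbasis given by \<open>h\<close> all operators act
  entrywise. There, since \<open>lam\<close> decreases, the sign of \<open>lam_i - lam_j\<close>
  separates the two triangles of a matrix, and exactly this sign turns the Hermitian matrix of the
  height function into its projection \<open>proj_u\<close>.\<close>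

lemma mat_adjoint_carrier [simp]: "A \<in> carrier_mat m n \<Longrightarrow> mat_adjoint A \<in> carrier_mat n m"
  unfolding mat_adjoint_def by (auto simp: mat_of_rows_def)

lemma mat_adjoint_index [simp]:
  fixes A :: "complex mat"
  assumes "i < dim_col A" "j < dim_row A"
  shows "mat_adjoint A $$ (i, j) = cnj (A $$ (j, i))"
  using assms unfolding mat_adjoint_def by (simp add: mat_of_rows_def)

lemma mat_adjoint_dim [simp]:
  "dim_row (mat_adjoint A) = dim_col A" "dim_col (mat_adjoint A) = dim_row A"
  unfolding mat_adjoint_def by auto

lemma index_mult_sum:
  assumes "A \<in> carrier_mat m n" "B \<in> carrier_mat n p" "i < m" "j < p"
  shows "(A * B) $$ (i, j) = (\<Sum>k<n. A $$ (i, k) * B $$ (k, j))"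
  using assms by (auto simp: scalar_prod_def atLeast0LessThan)

declare index_mult_mat(1) [simp del]

lemma complex_mult_nonneg: "0 \<le> (x :: complex) \<Longrightarrow> 0 \<le> y \<Longrightarrow> 0 \<le> x * y"
  by (simp add: less_eq_complex_def)

lemma complex_mult_pos: "0 < (x :: complex) \<Longrightarrow> 0 < y \<Longrightarrow> 0 < x * y"
  by (simp add: less_complex_def)

lemma complex_prod_nonneg: "(\<And>i. i \<in> I \<Longrightarrow> 0 \<le> (f i :: complex)) \<Longrightarrow> 0 \<le> prod f I"
  by (induction I rule: infinite_finite_induct) (auto intro: complex_mult_nonneg simp: less_eq_complex_def)

lemma complex_prod_pos: "(\<And>i. i \<in> I \<Longrightarrow> 0 < (f i :: complex)) \<Longrightarrow> 0 < prod f I"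
  by (induction I rule: infinite_finite_induct) (auto intro: complex_mult_pos simp: less_complex_def)

lemma mat_adjoint_mult:
  fixes A B :: "complex mat"
  assumes "A \<in> carrier_mat m n" "B \<in> carrier_mat n p"
  shows "mat_adjoint (A * B) = mat_adjoint B * mat_adjoint A"
proof (rule eq_matI)
  fix i j assume "i < dim_row (mat_adjoint B * mat_adjoint A)" "j < dim_col (mat_adjoint B * mat_adjoint A)"
  then have ij: "i < p" "j < m" using assms by auto
  show "mat_adjoint (A * B) $$ (i, j) = (mat_adjoint B * mat_adjoint A) $$ (i, j)"
    using assms ij index_mult_sum[OF assms ij(2,1)]
      index_mult_sum[OF mat_adjoint_carrier[OF assms(2)] mat_adjoint_carrier[OF assms(1)] ij]
    by (simp add: mult.commute)
qed (use assms in auto)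

lemma mat_adjoint_adjoint [simp]: "mat_adjoint (mat_adjoint A) = (A :: complex mat)"
  by (rule eq_matI) auto

lemma mat_adjoint_one [simp]: "mat_adjoint (1\<^sub>m n) = (1\<^sub>m n :: complex mat)"
  by (rule eq_matI) auto

lemma mat_diag_index [simp]: "i < n \<Longrightarrow> j < n \<Longrightarrow> mat_diag n d $$ (i, j) = (if i = j then d j else 0)"
  unfolding mat_diag_def by simp

lemma mat_diag_dims [simp]: "dim_row (mat_diag n d) = n" "dim_col (mat_diag n d) = n"
  unfolding mat_diag_def by auto

lemma mat_adjoint_diag: "mat_adjoint (mat_diag n d) = mat_diag n (\<lambda>i. cnj (d i))"
  by (rule eq_matI) auto

lemma index_diag_mult [simp]:
  "A \<in> carrier_mat n m \<Longrightarrow> i < n \<Longrightarrow> j < m \<Longrightarrow> (mat_diag n d * A) $$ (i, j) = d i * A $$ (i, j)"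
  by (subst mat_diag_mult_left) auto

lemma index_mult_diag [simp]:
  "A \<in> carrier_mat m n \<Longrightarrow> i < m \<Longrightarrow> j < n \<Longrightarrow> (A * mat_diag n d) $$ (i, j) = A $$ (i, j) * d j"
  by (subst mat_diag_mult_right) auto

lemma square_mult_carrier [simp]:
  "A \<in> carrier_mat n n \<Longrightarrow> B \<in> carrier_mat n n \<Longrightarrow> A * B \<in> carrier_mat n n"
  by (rule mult_carrier_mat)

lemma mult_assoc:
  "A \<in> carrier_mat n n \<Longrightarrow> B \<in> carrier_mat n n \<Longrightarrow> C \<in> carrier_mat n n \<Longrightarrow> A * B * C = A * (B * C)"
  for A :: "'a :: semiring_0 mat"
  by (rule assoc_mult_mat)

lemma left_inverse_right_inverse:
  fixes A B :: "complex mat"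
  assumes "A \<in> carrier_mat n n" "B \<in> carrier_mat n n" "A * B = 1\<^sub>m n"
  shows "B * A = 1\<^sub>m n"
  using mat_mult_left_right_inverse[OF assms] .

lemma det_nonzero_inverse:
  fixes A :: "complex mat"
  assumes "A \<in> carrier_mat n n" "det A \<noteq> 0"
  obtains B where "B \<in> carrier_mat n n" "A * B = 1\<^sub>m n" "B * A = 1\<^sub>m n"
  using det_non_zero_imp_unit[OF assms, of undefined] by (auto simp: Units_def ring_mat_def)

lemma inverse_det_nonzero:
  fixes A B :: "complex mat"
  assumes "A \<in> carrier_mat n n" "B \<in> carrier_mat n n" "A * B = 1\<^sub>m n"
  shows "det A \<noteq> 0"
  using det_mult[OF assms(1,2)] assms(3) by auto

lemma mult_left_cancel_det:
  fixes A B C :: "complex mat"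
  assumes "A \<in> carrier_mat n n" "det A \<noteq> 0" "B \<in> carrier_mat n m" "C \<in> carrier_mat n m" "A * B = A * C"
  shows "B = C"
proof -
  obtain A' where A': "A' \<in> carrier_mat n n" "A' * A = 1\<^sub>m n"
    using det_nonzero_inverse[OF assms(1,2)] by metis
  have "A' * (A * B) = A' * (A * C)" using assms(5) by simp
  then have "(A' * A) * B = (A' * A) * C"
    using assoc_mult_mat[OF A'(1) assms(1) assms(3)] assoc_mult_mat[OF A'(1) assms(1) assms(4)] by simp
  then show ?thesis using A' assms by simp
qed

lemma invertible_mat_iff_det:
  fixes A :: "complex mat"
  assumes "A \<in> carrier_mat n n"
  shows "invertible_mat A \<longleftrightarrow> det A \<noteq> 0"
proof
  assume "invertible_mat A"
  then obtain B where B: "A * B = 1\<^sub>m (dim_row A)" "B * A = 1\<^sub>m (dim_row B)"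
    unfolding invertible_mat_def inverts_mat_def by auto
  have "B \<in> carrier_mat n n"
    using assms arg_cong[OF B(1), of dim_col] arg_cong[OF B(2), of dim_col] by auto
  then show "det A \<noteq> 0" using inverse_det_nonzero[OF assms] B(1) assms by auto
next
  assume "det A \<noteq> 0"
  then obtain B where "B \<in> carrier_mat n n" "A * B = 1\<^sub>m n" "B * A = 1\<^sub>m n"
    using det_nonzero_inverse[OF assms] by metis
  then show "invertible_mat A"
    using assms unfolding invertible_mat_def inverts_mat_def by (auto simp: square_mat.simps)
qed

text \<open>The \<open>None\<close> outcome of \<open>mat_inverse\<close> would deny that
  \<open>g\<close> is a unit, and in the \<open>Some\<close> case two right inverses agree after
  cancelling \<open>g\<close>. For unitary \<open>g\<close> this turns \<open>minv\<close> into the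
  adjoint.\<close>

lemma minv_eq:
  assumes "g \<in> carrier_mat n n" "h \<in> carrier_mat n n" "g * h = 1\<^sub>m n"
  shows "minv g = h"
proof (cases "mat_inverse g")
  case None
  obtain B where "B \<in> carrier_mat n n" "g * B = 1\<^sub>m n" "B * g = 1\<^sub>m n"
    using left_inverse_right_inverse[OF assms] assms by blast
  then have "g \<in> Units (ring_mat TYPE(complex) n ())"
    using assms by (auto simp: Units_def ring_mat_def)
  with mat_inverse(1)[OF assms(1) None, where b = "()"] show ?thesis by simp
next
  case (Some B)
  have "g * B = 1\<^sub>m n" "B \<in> carrier_mat n n" using mat_inverse(2)[OF assms(1) Some] by auto
  with assms have "B = h"
    by (metis inverse_det_nonzero mult_left_cancel_det)
  with Some show ?thesis by (simp add: minv_def)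
qed

lemma unitary_groupD:
  assumes "g \<in> unitary_group n"
  shows "g \<in> carrier_mat n n" "g * mat_adjoint g = 1\<^sub>m n" "mat_adjoint g * g = 1\<^sub>m n"
    "det g \<noteq> 0" "minv g = mat_adjoint g"
proof -
  show *: "g \<in> carrier_mat n n" "g * mat_adjoint g = 1\<^sub>m n" "mat_adjoint g * g = 1\<^sub>m n"
    using assms by (auto simp: unitary_group_def)
  show "det g \<noteq> 0" using inverse_det_nonzero[OF *(1) _ *(2)] * by simp
  show "minv g = mat_adjoint g" by (rule minv_eq[OF *(1) _ *(2)]) (use * in simp)
qed

lemma unitary_groupI:
  assumes "g \<in> carrier_mat n n" "mat_adjoint g * g = 1\<^sub>m n"
  shows "g \<in> unitary_group n"
  using assms left_inverse_right_inverse[of "mat_adjoint g" n g] by (simp add: unitary_group_def)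

lemma unitary_adjoint: "g \<in> unitary_group n \<Longrightarrow> mat_adjoint g \<in> unitary_group n"
  by (auto simp: unitary_group_def)

lemma unitary_mult:
  assumes "g \<in> unitary_group n" "h \<in> unitary_group n"
  shows "g * h \<in> unitary_group n"
proof (rule unitary_groupI)
  note G = unitary_groupD[OF assms(1)] and H = unitary_groupD[OF assms(2)]
  show "g * h \<in> carrier_mat n n" using G H by simp
  have "mat_adjoint (g * h) * (g * h) = mat_adjoint h * ((mat_adjoint g * g) * h)"
    using G(1) H(1) by (simp add: mat_adjoint_mult[OF G(1) H(1)] mult_assoc[of _ n])
  then show "mat_adjoint (g * h) * (g * h) = 1\<^sub>m n" using G H by simp
qed

text \<open>Columns of a unitary matrix are unit vectors. In the perturbation argument this uniform
  bound takes the place of compactness of the unitary group.\<close>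

lemma unitary_entry_bound:
  assumes "g \<in> unitary_group n" "i < n" "j < n"
  shows "cmod (g $$ (i, j)) \<le> 1"
proof -
  note G = unitary_groupD[OF assms(1)]
  have "complex_of_real (\<Sum>k<n. (cmod (g $$ (k, j)))\<^sup>2) = (mat_adjoint g * g) $$ (j, j)"
    using G(1) assms by (simp add: index_mult_sum[of _ n n _ n] complex_norm_square[symmetric] mult.commute[of "cnj _"])
  also have "\<dots> = complex_of_real 1" using G assms by simp
  finally have 1: "(\<Sum>k<n. (cmod (g $$ (k, j)))\<^sup>2) = 1" using of_real_eq_iff by blast
  have "(cmod (g $$ (i, j)))\<^sup>2 \<le> (\<Sum>k<n. (cmod (g $$ (k, j)))\<^sup>2)"
    by (rule member_le_sum) (use assms in auto)
  then show ?thesis using 1 by (simp add: power_le_one_iff abs_square_le_1)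
qed

text \<open>In the order on complex numbers \<open>0 < z\<close> says that \<open>z\<close> is real
  and positive. These are the triangular factors for which the QR factorization is unique and which
  do not change signs of left-justified minors.\<close>

definition pos_upper :: "nat \<Rightarrow> complex mat set" where
  "pos_upper n = {b \<in> carrier_mat n n. upper_triangular b \<and> (\<forall>i<n. 0 < b $$ (i, i))}"

lemma upper_triangular_mult:
  assumes "A \<in> carrier_mat n n" "B \<in> carrier_mat n n" "upper_triangular A" "upper_triangular B"
  shows "upper_triangular (A * B)" and "i < n \<Longrightarrow> (A * B) $$ (i, i) = A $$ (i, i) * B $$ (i, i)"
proof -
  have *: "A $$ (i, k) * B $$ (k, j) = 0" if "i < n" "j < n" "k < n" "j \<le> i" "k \<noteq> i \<or> j < i" for i j k
    using that assms by (cases "k < i") (auto simp: upper_triangular_def)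
  show "upper_triangular (A * B)"
    using assms * by (auto simp: upper_triangular_def index_mult_sum[of _ n n _ n] intro!: sum.neutral)
  show "(A * B) $$ (i, i) = A $$ (i, i) * B $$ (i, i)" if "i < n"
  proof -
    have "(A * B) $$ (i, i) = (\<Sum>k\<in>{i}. A $$ (i, k) * B $$ (k, i))"
      unfolding index_mult_sum[OF assms(1,2) that that]
      by (rule sum.mono_neutral_right) (use that * in auto)
    then show ?thesis by simp
  qed
qed

lemma upper_triangular_det:
  assumes "A \<in> carrier_mat n n" "upper_triangular A"
  shows "det A = (\<Prod>i<n. A $$ (i, i))"
  using det_upper_triangular[OF assms(2,1)] assms(1) by (simp add: prod_list_diag_prod atLeast0LessThan)

lemma pos_upper_det: "b \<in> pos_upper n \<Longrightarrow> det b \<noteq> 0"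
  using upper_triangular_det[of b n] by (auto simp: pos_upper_def)

text \<open>Entry \<open>(i, j)\<close> of the product with \<open>j < i\<close> collapses to
  \<open>S_ij c_jj\<close>: terms with smaller middle index vanish by induction on \<open>j\<close>,
  terms with larger one because \<open>c\<close> is triangular. Arguing on the product avoids
  forming the inverse of \<open>c\<close>.\<close>

lemma upper_triangular_factor:
  fixes S c :: "complex mat"
  assumes S: "S \<in> carrier_mat n n" and c: "c \<in> carrier_mat n n" "upper_triangular c"
    and nz: "\<And>i. i < n \<Longrightarrow> c $$ (i, i) \<noteq> 0" and Sc: "upper_triangular (S * c)"
  shows "upper_triangular S" and "i < n \<Longrightarrow> (S * c) $$ (i, i) = S $$ (i, i) * c $$ (i, i)"
proof -
  have *: "j < i \<longrightarrow> S $$ (i, j) = 0" if "i < n" for i j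
  proof (induction j rule: less_induct)
    case (less j)
    show ?case
    proof
      assume ji: "j < i"
      have "0 = (S * c) $$ (i, j)" using Sc ji that S by (auto simp: upper_triangular_def)
      also have "\<dots> = (\<Sum>k<n. S $$ (i, k) * c $$ (k, j))"
        using index_mult_sum[OF S c(1)] that ji by simp
      also have "\<dots> = (\<Sum>k\<in>{j}. S $$ (i, k) * c $$ (k, j))"
      proof (rule sum.mono_neutral_right)
        show "\<forall>k\<in>{..<n} - {j}. S $$ (i, k) * c $$ (k, j) = 0"
        proof
          fix k assume k: "k \<in> {..<n} - {j}"
          show "S $$ (i, k) * c $$ (k, j) = 0"
            by (cases "k < j") (use k less ji c in \<open>auto simp: upper_triangular_def\<close>)
        qed
      qed (use that ji in auto)
      finally have "S $$ (i, j) = 0 \<or> c $$ (j, j) = 0" by simp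
      then show "S $$ (i, j) = 0" using nz[of j] that ji by linarith
    qed
  qed
  then show *: "upper_triangular S" using S by (auto simp: upper_triangular_def)
  show "i < n \<Longrightarrow> (S * c) $$ (i, i) = S $$ (i, i) * c $$ (i, i)"
    using upper_triangular_mult(2)[OF S c(1) * c(2)] by simp
qed

subsection \<open>Left-justified minors\<close>

text \<open>An increasing enumeration stands for the row set, so that exchanging one row is the
  function update \<open>f(m := r)\<close>.\<close>

definition row_choice :: "nat \<Rightarrow> nat \<Rightarrow> (nat \<Rightarrow> nat) \<Rightarrow> bool" where
  "row_choice n k f \<longleftrightarrow> (\<forall>i<k. f i < n) \<and> (\<forall>i j. i < j \<longrightarrow> j < k \<longrightarrow> f i < f j)"

definition left_minor :: "complex mat \<Rightarrow> nat \<Rightarrow> (nat \<Rightarrow> nat) \<Rightarrow> complex" where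
  "left_minor A k f = det (mat k k (\<lambda>(i, j). A $$ (f i, j)))"

definition tnn_flag :: "nat \<Rightarrow> complex mat \<Rightarrow> bool" where
  "tnn_flag n A \<longleftrightarrow> (\<forall>k f. row_choice n k f \<longrightarrow> 0 \<le> left_minor A k f)"

lemma row_choice_less: "row_choice n k f \<Longrightarrow> i < j \<Longrightarrow> j < k \<Longrightarrow> f i < f j"
  by (simp add: row_choice_def)

lemma row_choice_bound: "row_choice n k f \<Longrightarrow> i < k \<Longrightarrow> f i < n"
  by (simp add: row_choice_def)

lemma row_choice_inj: "row_choice n k f \<Longrightarrow> inj_on f {..<k}"
  by (rule inj_onI) (metis lessThan_iff linorder_neqE_nat nat_neq_iff row_choice_less)

lemma row_choice_ge: "row_choice n k f \<Longrightarrow> i < k \<Longrightarrow> i \<le> f i"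
proof (induction i)
  case (Suc i)
  then have "i \<le> f i" "f i < f (Suc i)" by (auto simp: row_choice_def)
  then show ?case by simp
qed simp

lemma row_choice_le: "row_choice n k f \<Longrightarrow> k \<le> n"
proof (cases k)
  case (Suc m)
  assume a: "row_choice n k f"
  then have "m \<le> f m" "f m < n" using row_choice_ge[OF a, of m] Suc by (auto simp: row_choice_def)
  with Suc show ?thesis by simp
qed simp

text \<open>Both directions rest on \<open>pick I\<close> being the increasing enumeration of
  \<open>I\<close>. Conversely a row choice is recovered from its image, because exactly
  \<open>i\<close> elements of the image lie below \<open>f i\<close>.\<close>

lemma left_minors_nonneg_iff:
  assumes A: "A \<in> carrier_mat n n"
  shows "left_minors_nonneg n A \<longleftrightarrow> tnn_flag n A"
proof -
  have pickk: "pick {..<k} j = j" if "j < k" for j k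
  proof -
    have "{a \<in> {..<k}. a < j} = {..<j}" using that by auto
    with pick_card_in_set[of j "{..<k}"] that show ?thesis by simp
  qed
  have key: "det (submatrix A I {..<card I}) = left_minor A (card I) f"
    if I: "I \<subseteq> {..<n}" and f: "\<And>i. i < card I \<Longrightarrow> pick I i = f i" for I f
  proof -
    have "card I \<le> n" using card_mono[OF _ I] by simp
    then have "{j. j < n \<and> j \<in> {..<card I}} = {..<card I}" by auto
    moreover have "{i. i < n \<and> i \<in> I} = I" using I by blast
    moreover have "dim_row A = n" "dim_col A = n" using A by auto
    ultimately have "submatrix A I {..<card I} = mat (card I) (card I) (\<lambda>(i, j). A $$ (pick I i, pick {..<card I} j))"
      by (simp only: submatrix_def card_lessThan)
    also have "\<dots> = mat (card I) (card I) (\<lambda>(i, j). A $$ (f i, j))"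
      by (rule eq_matI) (simp_all add: f pickk)
    finally have "submatrix A I {..<card I} = mat (card I) (card I) (\<lambda>(i, j). A $$ (f i, j))" .
    then show ?thesis by (simp add: left_minor_def)
  qed
  have nonneg: "(z \<in> \<real> \<and> 0 \<le> Re z) \<longleftrightarrow> 0 \<le> z" for z
    by (auto simp: less_eq_complex_def complex_is_Real_iff)
  show ?thesis
  proof
    assume L: "left_minors_nonneg n A"
    show "tnn_flag n A"
      unfolding tnn_flag_def
    proof (intro allI impI)
      fix k f assume f: "row_choice n k f"
      define I where "I = f ` {..<k}"
      have inj: "inj_on f {..<k}"
        using row_choice_inj[OF f] .
      then have card: "card I = k" by (simp add: I_def card_image)
      have "pick I i = f i" if "i < k" for i
      proof -
        have "{a \<in> I. a < f i} = f ` {..<i}"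
        proof -
          have "j < i" if "j < k" "f j < f i" for j
          proof (rule ccontr)
            assume "\<not> j < i"
            then have "i = j \<or> i < j" by auto
            then show False using row_choice_less[OF f, of i j] that by auto
          qed
          moreover have "f j < f i" if "j < i" for j
            using row_choice_less[OF f, of j i] that \<open>i < k\<close> by simp
          ultimately show ?thesis using that unfolding I_def by (auto intro!: imageI)
        qed
        moreover have "card (f ` {..<i}) = i"
          using inj_on_subset[OF inj, of "{..<i}"] that by (simp add: card_image)
        ultimately show ?thesis using pick_card_in_set[of "f i" I] that by (auto simp: I_def)
      qed
      moreover have "I \<subseteq> {..<n}" using f by (auto simp: I_def row_choice_def)
      ultimately have "det (submatrix A I {..<card I}) = left_minor A k f"
        using key[of I f] card by simp
      moreover have "det (submatrix A I {..<card I}) \<in> \<real> \<and> 0 \<le> Re (det (submatrix A I {..<card I}))"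
        using L \<open>I \<subseteq> {..<n}\<close> unfolding left_minors_nonneg_def by blast
      ultimately show "0 \<le> left_minor A k f" using nonneg by simp
    qed
  next
    assume T: "tnn_flag n A"
    have "0 \<le> det (submatrix A I {..<card I})" if I: "I \<subseteq> {..<n}" for I
    proof -
      have "finite I" using I finite_subset by blast
      then have "row_choice n (card I) (pick I)"
        using I pick_in_set_le[of _ I] pick_mono_le[of _ I] unfolding row_choice_def by blast
      then show ?thesis using T key[OF I, of "pick I"] by (auto simp: tnn_flag_def)
    qed
    then show "left_minors_nonneg n A" by (simp add: left_minors_nonneg_def nonneg)
  qed
qed

text \<open>The first \<open>k\<close> columns of \<open>A * U\<close> are combinations of the first
  \<open>k\<close> columns of \<open>A\<close> alone, with the leading block of \<open>U\<close> as
  coefficients. This is why left-justified minors suit QR and Bruhat factorizations.\<close>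

lemma left_minor_mult_upper:
  assumes A: "A \<in> carrier_mat n n" and U: "U \<in> carrier_mat n n" "upper_triangular U"
    and f: "row_choice n k f"
  shows "left_minor (A * U) k f = left_minor A k f * (\<Prod>j<k. U $$ (j, j))"
proof -
  have kn: "k \<le> n" using row_choice_le[OF f] .
  let ?A = "mat k k (\<lambda>(i, j). A $$ (f i, j))" and ?U = "mat k k (\<lambda>(i, j). U $$ (i, j))"
  have "mat k k (\<lambda>(i, j). (A * U) $$ (f i, j)) = ?A * ?U"
  proof (rule eq_matI)
    fix i j assume "i < dim_row (?A * ?U)" "j < dim_col (?A * ?U)"
    then have ij: "i < k" "j < k" by auto
    have fi: "f i < n" using f ij by (auto simp: row_choice_def)
    have "(A * U) $$ (f i, j) = (\<Sum>l<n. A $$ (f i, l) * U $$ (l, j))"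
      using index_mult_sum[OF A U(1) fi] ij kn by simp
    also have "\<dots> = (\<Sum>l<k. A $$ (f i, l) * U $$ (l, j))"
      by (rule sum.mono_neutral_right) (use kn ij U in \<open>auto simp: upper_triangular_def\<close>)
    also have "\<dots> = (?A * ?U) $$ (i, j)"
      using ij by (subst index_mult_sum[of _ k k _ k]) auto
    finally show "mat k k (\<lambda>(i, j). (A * U) $$ (f i, j)) $$ (i, j) = (?A * ?U) $$ (i, j)"
      using ij by simp
  qed auto
  moreover have "upper_triangular ?U" using U kn by (auto simp: upper_triangular_def)
  ultimately show ?thesis
    using det_mult[of ?A k ?U] upper_triangular_det[of ?U k] by (simp add: left_minor_def)
qed

lemma left_minor_diag_mult:
  assumes A: "A \<in> carrier_mat n n" and f: "row_choice n k f"
  shows "left_minor (mat_diag n d * A) k f = (\<Prod>i<k. d (f i)) * left_minor A k f"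
proof -
  have kn: "k \<le> n" using row_choice_le[OF f] .
  let ?A = "mat k k (\<lambda>(i, j). A $$ (f i, j))" and ?D = "mat_diag k (\<lambda>i. d (f i))"
  have "mat k k (\<lambda>(i, j). (mat_diag n d * A) $$ (f i, j)) = ?D * ?A"
    using kn row_choice_bound[OF f] A by (intro eq_matI) (simp_all add: index_diag_mult[of _ k k])
  moreover have "det ?D = (\<Prod>i<k. d (f i))"
    by (subst upper_triangular_det[of _ k]) (auto simp: upper_triangular_def)
  ultimately show ?thesis
    using det_mult[of ?D k ?A] by (simp add: left_minor_def)
qed

text \<open>Since \<open>i <= f i\<close> for an increasing choice, the selected block is again
  triangular. Its diagonal entry \<open>U (f i, i)\<close> is a diagonal entry of \<open>U\<close>
  if \<open>f i = i\<close> and zero otherwise.\<close>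

lemma tnn_flag_upper:
  assumes U: "U \<in> carrier_mat n n" "upper_triangular U" and pos: "\<And>i. i < n \<Longrightarrow> 0 \<le> U $$ (i, i)"
  shows "tnn_flag n U"
  unfolding tnn_flag_def
proof (intro allI impI)
  fix k f assume f: "row_choice n k f"
  let ?M = "mat k k (\<lambda>(i, j). U $$ (f i, j))"
  have kn: "k \<le> n" using row_choice_le[OF f] .
  have 0: "U $$ (f i, j) = 0" if "i < k" "j < f i" for i j
    using that f U by (auto simp: upper_triangular_def row_choice_def)
  have "upper_triangular ?M"
    using 0 row_choice_ge[OF f] by (auto simp: upper_triangular_def) (meson order_less_le_trans)
  then have "left_minor U k f = (\<Prod>i<k. U $$ (f i, i))"
    using upper_triangular_det[of ?M k] by (simp add: left_minor_def)
  also have "0 \<le> \<dots>"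
  proof (rule complex_prod_nonneg)
    fix i assume "i \<in> {..<k}"
    then show "0 \<le> U $$ (f i, i)"
      using 0[of i i] row_choice_ge[OF f, of i] pos[of i] kn by (cases "f i = i") auto
  qed
  finally show "0 \<le> left_minor U k f" .
qed

lemma left_minor_id: "A \<in> carrier_mat n n \<Longrightarrow> left_minor A n (\<lambda>i. i) = det A"
  unfolding left_minor_def by (rule arg_cong[where f = det]) (auto intro!: eq_matI)

text \<open>Descending from the full determinant, Laplace expansion of a nonzero minor along its
  last column exhibits a nonzero minor one size smaller, still left-justified because only the last
  column was removed.\<close>

lemma exists_nonzero_left_minor:
  assumes A: "A \<in> carrier_mat n n" "det A \<noteq> 0" and "k \<le> n"
  shows "\<exists>f. row_choice n k f \<and> left_minor A k f \<noteq> 0"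
  using \<open>k \<le> n\<close>
proof (induction rule: inc_induct)
  case base
  have "row_choice n n (\<lambda>i. i)" by (simp add: row_choice_def)
  then show ?case using left_minor_id[OF A(1)] A(2) by metis
next
  case (step k)
  then obtain f where f: "row_choice n (Suc k) f" and nz: "left_minor A (Suc k) f \<noteq> 0" by blast
  let ?M = "mat (Suc k) (Suc k) (\<lambda>(i, j). A $$ (f i, j))"
  have "det ?M = (\<Sum>i<Suc k. ?M $$ (i, k) * cofactor ?M i k)"
    by (rule laplace_expansion_column) auto
  then obtain i where i: "i < Suc k" "cofactor ?M i k \<noteq> 0"
    using nz unfolding left_minor_def by (metis (no_types, lifting) lessThan_iff mult_zero_right sum.neutral)
  let ?f = "\<lambda>r. f (if r < i then r else Suc r)"
  have "mat_delete ?M i k = mat k k (\<lambda>(r, s). A $$ (?f r, s))"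
    using i by (intro eq_matI) (auto simp: mat_delete_def)
  then have "left_minor A k ?f \<noteq> 0" using i by (auto simp: cofactor_def left_minor_def)
  moreover have "row_choice n k ?f"
    using i row_choice_less[OF f] row_choice_bound[OF f] by (auto simp: row_choice_def)
  ultimately show ?case by blast
qed

section \<open>Effect of row operations on left-justified minors\<close>

lemma det_row_combination:
  fixes B :: "nat \<Rightarrow> nat \<Rightarrow> complex"
  assumes "m < k"
  shows "det (mat k k (\<lambda>(i, j). if i = m then x j + a * y j else B i j)) =
    det (mat k k (\<lambda>(i, j). if i = m then x j else B i j)) +
    a * det (mat k k (\<lambda>(i, j). if i = m then y j else B i j))"
proof -
  let ?M = "\<lambda>x. mat k k (\<lambda>(i, j). if i = m then x j else B i j)"
  have L: "det (?M x) = (\<Sum>j<k. x j * cofactor (?M (\<lambda>_. 0)) m j)" for x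
  proof -
    have "det (?M x) = (\<Sum>j<k. ?M x $$ (m, j) * cofactor (?M x) m j)"
      by (rule laplace_expansion_row) (use assms in auto)
    also have "\<dots> = (\<Sum>j<k. x j * cofactor (?M (\<lambda>_. 0)) m j)"
    proof (rule sum.cong[OF refl])
      fix j assume "j \<in> {..<k}"
      moreover have "mat_delete (?M x) m j = mat_delete (?M (\<lambda>_. 0)) m j"
        by (intro eq_matI) (auto simp: mat_delete_def)
      ultimately show "?M x $$ (m, j) * cofactor (?M x) m j = x j * cofactor (?M (\<lambda>_. 0)) m j"
        using assms by (simp add: cofactor_def)
    qed
    finally show ?thesis .
  qed
  show ?thesis
    unfolding L[of "\<lambda>j. x j + a * y j"] L[of x] L[of y]
    by (simp add: sum_distrib_left algebra_simps sum.distrib)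
qed

lemma left_minor_addrow:
  assumes A: "A \<in> carrier_mat n n" and f: "row_choice n k f" and m: "m < k" and s: "s < n"
  shows "left_minor (addrow a (f m) s A) k f = left_minor A k f + a * left_minor A k (f(m := s))"
proof -
  have kn: "k \<le> n" using row_choice_le[OF f] .
  have inj: "f i = f m \<longleftrightarrow> i = m" if "i < k" for i
    using row_choice_inj[OF f] m that by (auto simp: inj_on_def)
  have "left_minor (addrow a (f m) s A) k f =
      det (mat k k (\<lambda>(i, j). if i = m then A $$ (f m, j) + a * A $$ (s, j) else A $$ (f i, j)))"
    unfolding left_minor_def using A kn row_choice_bound[OF f] inj
    by (intro arg_cong[where f = det] eq_matI) (auto simp: add.commute, metis)
  also have "\<dots> = det (mat k k (\<lambda>(i, j). if i = m then A $$ (f m, j) else A $$ (f i, j)))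
      + a * det (mat k k (\<lambda>(i, j). if i = m then A $$ (s, j) else A $$ (f i, j)))"
    by (rule det_row_combination[OF m])
  also have "mat k k (\<lambda>(i, j). if i = m then A $$ (f m, j) else A $$ (f i, j)) = mat k k (\<lambda>(i, j). A $$ (f i, j))"
    by (rule eq_matI) auto
  also have "mat k k (\<lambda>(i, j). if i = m then A $$ (s, j) else A $$ (f i, j)) =
      mat k k (\<lambda>(i, j). A $$ ((f(m := s)) i, j))"
    by (rule eq_matI) auto
  finally show ?thesis by (simp add: left_minor_def)
qed

lemma left_minor_addrow_other:
  assumes A: "A \<in> carrier_mat n n" and f: "row_choice n k f" and r: "\<And>i. i < k \<Longrightarrow> f i \<noteq> r"
  shows "left_minor (addrow a r s A) k f = left_minor A k f"
proof -
  have "mat k k (\<lambda>(i, j). addrow a r s A $$ (f i, j)) = mat k k (\<lambda>(i, j). A $$ (f i, j))"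
    using A r row_choice_bound[OF f] row_choice_le[OF f] by (intro eq_matI) auto
  then show ?thesis by (simp add: left_minor_def)
qed

definition adjacent :: "(nat \<times> nat) set" where
  "adjacent = {(r, s). r = Suc s \<or> s = Suc r}"

text \<open>Adjacency avoids signs: replacing a chosen row by its neighbour either keeps the
  enumeration increasing or repeats a row, in which case the extra minor is zero. For distant rows a
  reordering sign could appear.\<close>

lemma left_minor_addrow_adjacent:
  assumes A: "A \<in> carrier_mat n n" and f: "row_choice n k f"
    and rs: "(r, s) \<in> adjacent" "r < n" "s < n"
  shows "left_minor (addrow a r s A) k f = left_minor A k f \<or>
    (\<exists>m<k. row_choice n k (f(m := s)) \<and>
      left_minor (addrow a r s A) k f = left_minor A k f + a * left_minor A k (f(m := s)))"
proof (cases "\<exists>m<k. f m = r")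
  case False
  then show ?thesis using left_minor_addrow_other[OF A f, of r a s] by auto
next
  case True
  then obtain m where m: "m < k" "f m = r" by blast
  have eq: "left_minor (addrow a r s A) k f = left_minor A k f + a * left_minor A k (f(m := s))"
    using left_minor_addrow[OF A f m(1) rs(3)] m by simp
  show ?thesis
  proof (cases "\<exists>i<k. f i = s")
    case True
    then obtain i where i: "i < k" "f i = s" by blast
    have "i \<noteq> m" using i m rs by (auto simp: adjacent_def)
    then have "left_minor A k (f(m := s)) = 0"
      unfolding left_minor_def using i m
      by (intro det_identical_rows[of _ k i m]) (auto intro!: eq_vecI)
    then show ?thesis using eq by simp
  next
    case False
    have "row_choice n k (f(m := s))"
      unfolding row_choice_def
    proof (intro conjI allI impI)
      fix i assume "i < k"
      then show "(f(m := s)) i < n" using row_choice_bound[OF f] rs by simp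
    next
      fix i j assume ij: "i < j" "j < k"
      have "f i < f j" "f i \<noteq> s" "f j \<noteq> s" using row_choice_less[OF f ij] False ij by auto
      then show "(f(m := s)) i < (f(m := s)) j" using m(2) rs(1) ij(1) by (auto simp: adjacent_def)
    qed
    then show ?thesis using eq m by blast
  qed
qed

lemma tnn_flag_addrow:
  assumes "A \<in> carrier_mat n n" "tnn_flag n A" "(r, s) \<in> adjacent" "r < n" "s < n" "0 \<le> a"
  shows "tnn_flag n (addrow a r s A)"
    and "row_choice n k f \<Longrightarrow> left_minor A k f \<le> left_minor (addrow a r s A) k f"
proof -
  show *: "left_minor A k f \<le> left_minor (addrow a r s A) k f" if f: "row_choice n k f" for k f
    using left_minor_addrow_adjacent[OF assms(1) f assms(3-5), of a] assms(2,6)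
    by (auto simp: tnn_flag_def complex_mult_nonneg)
  then show "tnn_flag n (addrow a r s A)"
    using assms(2) unfolding tnn_flag_def by (meson order_trans)
qed

lemma tnn_flag_diag_mult:
  assumes "A \<in> carrier_mat n n" "tnn_flag n A" "\<And>i. i < n \<Longrightarrow> 0 \<le> d i"
  shows "tnn_flag n (mat_diag n d * A)"
  using assms by (auto simp: tnn_flag_def left_minor_diag_mult intro!: complex_mult_nonneg complex_prod_nonneg
    dest: row_choice_bound)

lemma tnn_flag_mult_upper:
  assumes "A \<in> carrier_mat n n" "tnn_flag n A" "U \<in> pos_upper n"
  shows "tnn_flag n (A * U)"
  using assms by (auto simp: tnn_flag_def pos_upper_def left_minor_mult_upper less_imp_le
    intro!: complex_mult_nonneg complex_prod_nonneg dest: row_choice_le)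

subsection \<open>Totally nonnegative matrices\<close>

text \<open>The semigroup generated by the positive diagonal matrices and the elementary matrices
  that add a nonnegative multiple of row \<open>s\<close> to row \<open>r\<close>, for \<open>(r, s) \<in> E\<close>.\<close>

inductive_set tnn :: "nat \<Rightarrow> (nat \<times> nat) set \<Rightarrow> complex mat set" for n E where
  one: "1\<^sub>m n \<in> tnn n E"
| diag: "(\<And>i. i < n \<Longrightarrow> 0 < d i) \<Longrightarrow> A \<in> tnn n E \<Longrightarrow> mat_diag n d * A \<in> tnn n E"
| add: "(r, s) \<in> E \<Longrightarrow> r < n \<Longrightarrow> s < n \<Longrightarrow> 0 \<le> a \<Longrightarrow> A \<in> tnn n E \<Longrightarrow> addrow_mat n a r s * A \<in> tnn n E"

lemma tnn_carrier: "A \<in> tnn n E \<Longrightarrow> A \<in> carrier_mat n n"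
  by (induction rule: tnn.induct) auto

lemma tnn_mult: "A \<in> tnn n E \<Longrightarrow> B \<in> tnn n E \<Longrightarrow> A * B \<in> tnn n E"
proof (induction rule: tnn.induct)
  case (diag d A)
  then show ?case using tnn.diag[of n d "A * B" E] tnn_carrier[of A n E] tnn_carrier[of B n E] by (simp add: mult_assoc[of _ n])
next
  case (add r s a A)
  then show ?case using tnn.add[of r s E n a "A * B"] tnn_carrier[of A n E] tnn_carrier[of B n E] by (simp add: mult_assoc[of _ n])
qed (use tnn_carrier[of B n E] in auto)

lemma tnn_addrow_mat: "(r, s) \<in> E \<Longrightarrow> r < n \<Longrightarrow> s < n \<Longrightarrow> 0 \<le> a \<Longrightarrow> addrow_mat n a r s \<in> tnn n E"
  using tnn.add[OF _ _ _ _ tnn.one, of r s E n a] by simp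

lemma tnn_diag: "(\<And>i. i < n \<Longrightarrow> 0 < d i) \<Longrightarrow> mat_diag n d \<in> tnn n E"
  using tnn.diag[OF _ tnn.one, of n d E] by simp

lemma tnn_addrow:
  assumes "(r, s) \<in> E" "r < n" "s < n" "0 \<le> a" "A \<in> tnn n E"
  shows "addrow a r s A \<in> tnn n E"
  using tnn.add[OF assms] addrow_mat[OF tnn_carrier[OF assms(5)] assms(3), of a r] by simp

lemma complex_nonneg_cnj: "0 \<le> (a :: complex) \<Longrightarrow> cnj a = a"
  by (simp add: complex_eq_iff less_eq_complex_def)

lemma mat_adjoint_addrow_mat: "0 \<le> (a :: complex) \<Longrightarrow> mat_adjoint (addrow_mat n a r s) = addrow_mat n a s r"
  using complex_nonneg_cnj by (intro eq_matI) (auto simp: Let_def addrow_mat_def)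

lemma tnn_adjoint: "A \<in> tnn n E \<Longrightarrow> mat_adjoint A \<in> tnn n (E\<inverse>)"
proof (induction rule: tnn.induct)
  case (diag d A)
  have "mat_diag n (\<lambda>i. cnj (d i)) \<in> tnn n (E\<inverse>)"
    by (rule tnn_diag) (use diag in \<open>simp add: less_complex_def\<close>)
  then show ?case
    using diag tnn_carrier[of A n E] tnn_mult
    by (simp add: mat_adjoint_mult[of _ n n _ n] mat_adjoint_diag)
next
  case (add r s a A)
  then show ?case
    using tnn_carrier[of A n E] tnn_mult tnn_addrow_mat[of s r "E\<inverse>" n a]
    by (simp add: mat_adjoint_mult[of _ n n _ n] mat_adjoint_addrow_mat)
qed (auto intro: tnn.intros)

lemma pos_upper_mult: "A \<in> pos_upper n \<Longrightarrow> B \<in> pos_upper n \<Longrightarrow> A * B \<in> pos_upper n"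
  using upper_triangular_mult[of A n B] by (auto simp: pos_upper_def complex_mult_pos)

lemma tnn_pos_upper:
  assumes "A \<in> tnn n E" "\<And>r s. (r, s) \<in> E \<Longrightarrow> r < s"
  shows "A \<in> pos_upper n"
  using assms(1)
proof (induction rule: tnn.induct)
  case one
  then show ?case by (auto simp: pos_upper_def less_complex_def)
next
  case (diag d A)
  then have "mat_diag n d \<in> pos_upper n" by (auto simp: pos_upper_def)
  then show ?case using diag pos_upper_mult by blast
next
  case (add r s a A)
  then have "addrow_mat n a r s \<in> pos_upper n" using assms(2)[of r s]
    by (auto simp: pos_upper_def Let_def less_complex_def upper_triangular_def)
  then show ?case using add pos_upper_mult by blast
qed

section \<open>Conjugation by the alternating sign matrix\<close>

lemma delta_carrier [simp]: "delta n \<in> carrier_mat n n"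
  by (simp add: delta_def)

lemma delta_dims [simp]: "dim_row (delta n) = n" "dim_col (delta n) = n"
  by (simp_all add: delta_def)

lemma delta_square [simp]: "delta n * delta n = 1\<^sub>m n"
  by (simp add: delta_def power_mult_distrib[symmetric])

lemma delta_adjoint [simp]: "mat_adjoint (delta n) = delta n"
  by (simp add: delta_def mat_adjoint_diag)

definition dconj :: "nat \<Rightarrow> complex mat \<Rightarrow> complex mat" where
  "dconj n A = delta n * A * delta n"

lemma dconj_carrier [simp]: "A \<in> carrier_mat n n \<Longrightarrow> dconj n A \<in> carrier_mat n n"
  by (simp add: dconj_def)

lemma dconj_dims [simp]: "dim_row (dconj n A) = n" "dim_col (dconj n A) = n"
  by (simp_all add: dconj_def)

lemma dconj_index [simp]:
  "A \<in> carrier_mat n n \<Longrightarrow> i < n \<Longrightarrow> j < n \<Longrightarrow> dconj n A $$ (i, j) = (- 1) ^ i * A $$ (i, j) * (- 1) ^ j"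
  by (simp add: dconj_def delta_def index_mult_diag[of _ n n])

lemma dconj_mult:
  assumes "A \<in> carrier_mat n n" "B \<in> carrier_mat n n"
  shows "dconj n (A * B) = dconj n A * dconj n B"
proof -
  have "dconj n A * dconj n B = delta n * (A * ((delta n * delta n) * (B * delta n)))"
    using assms unfolding dconj_def by (simp add: mult_assoc[of _ n] del: delta_square)
  then show ?thesis using assms unfolding dconj_def by (simp add: mult_assoc[of _ n])
qed

lemma dconj_one [simp]: "dconj n (1\<^sub>m n) = 1\<^sub>m n"
  using delta_square by (simp add: dconj_def)

lemma sign_mult_sign [simp]: "(- 1) ^ i * x * (- 1) ^ i = (x :: complex)"
  by (metis (no_types) left_minus_one_mult_self mult.commute mult.left_commute)

lemma dconj_diag [simp]: "dconj n (mat_diag n d) = mat_diag n d"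
  by (rule eq_matI) auto

lemma dconj_dconj [simp]: "A \<in> carrier_mat n n \<Longrightarrow> dconj n (dconj n A) = A"
proof -
  assume A: "A \<in> carrier_mat n n"
  have "dconj n (dconj n A) = (delta n * delta n) * (A * (delta n * delta n))"
    using A unfolding dconj_def by (simp add: mult_assoc[of _ n] del: delta_square)
  then show ?thesis using A by simp
qed

lemma dconj_adjoint: "A \<in> carrier_mat n n \<Longrightarrow> mat_adjoint (dconj n A) = dconj n (mat_adjoint A)"
  by (simp add: dconj_def mat_adjoint_mult[of _ n n _ n] mult_assoc[of _ n])

lemma dconj_pos_upper: "A \<in> pos_upper n \<Longrightarrow> dconj n A \<in> pos_upper n"
  by (auto simp: pos_upper_def upper_triangular_def)

text \<open>Inverting an elementary matrix negates its coefficient, and so does conjugation by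
  \<open>delta\<close> when \<open>r + s\<close> is odd, which adjacency guarantees; diagonal
  matrices are fixed by the conjugation. The generators of the inverse appear in reverse order,
  hence the multiplication on the right.\<close>

lemma tnn_signed_inverse:
  assumes "A \<in> tnn n E" "E \<subseteq> adjacent"
  shows "\<exists>A'\<in>tnn n E. dconj n A' * A = 1\<^sub>m n"
  using assms(1)
proof (induction rule: tnn.induct)
  case one
  then show ?case by (intro bexI[OF _ tnn.one]) simp
next
  case (diag d A)
  then obtain A' where A': "A' \<in> tnn n E" "dconj n A' * A = 1\<^sub>m n" by blast
  have c: "A \<in> carrier_mat n n" "A' \<in> carrier_mat n n" using diag A' tnn_carrier by blast+
  let ?D = "mat_diag n (\<lambda>i. inverse (d i))"
  have pos: "0 < inverse x" if "0 < x" for x :: complex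
    using that by (auto simp: less_complex_def)
  have "d i \<noteq> 0" if "i < n" for i using diag(1)[OF that] by auto
  then have "?D * mat_diag n d = 1\<^sub>m n" by (intro eq_matI) auto
  moreover have "dconj n (A' * ?D) * (mat_diag n d * A) = dconj n A' * ((?D * mat_diag n d) * A)"
    using c by (simp add: dconj_mult mult_assoc[of _ n] del: mat_diag_diag)
  ultimately have "dconj n (A' * ?D) * (mat_diag n d * A) = 1\<^sub>m n" using A' c by simp
  moreover have "A' * ?D \<in> tnn n E"
    by (intro tnn_mult A'(1) tnn_diag pos diag)
  ultimately show ?case by blast
next
  case (add r s a A)
  then obtain A' where A': "A' \<in> tnn n E" "dconj n A' * A = 1\<^sub>m n" by blast
  have c: "A \<in> carrier_mat n n" "A' \<in> carrier_mat n n" using add A' tnn_carrier by blast+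
  let ?X = "addrow_mat n a r s"
  have "odd (r + s)" "r \<noteq> s" using add(1) assms(2) by (auto simp: adjacent_def)
  then have "dconj n ?X = addrow_mat n (- a) r s"
    by (intro eq_matI) (auto simp: Let_def simp flip: power_add)
  then have "dconj n ?X * ?X = 1\<^sub>m n"
    using addrow_mat_inv[OF add(2,3) \<open>r \<noteq> s\<close>, of "- a"] by simp
  moreover have "dconj n (A' * ?X) * (?X * A) = dconj n A' * ((dconj n ?X * ?X) * A)"
    using c by (simp add: dconj_mult mult_assoc[of _ n])
  ultimately have "dconj n (A' * ?X) * (?X * A) = 1\<^sub>m n" using A' c by simp
  moreover have "A' * ?X \<in> tnn n E" using tnn_mult[OF A'(1) tnn_addrow_mat] add by blast
  ultimately show ?case by blast
qed

lemma tnn_mult_tnn_flag: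
  assumes "A \<in> tnn n E" "E \<subseteq> adjacent" "B \<in> carrier_mat n n" "tnn_flag n B"
  shows "tnn_flag n (A * B)"
  using assms(1)
proof (induction rule: tnn.induct)
  case one
  then show ?case using assms by simp
next
  case (diag d A)
  then show ?case
    using tnn_flag_diag_mult[of "A * B" n d] tnn_carrier[of A n E] assms
    by (simp add: mult_assoc[of _ n] less_imp_le)
next
  case (add r s a A)
  have "addrow_mat n a r s * A * B = addrow a r s (A * B)"
    using addrow_mat[of "A * B" n n s a r] add tnn_carrier[of A n E] assms by (simp add: mult_assoc[of _ n])
  then show ?case
    using tnn_flag_addrow(1)[of "A * B" n r s a] add tnn_carrier[of A n E] assms by auto
qed

lemma tnn_tnn_flag: "A \<in> tnn n E \<Longrightarrow> E \<subseteq> adjacent \<Longrightarrow> tnn_flag n A"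
  using tnn_mult_tnn_flag[of A n E "1\<^sub>m n"] tnn_flag_upper[of "1\<^sub>m n" n] tnn_carrier[of A n E]
  by (simp add: less_eq_complex_def)

section \<open>Exchanging upper and lower totally nonnegative factors\<close>

definition low_pairs :: "(nat \<times> nat) set" where "low_pairs = {(Suc i, i) | i. True}"

abbreviation tnn_low :: "nat \<Rightarrow> complex mat set" where "tnn_low n \<equiv> tnn n low_pairs"
abbreviation tnn_up :: "nat \<Rightarrow> complex mat set" where "tnn_up n \<equiv> tnn n (low_pairs\<inverse>)"

lemma low_pairs_adjacent: "low_pairs \<subseteq> adjacent" "low_pairs\<inverse> \<subseteq> adjacent"
  by (auto simp: low_pairs_def adjacent_def)

lemma complex_inverse_pos: "0 < (x :: complex) \<Longrightarrow> 0 < inverse x"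
  by (auto simp: less_complex_def)

lemma complex_divide_pos: "0 < (x :: complex) \<Longrightarrow> 0 < y \<Longrightarrow> 0 < x / y"
  by (simp add: divide_inverse complex_mult_pos complex_inverse_pos)

lemma complex_divide_nonneg: "0 \<le> (x :: complex) \<Longrightarrow> 0 < y \<Longrightarrow> 0 \<le> x / y"
  using complex_mult_nonneg[OF _ less_imp_le[OF complex_inverse_pos]] by (simp add: divide_inverse)

lemma addrow_diag_mult:
  fixes A :: "complex mat"
  assumes "A \<in> carrier_mat n n" "d r \<noteq> 0" "r < n" "s < n" "r \<noteq> s"
  shows "addrow b r s (mat_diag n d * A) = mat_diag n d * addrow (b * d s / d r) r s A"
  using assms by (intro eq_matI) (auto simp: index_diag_mult[of _ n n] field_simps)

lemma addrow_commute_same_row: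
  assumes "A \<in> carrier_mat n n" "r \<noteq> s'" "s \<noteq> r'" "r < n" "s < n" "r' < n" "s' < n"
  shows "addrow b r s (addrow a r' s' A) = addrow a r' s' (addrow b r s (A :: complex mat))"
  using assms by (intro eq_matI) auto

text \<open>The exchange relation in \<open>SL\<^sub>2\<close>:
  \<open>x(b) y(a) = y(a/t) diag(t, 1/t) x(b/t)\<close> with \<open>t = 1 + a b\<close>.\<close>

lemma addrow_exchange:
  fixes A :: "complex mat"
  assumes A: "A \<in> carrier_mat n n" and i: "Suc i < n" and t: "t = 1 + a * b" "t \<noteq> 0"
  defines "d \<equiv> (\<lambda>j. if j = i then t else if j = Suc i then 1 / t else 1)"
  shows "addrow b i (Suc i) (addrow a (Suc i) i A) =
    addrow (a / t) (Suc i) i (mat_diag n d * addrow (b / t) i (Suc i) A)"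
proof (rule eq_matI)
  fix r c
  assume "r < dim_row (addrow (a / t) (Suc i) i (mat_diag n d * addrow (b / t) i (Suc i) A))"
    "c < dim_col (addrow (a / t) (Suc i) i (mat_diag n d * addrow (b / t) i (Suc i) A))"
  then have rc: "r < n" "c < n" using A by auto
  \<comment> \<open>This is row \<open>Suc i\<close>, with \<open>y\<close> and \<open>z\<close> the
    entries of rows \<open>i\<close> and \<open>Suc i\<close>: collecting \<open>z\<close> leaves
    the coefficient \<open>(1 + a b) / t = 1\<close>.\<close>
  have x: "1 / t * z + a / t * (t * (y + b / t * z)) = z + a * y" for y z
  proof -
    have "1 / t * z + a / t * (t * (y + b / t * z)) = (1 + a * b) / t * z + a * y"
      using t(2) by (simp add: field_simps)
    then show ?thesis using t by simp
  qed
  consider "r = i" | "r = Suc i" | "r \<noteq> i" "r \<noteq> Suc i" by blast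
  then show "addrow b i (Suc i) (addrow a (Suc i) i A) $$ (r, c) =
    addrow (a / t) (Suc i) i (mat_diag n d * addrow (b / t) i (Suc i) A) $$ (r, c)"
  proof cases
    case 1
    then show ?thesis using A i rc t by (simp add: d_def index_diag_mult[of _ n n] field_simps)
  next
    case 2
    then show ?thesis using A i rc x by (simp add: d_def index_diag_mult[of _ n n] add.commute)
  qed (use A i rc in \<open>simp add: d_def index_diag_mult[of _ n n]\<close>)
qed (use A in auto)

lemma addrow_mult:
  assumes "A \<in> carrier_mat n n" "B \<in> carrier_mat n n" "s < n"
  shows "addrow a r s (A * B) = addrow a r s A * (B :: complex mat)"
  using assms addrow_mat[of "A * B" n n s a r] addrow_mat[of A n n s a r] by (simp add: mult_assoc[of _ n])

text \<open>An elementary upper operation is pushed rightwards through the generators of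
  \<open>A\<close>. It commutes with every generator except the opposite operation on the same two
  rows, where the exchange relation applies; there \<open>t = 1 + a b\<close> is positive because
  \<open>a\<close> and \<open>b\<close> are nonnegative. The coefficient changes on the way, so the
  induction must leave \<open>b\<close> arbitrary.\<close>

lemma addrow_low_factor:
  assumes "A \<in> tnn_low n" "Suc i < n" "0 \<le> b"
  shows "\<exists>A'\<in>tnn_low n. \<exists>B\<in>tnn_up n. addrow b i (Suc i) A = A' * B"
  using assms(1,3)
proof (induction arbitrary: b rule: tnn.induct)
  case one
  have "addrow b i (Suc i) (1\<^sub>m n) \<in> tnn_up n"
    by (rule tnn_addrow) (use one assms(2) in \<open>auto simp: low_pairs_def intro: tnn.one\<close>)
  then show ?case by (intro bexI[OF _ tnn.one] bexI) auto
next
  case (diag d A)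
  have A: "A \<in> carrier_mat n n" using diag(2) tnn_carrier by blast
  have d: "0 < d i" "0 < d (Suc i)" using diag(1) assms(2) by auto
  then have "0 \<le> b * d (Suc i) / d i"
    using diag(4) by (intro complex_divide_nonneg complex_mult_nonneg) auto
  then obtain A' B where AB: "A' \<in> tnn_low n" "B \<in> tnn_up n"
    "addrow (b * d (Suc i) / d i) i (Suc i) A = A' * B" using diag(3) by blast
  have "addrow b i (Suc i) (mat_diag n d * A) = mat_diag n d * (A' * B)"
    using addrow_diag_mult[of A n d i "Suc i" b] A d assms(2) AB(3) by auto
  also have "\<dots> = (mat_diag n d * A') * B"
    using AB(1,2) tnn_carrier by (intro mult_assoc[symmetric]) auto
  finally show ?case using AB tnn_mult[OF tnn_diag[of n d low_pairs] AB(1)] diag(1) by blast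
next
  case (add r s a A)
  then obtain j where j: "r = Suc j" "s = j" "Suc j < n" by (auto simp: low_pairs_def)
  have A: "A \<in> carrier_mat n n" using add tnn_carrier by blast
  have eq: "addrow_mat n a r s * A = addrow a (Suc j) j A"
    using addrow_mat[OF A, of j a "Suc j"] j by simp
  have low: "addrow a' (Suc j) j A' \<in> tnn_low n" if "0 \<le> a'" "A' \<in> tnn_low n" for a' A'
    by (rule tnn_addrow) (use that j in \<open>auto simp: low_pairs_def\<close>)
  show ?case
  proof (cases "i = j")
    case False
    obtain A' B where AB: "A' \<in> tnn_low n" "B \<in> tnn_up n" "addrow b i (Suc i) A = A' * B"
      using add by blast
    have "addrow b i (Suc i) (addrow a (Suc j) j A) = addrow a (Suc j) j (A' * B)"
      using addrow_commute_same_row[OF A, of i j "Suc i" "Suc j" b a] False j assms(2) AB(3) by simp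
    also have "\<dots> = addrow a (Suc j) j A' * B"
      using AB j by (intro addrow_mult[of _ n]) (auto dest: tnn_carrier)
    finally show ?thesis using AB low add(4) unfolding eq by blast
  next
    case True
    define t where "t = 1 + a * b"
    have "0 \<le> a * b" using add by (intro complex_mult_nonneg)
    then have t: "0 < t" by (auto simp: t_def less_complex_def less_eq_complex_def)
    let ?d = "\<lambda>k. if k = i then t else if k = Suc i then 1 / t else 1"
    have "0 \<le> b / t" using add(7) t by (rule complex_divide_nonneg)
    then obtain A' B where AB: "A' \<in> tnn_low n" "B \<in> tnn_up n" "addrow (b / t) i (Suc i) A = A' * B"
      using add(6) by blast
    have c: "A' \<in> carrier_mat n n" "B \<in> carrier_mat n n" using AB tnn_carrier by blast+
    have "addrow b i (Suc i) (addrow a (Suc j) j A) =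
        addrow (a / t) (Suc i) i (mat_diag n ?d * (A' * B))"
      using addrow_exchange[OF A assms(2) t_def] t AB(3) True by auto
    also have "\<dots> = addrow (a / t) (Suc i) i (mat_diag n ?d * A') * B"
      using addrow_mult[of "mat_diag n ?d * A'" n B i "a / t" "Suc i"] c assms(2)
      by (simp add: mult_assoc[of _ n])
    finally have "addrow b i (Suc i) (addrow a (Suc j) j A) =
      addrow (a / t) (Suc i) i (mat_diag n ?d * A') * B" .
    moreover have "mat_diag n ?d * A' \<in> tnn_low n"
      using AB(1) t complex_divide_pos[of 1 t] by (intro tnn.diag) (auto simp: less_complex_def)
    then have "addrow (a / t) (Suc i) i (mat_diag n ?d * A') \<in> tnn_low n"
      using low[of "a / t"] complex_divide_nonneg[OF add(4) t] True by simp
    ultimately show ?thesis using AB unfolding eq by auto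
  qed
qed

text \<open>Each generator of \<open>B\<close> is carried past the lower factor by
  \<open>addrow_low_factor\<close>, and diagonal ones are absorbed on the left. The intended use is
  the Gram matrix \<open>mat_adjoint Y * Y\<close> of a lower factor.\<close>

lemma up_low_factor:
  assumes "B \<in> tnn_up n" "A \<in> tnn_low n"
  shows "\<exists>A'\<in>tnn_low n. \<exists>B'\<in>tnn_up n. B * A = A' * B'"
  using assms(1)
proof (induction rule: tnn.induct)
  case one
  then show ?case using assms(2) tnn_carrier[OF assms(2)]
    by (intro bexI[OF _ assms(2)] bexI[OF _ tnn.one]) simp
next
  case (diag d B)
  then obtain A' B' where AB: "A' \<in> tnn_low n" "B' \<in> tnn_up n" "B * A = A' * B'" by blast
  have c: "A \<in> carrier_mat n n" "B \<in> carrier_mat n n" "A' \<in> carrier_mat n n" "B' \<in> carrier_mat n n"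
    using assms AB diag tnn_carrier by blast+
  have "mat_diag n d * B * A = (mat_diag n d * A') * B'"
    using c AB(3) by (simp add: mult_assoc[of _ n])
  then show ?case using AB tnn_mult[OF tnn_diag[of n d low_pairs] AB(1)] diag(1) by blast
next
  case (add r s a B)
  then obtain A' B' where AB: "A' \<in> tnn_low n" "B' \<in> tnn_up n" "B * A = A' * B'" by blast
  have c: "A \<in> carrier_mat n n" "B \<in> carrier_mat n n" "A' \<in> carrier_mat n n" "B' \<in> carrier_mat n n"
    using assms AB add tnn_carrier by blast+
  obtain i where i: "r = i" "s = Suc i" "Suc i < n" using add by (auto simp: low_pairs_def)
  obtain A2 B2 where AB2: "A2 \<in> tnn_low n" "B2 \<in> tnn_up n" "addrow a i (Suc i) A' = A2 * B2"
    using addrow_low_factor[OF AB(1) i(3) add(4)] by blast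
  have c2: "A2 \<in> carrier_mat n n" "B2 \<in> carrier_mat n n" using AB2 tnn_carrier by blast+
  have "addrow_mat n a r s * B * A = addrow_mat n a r s * A' * B'"
    using c AB(3) by (simp add: mult_assoc[of _ n])
  also have "addrow_mat n a r s * A' = A2 * B2"
    using addrow_mat[OF c(3), of "Suc i" a i] i AB2(3) by simp
  finally have "addrow_mat n a r s * B * A = A2 * (B2 * B')"
    using c c2 by (simp add: mult_assoc[of _ n])
  then show ?case using AB2(1) tnn_mult[OF AB2(2) AB(2)] by blast
qed

subsection \<open>Neville elimination\<close>

text \<open>Rows and columns are both consecutive, and \<open>c\<close> is meant to be the first
  column not yet cleared: this family of minors is reproduced by a Neville step, which subtracts
  from a row a multiple of the row just above it.\<close>

definition block_minor :: "complex mat \<Rightarrow> nat \<Rightarrow> nat \<Rightarrow> nat \<Rightarrow> complex" where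
  "block_minor M c k i = det (mat k k (\<lambda>(r, s). M $$ (i + r, c + s)))"

text \<open>The matrix \<open>?L\<close> is unit lower bidiagonal, so subtracting neighbouring rows
  leaves the determinant alone, and expansion along the cleared first column splits off the pivot.
  The first row of the block is required to be unmodified, since its predecessor lies outside the
  block.\<close>

lemma neville_block_minor:
  fixes M :: "complex mat"
  assumes W: "\<And>r s. r \<le> k \<Longrightarrow> s \<le> k \<Longrightarrow> M' $$ (Suc i + r - 1, c + s) =
      (if r = 0 then M $$ (i, c + s) else M $$ (i + r, c + s) - a r * M $$ (i + r - 1, c + s))"
    and z: "\<And>r. 0 < r \<Longrightarrow> r \<le> k \<Longrightarrow> M' $$ (i + r, c) = 0"
  shows "block_minor M c (Suc k) i = M $$ (i, c) * block_minor M' (Suc c) k (Suc i)"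
proof -
  let ?L = "mat (Suc k) (Suc k) (\<lambda>(r, s). if r = s then 1 else if r = Suc s then - a r else 0)"
  let ?V = "mat (Suc k) (Suc k) (\<lambda>(r, s). M $$ (i + r, c + s))"
  let ?W = "mat (Suc k) (Suc k) (\<lambda>(r, s). M' $$ (i + r, c + s))"
  have LV: "?L * ?V = ?W"
  proof (rule eq_matI)
    fix r s assume "r < dim_row ?W" "s < dim_col ?W"
    then have rs: "r < Suc k" "s < Suc k" by auto
    have "(?L * ?V) $$ (r, s) = (\<Sum>l<Suc k. ?L $$ (r, l) * ?V $$ (l, s))"
      by (rule index_mult_sum) (use rs in auto)
    also have "\<dots> = (\<Sum>l<Suc k. (if l = r then ?V $$ (l, s) else 0) + (if Suc l = r then - a r * ?V $$ (l, s) else 0))"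
      by (rule sum.cong) (use rs in auto)
    also have "\<dots> = ?V $$ (r, s) + (\<Sum>l<Suc k. if Suc l = r then - a r * ?V $$ (l, s) else 0)"
      unfolding sum.distrib using rs by (subst sum.delta) auto
    also have "(\<Sum>l<Suc k. if Suc l = r then - a r * ?V $$ (l, s) else 0) =
        (if r = 0 then 0 else - a r * ?V $$ (r - 1, s))"
    proof (cases r)
      case (Suc r')
      then have "(\<Sum>l<Suc k. if Suc l = r then - a r * ?V $$ (l, s) else 0) =
        (\<Sum>l<Suc k. if l = r' then - a r * ?V $$ (l, s) else 0)" by (intro sum.cong) auto
      then show ?thesis using rs Suc by (subst (asm) sum.delta) auto
    qed simp
    finally show "(?L * ?V) $$ (r, s) = ?W $$ (r, s)"
      using W[of r s] rs by (cases r) auto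
  qed auto
  have "det ?L = 1"
    by (subst det_lower_triangular[of "Suc k"]) (auto simp: prod_list_diag_prod)
  then have VW: "det ?V = det ?W" using det_mult[of ?L "Suc k" ?V] LV by simp
  have "det ?W = (\<Sum>r<Suc k. ?W $$ (r, 0) * cofactor ?W r 0)"
    by (rule laplace_expansion_column) auto
  also have "\<dots> = (\<Sum>r\<in>{0}. ?W $$ (r, 0) * cofactor ?W r 0)"
    by (rule sum.mono_neutral_right) (use z in auto)
  also have "\<dots> = M $$ (i, c) * det (mat_delete ?W 0 0)"
    using W[of 0 0] by (simp add: cofactor_def)
  also have "mat_delete ?W 0 0 = mat k k (\<lambda>(r, s). M' $$ (Suc i + r, Suc c + s))"
    by (intro eq_matI) (auto simp: mat_delete_def)
  finally show ?thesis using VW by (simp add: block_minor_def)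
qed

definition neville_reduced :: "nat \<Rightarrow> nat \<Rightarrow> complex mat \<Rightarrow> bool" where
  "neville_reduced n c M \<longleftrightarrow> M \<in> carrier_mat n n \<and>
    (\<forall>i j. j < c \<longrightarrow> j < i \<longrightarrow> i < n \<longrightarrow> M $$ (i, j) = 0) \<and> (\<forall>j<c. 0 < M $$ (j, j)) \<and>
    (\<forall>i k. c \<le> i \<longrightarrow> i + k \<le> n \<longrightarrow> 0 < block_minor M c k i)"

text \<open>The multipliers are quotients of 1 by 1 block minors, hence nonnegative, so undoing the
  subtractions stays in the semigroup. Each new block minor is an old one, larger by one row and one
  column, divided by its positive pivot.\<close>

lemma neville_step:
  assumes red: "neville_reduced n c M" and c: "c < n"
  shows "\<exists>Y\<in>tnn_low n. \<exists>M'. neville_reduced n (Suc c) M' \<and> M = Y * M'"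
proof -
  have M: "M \<in> carrier_mat n n"
    and z: "\<And>i j. j < c \<Longrightarrow> j < i \<Longrightarrow> i < n \<Longrightarrow> M $$ (i, j) = 0"
    and d: "\<And>j. j < c \<Longrightarrow> 0 < M $$ (j, j)"
    and bm: "\<And>i k. c \<le> i \<Longrightarrow> i + k \<le> n \<Longrightarrow> 0 < block_minor M c k i"
    using red by (auto simp: neville_reduced_def)
  define a where "a i = M $$ (i, c) / M $$ (i - 1, c)" for i
  define M' where "M' = mat n n (\<lambda>(i, j). if c < i then M $$ (i, j) - a i * M $$ (i - 1, j) else M $$ (i, j))"
  have p: "0 < M $$ (i, c)" if "c \<le> i" "i < n" for i
    using bm[of i 1] that det_single[of "mat 1 1 (\<lambda>(r, s). M $$ (i + r, c + s))"]
    by (simp add: block_minor_def)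
  have a: "0 \<le> a i" if "c < i" "i < n" for i
    using p[of i] p[of "i - 1"] that complex_divide_pos[of "M $$ (i, c)" "M $$ (i - 1, c)"]
    by (simp add: a_def less_imp_le)
  \<comment> \<open>The subtractions are undone from the top: in \<open>P m\<close> the rows up to
    \<open>m\<close> are those of \<open>M\<close> again, so adding \<open>a (Suc m)\<close> times
    row \<open>m\<close> restores the next one. \<open>P c\<close> is \<open>M'\<close> and
    \<open>P (n - 1)\<close> is \<open>M\<close>.\<close>
  define P where "P m = mat n n (\<lambda>(i, j). if i \<le> m then M $$ (i, j) else M' $$ (i, j))" for m
  have "\<exists>Y\<in>tnn_low n. P m = Y * M'" if "c \<le> m" "m < n" for m
    using that
  proof (induction m rule: dec_induct)
    case base
    have "P c = M'" by (rule eq_matI) (auto simp: P_def M'_def)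
    then show ?case by (intro bexI[OF _ tnn.one]) (simp add: M'_def)
  next
    case (step m)
    then obtain Y where Y: "Y \<in> tnn_low n" "P m = Y * M'" by auto
    have "P (Suc m) = addrow (a (Suc m)) (Suc m) m (P m)"
      using step by (intro eq_matI) (auto simp: P_def M'_def le_Suc_eq)
    also have "\<dots> = addrow (a (Suc m)) (Suc m) m Y * M'"
      unfolding Y(2) using Y(1) step tnn_carrier[of Y]
      by (intro addrow_mult[of _ n]) (auto simp: M'_def)
    finally have "P (Suc m) = addrow (a (Suc m)) (Suc m) m Y * M'" .
    moreover have "addrow (a (Suc m)) (Suc m) m Y \<in> tnn_low n"
      using step a[of "Suc m"] Y(1) by (intro tnn_addrow) (auto simp: low_pairs_def)
    ultimately show ?case by blast
  qed
  moreover have "c \<le> n - 1" "n - 1 < n" using c by auto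
  ultimately obtain Y where Y: "Y \<in> tnn_low n" "P (n - 1) = Y * M'" by blast
  have "P (n - 1) = M" using M by (intro eq_matI) (auto simp: P_def)
  with Y have MY: "M = Y * M'" by simp
  moreover have "M' \<in> carrier_mat n n" by (simp add: M'_def)
  moreover have z': "M' $$ (i, j) = 0" if "j < Suc c" "j < i" "i < n" for i j
  proof (cases "j = c")
    case True
    have "c \<le> i - 1" "i - 1 < n" using that True by auto
    from p[OF this] have "M $$ (i - 1, c) \<noteq> 0" by auto
    then show ?thesis using that True c by (simp add: M'_def a_def)
  next
    case False
    then show ?thesis using that z[of j i] z[of j "i - 1"] c by (auto simp: M'_def)
  qed
  moreover have "0 < M' $$ (j, j)" if "j < Suc c" for j
    using that d[of j] p[of c] c by (cases "j = c") (auto simp: M'_def)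
  moreover have "0 < block_minor M' (Suc c) k i" if i: "Suc c \<le> i" "i + k \<le> n" for i k
  proof (cases "k = 0")
    case True
    then show ?thesis by (simp add: block_minor_def less_complex_def)
  next
    case False
    \<comment> \<open>\<open>neville_block_minor\<close> wants the first row of the block as it was
      before the step, whereas row \<open>i - 1\<close> of \<open>M'\<close> may already be
      modified. Putting the old row back does not affect the smaller block, which starts at row
      \<open>i\<close>.\<close>
    define N where "N = mat n n (\<lambda>(r, s). if r = i - 1 then M $$ (r, s) else M' $$ (r, s))"
    have "block_minor M c (Suc k) (i - 1) = M $$ (i - 1, c) * block_minor N (Suc c) k (Suc (i - 1))"
    proof (rule neville_block_minor[where a = "\<lambda>r. a (i - 1 + r)"])
      fix r s assume "r \<le> k" "s \<le> k"
      then show "N $$ (Suc (i - 1) + r - 1, c + s) = (if r = 0 then M $$ (i - 1, c + s)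
          else M $$ (i - 1 + r, c + s) - a (i - 1 + r) * M $$ (i - 1 + r - 1, c + s))"
        using i False by (auto simp: N_def M'_def)
    next
      fix r assume "0 < r" "r \<le> k"
      then show "N $$ (i - 1 + r, c) = 0" using i False z'[of c "i - 1 + r"] by (simp add: N_def)
    qed
    also have "block_minor N (Suc c) k (Suc (i - 1)) = block_minor M' (Suc c) k i"
      unfolding block_minor_def using i False
      by (intro arg_cong[where f = det] eq_matI) (auto simp: N_def M'_def)
    finally have eq: "block_minor M c (Suc k) (i - 1) = M $$ (i - 1, c) * block_minor M' (Suc c) k i" .
    have "c \<le> i - 1" "i - 1 < n" "i - 1 + Suc k \<le> n" using i False by auto
    note pos = p[OF this(1,2)] bm[OF this(1,3)]
    then have "block_minor M' (Suc c) k i = block_minor M c (Suc k) (i - 1) / M $$ (i - 1, c)"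
      using eq by auto
    then show ?thesis using complex_divide_pos[OF pos(2,1)] by simp
  qed
  ultimately have "neville_reduced n (Suc c) M'" unfolding neville_reduced_def by blast
  then show ?thesis using Y(1) MY by blast
qed

lemma neville_elimination:
  assumes M: "M \<in> carrier_mat n n"
    and bm: "\<And>i k. i + k \<le> n \<Longrightarrow> 0 < block_minor M 0 k i"
  obtains Y b where "Y \<in> tnn_low n" "b \<in> pos_upper n" "M = Y * b"
proof -
  have "\<exists>Y\<in>tnn_low n. \<exists>M'. neville_reduced n c M' \<and> M = Y * M'" if "c \<le> n" for c
    using that
  proof (induction c)
    case 0
    have "neville_reduced n 0 M" using M bm by (simp add: neville_reduced_def)
    then show ?case using M by (intro bexI[OF _ tnn.one]) auto
  next
    case (Suc c)
    then obtain Y M1 where Y: "Y \<in> tnn_low n" "neville_reduced n c M1" "M = Y * M1"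
      by (auto simp: Suc_le_eq)
    from Suc have "c < n" by simp
    from neville_step[OF Y(2) this] obtain Z M2 where
      Z: "Z \<in> tnn_low n" "neville_reduced n (Suc c) M2" "M1 = Z * M2" by blast
    have "M = (Y * Z) * M2"
      using Y Z tnn_carrier[OF Y(1)] tnn_carrier[OF Z(1)] by (simp add: mult_assoc[of _ n] neville_reduced_def)
    then show ?case using tnn_mult[OF Y(1) Z(1)] Z(2) by blast
  qed
  from this[of n] obtain Y b where Yb: "Y \<in> tnn_low n" "neville_reduced n n b" "M = Y * b" by blast
  have "b \<in> pos_upper n"
    using Yb(2) unfolding neville_reduced_def pos_upper_def upper_triangular_def by auto
  then show thesis using that Yb by blast
qed

text \<open>A lower triangular matrix with an upper triangular inverse is triangular both ways; its
  diagonal consists of the inverses of the positive diagonal entries of \<open>Y\<close>.\<close>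

lemma lower_upper_one:
  fixes Z Y :: "complex mat"
  assumes Z: "Z \<in> carrier_mat n n" and lower: "\<And>i j. i < j \<Longrightarrow> j < n \<Longrightarrow> Z $$ (i, j) = 0"
    and Y: "Y \<in> pos_upper n" and ZY: "Z * Y = 1\<^sub>m n"
  shows "Z = mat_diag n (\<lambda>i. Z $$ (i, i))" and "i < n \<Longrightarrow> 0 < Z $$ (i, i)"
proof -
  have Yc: "Y \<in> carrier_mat n n" "upper_triangular Y" and Yd: "\<And>i. i < n \<Longrightarrow> 0 < Y $$ (i, i)"
    using Y by (auto simp: pos_upper_def)
  have nz: "\<And>i. i < n \<Longrightarrow> Y $$ (i, i) \<noteq> 0" using Yd by fastforce
  have "upper_triangular (Z * Y)" unfolding ZY by simp
  from upper_triangular_factor[OF Z Yc nz this]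
  have up: "upper_triangular Z" and dg: "\<And>i. i < n \<Longrightarrow> (Z * Y) $$ (i, i) = Z $$ (i, i) * Y $$ (i, i)"
    by auto
  show "Z = mat_diag n (\<lambda>i. Z $$ (i, i))"
  proof (rule eq_matI)
    fix i j assume "i < dim_row (mat_diag n (\<lambda>i. Z $$ (i, i)))" "j < dim_col (mat_diag n (\<lambda>i. Z $$ (i, i)))"
    then show "Z $$ (i, j) = mat_diag n (\<lambda>i. Z $$ (i, i)) $$ (i, j)"
      using lower[of i j] up Z by (cases i j rule: linorder_cases) (auto simp: upper_triangular_def)
  qed (use Z in auto)
  show "0 < Z $$ (i, i)" if "i < n"
  proof -
    have "Z $$ (i, i) * Y $$ (i, i) = 1" using dg[OF that] that by (simp add: ZY)
    then have "Z $$ (i, i) = inverse (Y $$ (i, i))"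
      using inverse_unique[of "Y $$ (i, i)" "Z $$ (i, i)"] by (simp add: mult.commute)
    then show ?thesis using complex_inverse_pos[OF Yd[OF that]] by simp
  qed
qed

text \<open>With \<open>g = Y b\<close>, unitarity reads \<open>b b\<^sup>* Y\<^sup>* Y = 1\<close>. Rewriting \<open>Y\<^sup>* Y = A B\<close> with lower and
  upper totally nonnegative factors forces the lower triangular matrix \<open>b\<^sup>* A\<close> to be diagonal,
  so that \<open>b\<^sup>*\<close> is the inverse of a totally nonnegative matrix up to a positive diagonal factor.\<close>

lemma tnn_flag_inverse_generic:
  assumes g: "g \<in> unitary_group n" and bm: "\<And>i k. i + k \<le> n \<Longrightarrow> 0 < block_minor g 0 k i"
  shows "tnn_flag n (dconj n (mat_adjoint g))"
proof -
  note G = unitary_groupD[OF g]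
  from neville_elimination[OF G(1) bm] obtain Y b where
    Y: "Y \<in> tnn_low n" and b: "b \<in> pos_upper n" and gYb: "g = Y * b" by metis
  have Yc: "Y \<in> carrier_mat n n" and bc: "b \<in> carrier_mat n n"
    using tnn_carrier[OF Y] b by (auto simp: pos_upper_def)
  have Ya: "mat_adjoint Y \<in> tnn_up n" using tnn_adjoint[OF Y] .
  from up_low_factor[OF Ya Y] obtain A B where
    A: "A \<in> tnn_low n" and B: "B \<in> tnn_up n" and AB: "mat_adjoint Y * Y = A * B" by blast
  have Ac: "A \<in> carrier_mat n n" and Bc: "B \<in> carrier_mat n n"
    using tnn_carrier[OF A] tnn_carrier[OF B] by auto
  have Bp: "B \<in> pos_upper n" by (rule tnn_pos_upper[OF B]) (auto simp: low_pairs_def)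
  have "mat_adjoint A \<in> pos_upper n"
    by (rule tnn_pos_upper[OF tnn_adjoint[OF A]]) (auto simp: low_pairs_def)
  define Z where "Z = mat_adjoint b * A"
  have Zc: "Z \<in> carrier_mat n n" using Ac bc by (simp add: Z_def)
  have Za: "mat_adjoint Z \<in> pos_upper n"
    using pos_upper_mult[OF \<open>mat_adjoint A \<in> pos_upper n\<close> b] Ac bc
    by (simp add: Z_def mat_adjoint_mult[of _ n n _ n])
  have low: "Z $$ (i, j) = 0" if "i < j" "j < n" for i j
    using Za Zc that mat_adjoint_index[of j Z i] by (auto simp: pos_upper_def upper_triangular_def)
  have "mat_adjoint g * g = 1\<^sub>m n" using G by simp
  then have "mat_adjoint b * ((mat_adjoint Y * Y) * b) = 1\<^sub>m n"
    unfolding gYb using Yc bc by (simp add: mat_adjoint_mult[of _ n n _ n] mult_assoc[of _ n])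
  then have ZY: "Z * (B * b) = 1\<^sub>m n"
    unfolding AB Z_def using Ac Bc bc by (simp add: mult_assoc[of _ n])
  note Z = lower_upper_one[OF Zc low pos_upper_mult[OF Bp b] ZY]
  from tnn_signed_inverse[OF A low_pairs_adjacent(1)] obtain A1 where
    A1: "A1 \<in> tnn_low n" "dconj n A1 * A = 1\<^sub>m n" by blast
  have A1c: "A1 \<in> carrier_mat n n" using tnn_carrier[OF A1(1)] .
  have "A * dconj n A1 = 1\<^sub>m n" using left_inverse_right_inverse[of "dconj n A1" n A] A1 A1c Ac by simp
  then have "mat_adjoint b = Z * dconj n A1"
    unfolding Z_def using Ac A1c bc by (simp add: mult_assoc[of _ n])
  then have "dconj n (mat_adjoint g) = dconj n Z * A1 * dconj n (mat_adjoint Y)"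
    unfolding gYb using Yc bc Zc A1c by (simp add: mat_adjoint_mult[of _ n n _ n] dconj_mult)
  also have "dconj n Z = mat_diag n (\<lambda>i. Z $$ (i, i))" using Z(1) dconj_diag by metis
  finally have eq: "dconj n (mat_adjoint g) = mat_diag n (\<lambda>i. Z $$ (i, i)) * A1 * dconj n (mat_adjoint Y)" .
  have "tnn_flag n (mat_diag n (\<lambda>i. Z $$ (i, i)) * A1)"
    using tnn_tnn_flag[OF A1(1) low_pairs_adjacent(1)] Z(2) A1c
    by (intro tnn_flag_diag_mult) (auto simp: less_imp_le)
  moreover have "dconj n (mat_adjoint Y) \<in> pos_upper n"
    by (intro dconj_pos_upper tnn_pos_upper[OF Ya]) (auto simp: low_pairs_def)
  ultimately show ?thesis unfolding eq using A1c by (intro tnn_flag_mult_upper[of "_ * _"]) auto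
qed

subsection \<open>QR decomposition\<close>

text \<open>Gram-Schmidt by induction on the number \<open>k\<close> of orthonormal columns. A
  square factorization \<open>M = Q * c\<close> is kept throughout, so that \<open>det Q\<close> is
  nonzero at each stage and the next residual cannot vanish.\<close>

lemma qr_decomposition:
  assumes M: "M \<in> carrier_mat n n" "det M \<noteq> 0"
  shows "\<exists>h\<in>unitary_group n. \<exists>c\<in>pos_upper n. M = h * c"
proof -
  have "\<exists>Q\<in>carrier_mat n n. \<exists>c\<in>pos_upper n. M = Q * c \<and>
      (\<forall>i<k. \<forall>j<k. (\<Sum>r<n. cnj (Q $$ (r, i)) * Q $$ (r, j)) = (if i = j then 1 else 0))" if "k \<le> n" for k
    using that
  proof (induction k)
    case 0
    have "1\<^sub>m n \<in> pos_upper n" by (auto simp: pos_upper_def less_complex_def)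
    then show ?case using M by (intro bexI[OF _ M(1)] bexI[of _ "1\<^sub>m n"]) auto
  next
    case (Suc k)
    then obtain Q c where Q: "Q \<in> carrier_mat n n" and c: "c \<in> pos_upper n" and MQc: "M = Q * c"
      and orth: "\<And>i j. i < k \<Longrightarrow> j < k \<Longrightarrow> (\<Sum>r<n. cnj (Q $$ (r, i)) * Q $$ (r, j)) = (if i = j then 1 else 0)"
      by auto
    have k: "k < n" using Suc by simp
    have detQ: "det Q \<noteq> 0" using M(2) det_mult[OF Q, of c] c unfolding MQc by (auto simp: pos_upper_def)
    \<comment> \<open>\<open>p\<close> holds the coefficients of column \<open>k\<close> along the
      orthonormal columns and \<open>v\<close> the residual. \<open>Q' \<nu>\<close> carries the
      residual divided by \<open>\<nu>\<close>, and \<open>u \<nu>\<close> records how column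
      \<open>k\<close> is rebuilt. The parameter is left open since the norm of \<open>v\<close> is
      not yet known to be nonzero.\<close>
    define p where "p i = (\<Sum>r<n. cnj (Q $$ (r, i)) * Q $$ (r, k))" for i
    define v where "v r = Q $$ (r, k) - (\<Sum>l<k. p l * Q $$ (r, l))" for r
    define Q' where "Q' \<nu> = mat n n (\<lambda>(r, j). if j = k then v r / \<nu> else Q $$ (r, j))" for \<nu>
    define u where "u \<nu> = mat n n (\<lambda>(i, j). if j = k then (if i < k then p i else if i = k then \<nu> else 0)
      else if i = j then 1 else 0)" for \<nu>
    have Qu: "Q = Q' \<nu> * u \<nu>" if "\<nu> \<noteq> 0" for \<nu>
    proof (rule eq_matI)
      fix r j assume "r < dim_row (Q' \<nu> * u \<nu>)" "j < dim_col (Q' \<nu> * u \<nu>)"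
      then have rj: "r < n" "j < n" by (auto simp: Q'_def u_def)
      have "(Q' \<nu> * u \<nu>) $$ (r, j) = (\<Sum>l<n. Q' \<nu> $$ (r, l) * u \<nu> $$ (l, j))"
        by (rule index_mult_sum) (use rj in \<open>auto simp: Q'_def u_def\<close>)
      also have "\<dots> = Q $$ (r, j)"
      proof (cases "j = k")
        case False
        have "(\<Sum>l<n. Q' \<nu> $$ (r, l) * u \<nu> $$ (l, j)) = (\<Sum>l<n. if l = j then Q $$ (r, l) else 0)"
          by (rule sum.cong) (use False rj in \<open>auto simp: Q'_def u_def\<close>)
        then show ?thesis using rj by simp
      next
        case True
        have "(\<Sum>l<n. Q' \<nu> $$ (r, l) * u \<nu> $$ (l, j)) = (\<Sum>l\<in>{..<Suc k}. Q' \<nu> $$ (r, l) * u \<nu> $$ (l, j))"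
          by (rule sum.mono_neutral_right) (use True k in \<open>auto simp: u_def\<close>)
        also have "\<dots> = (\<Sum>l<k. p l * Q $$ (r, l)) + v r"
          using True rj that k by (auto simp: Q'_def u_def intro!: sum.cong)
        finally show ?thesis using True by (simp add: v_def)
      qed
      finally show "Q $$ (r, j) = (Q' \<nu> * u \<nu>) $$ (r, j)" by simp
    qed (use Q in \<open>auto simp: Q'_def u_def\<close>)
    define N where "N = (\<Sum>r<n. (cmod (v r))\<^sup>2)"
    \<comment> \<open>A zero residual is a zero column of \<open>Q' 1\<close>; the factorization at
      \<open>\<nu> = 1\<close> then makes \<open>det Q\<close> vanish.\<close>
    have "N \<noteq> 0"
    proof
      assume "N = 0"
      then have "v r = 0" if "r < n" for r
        using that by (auto simp: N_def sum_nonneg_eq_0_iff)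
      moreover have "det (Q' 1) = (\<Sum>i<n. Q' 1 $$ (i, k) * cofactor (Q' 1) i k)"
        by (rule laplace_expansion_column[OF _ k]) (simp add: Q'_def)
      ultimately have "det (Q' 1) = 0" using k by (simp add: Q'_def)
      then have "det (Q' 1 * u 1) = 0"
        using det_mult[of "Q' 1" n "u 1"] by (simp add: Q'_def u_def)
      then show False using detQ Qu[of 1] by simp
    qed
    moreover have "0 \<le> N" unfolding N_def by (simp add: sum_nonneg)
    ultimately have N: "0 < N" by simp
    define \<nu> where "\<nu> = complex_of_real (sqrt N)"
    have nu: "\<nu> \<noteq> 0" "cnj \<nu> = \<nu>" "\<nu> * \<nu> = complex_of_real N" "0 < \<nu>"
      using N by (auto simp: \<nu>_def less_complex_def simp flip: of_real_mult)
    have u: "u \<nu> \<in> pos_upper n"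
      using nu k by (auto simp: u_def pos_upper_def upper_triangular_def) (auto simp: less_complex_def)
    have vorth: "(\<Sum>r<n. cnj (Q $$ (r, i)) * v r) = 0" if "i < k" for i
    proof -
      have "(\<Sum>r<n. cnj (Q $$ (r, i)) * v r) =
          p i - (\<Sum>r<n. \<Sum>l<k. p l * (cnj (Q $$ (r, i)) * Q $$ (r, l)))"
        by (simp add: v_def p_def right_diff_distrib sum_subtractf sum_distrib_left mult.left_commute mult.commute)
      also have "(\<Sum>r<n. \<Sum>l<k. p l * (cnj (Q $$ (r, i)) * Q $$ (r, l))) =
          (\<Sum>l<k. p l * (\<Sum>r<n. cnj (Q $$ (r, i)) * Q $$ (r, l)))"
        by (subst sum.swap) (simp add: sum_distrib_left)
      also have "\<dots> = (\<Sum>l<k. if l = i then p l else 0)"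
        by (rule sum.cong) (use orth that in auto)
      finally show ?thesis using that by simp
    qed
    have vorth': "(\<Sum>r<n. cnj (v r) * Q $$ (r, i)) = 0" if "i < k" for i
      using arg_cong[OF vorth[OF that], of cnj] by (simp add: mult.commute)
    have vv: "(\<Sum>r<n. cnj (v r) * v r) = complex_of_real N"
      by (simp add: N_def complex_norm_square[symmetric] mult.commute[of "cnj _"])
    have "(\<Sum>r<n. cnj (Q' \<nu> $$ (r, i)) * Q' \<nu> $$ (r, j)) = (if i = j then 1 else 0)"
      if "i < Suc k" "j < Suc k" for i j
    proof -
      have ij: "i < n" "j < n" using that k by auto
      consider "i < k" "j < k" | "i = k" "j < k" | "i < k" "j = k" | "i = k" "j = k" using \<open>i < Suc k\<close> \<open>j < Suc k\<close> by linarith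
      then show ?thesis
      proof cases
        case 1
        then show ?thesis using orth ij by (simp add: Q'_def)
      next
        case 2
        have "(\<Sum>r<n. cnj (Q' \<nu> $$ (r, i)) * Q' \<nu> $$ (r, j)) = (\<Sum>r<n. cnj (v r) * Q $$ (r, j)) / \<nu>"
          using 2 ij nu by (simp add: Q'_def sum_divide_distrib)
        then show ?thesis using vorth' 2 by simp
      next
        case 3
        have "(\<Sum>r<n. cnj (Q' \<nu> $$ (r, i)) * Q' \<nu> $$ (r, j)) = (\<Sum>r<n. cnj (Q $$ (r, i)) * v r) / \<nu>"
          using 3 ij nu by (simp add: Q'_def sum_divide_distrib)
        then show ?thesis using vorth 3 by simp
      next
        case 4
        have "(\<Sum>r<n. cnj (Q' \<nu> $$ (r, i)) * Q' \<nu> $$ (r, j)) = (\<Sum>r<n. cnj (v r) * v r) / (\<nu> * \<nu>)"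
          using 4 ij nu(2) by (simp add: Q'_def sum_divide_distrib)
        then show ?thesis using vv nu(3) N 4 by simp
      qed
    qed
    moreover have "M = Q' \<nu> * (u \<nu> * c)"
      using MQc Qu[OF nu(1)] u c by (simp add: mult_assoc[of _ n, symmetric] pos_upper_def Q'_def)
    moreover have "Q' \<nu> \<in> carrier_mat n n" by (simp add: Q'_def)
    ultimately show ?case using pos_upper_mult[OF u c] by blast
  qed
  from this[of n] obtain Q c where Q: "Q \<in> carrier_mat n n" "c \<in> pos_upper n" "M = Q * c"
    "\<And>i j. i < n \<Longrightarrow> j < n \<Longrightarrow> (\<Sum>r<n. cnj (Q $$ (r, i)) * Q $$ (r, j)) = (if i = j then 1 else 0)" by auto
  have "mat_adjoint Q * Q = 1\<^sub>m n"
    using Q(1,4) by (intro eq_matI) (auto simp: index_mult_sum[of _ n n _ n])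
  then show ?thesis using Q unitary_groupI by blast
qed

text \<open>The adjoint of \<open>c\<close> is lower triangular and inverse to the upper triangular
  \<open>c\<close>, so \<open>c\<close> is diagonal; a positive number of modulus 1 is 1. This is
  the uniqueness of the QR factorization at a unitary matrix.\<close>

lemma pos_upper_unitary:
  assumes "c \<in> pos_upper n" "c \<in> unitary_group n"
  shows "c = 1\<^sub>m n"
proof -
  note C = unitary_groupD[OF assms(2)]
  have up: "upper_triangular c" and pos: "\<And>i. i < n \<Longrightarrow> 0 < c $$ (i, i)" using assms(1) by (auto simp: pos_upper_def)
  have low: "mat_adjoint c $$ (i, j) = 0" if "i < j" "j < n" for i j
    using up C(1) that by (auto simp: upper_triangular_def)
  have Z: "mat_adjoint c = mat_diag n (\<lambda>i. mat_adjoint c $$ (i, i))"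
    by (rule lower_upper_one(1)[OF _ low assms(1) C(3)]) (use C in auto)
  have off: "c $$ (i, j) = 0" if "i < n" "j < n" "i \<noteq> j" for i j
  proof -
    have "mat_adjoint c $$ (j, i) = 0" by (subst Z) (use that in simp)
    then show ?thesis using that C(1) by simp
  qed
  have dg: "c $$ (i, i) = 1" if "i < n" for i
  proof -
    have "1 = (mat_adjoint c * c) $$ (i, i)" using C(3) that by simp
    also have "\<dots> = (\<Sum>k<n. cnj (c $$ (k, i)) * c $$ (k, i))"
      using C(1) that by (simp add: index_mult_sum[of _ n n _ n])
    also have "\<dots> = (\<Sum>k<n. if k = i then cnj (c $$ (i, i)) * c $$ (i, i) else 0)"
      by (rule sum.cong) (use off that in auto)
    also have "\<dots> = c $$ (i, i) * c $$ (i, i)"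
      using complex_nonneg_cnj[OF less_imp_le[OF pos[OF that]]] that by simp
    finally have "(c $$ (i, i) - 1) * (c $$ (i, i) + 1) = 0" by (simp add: algebra_simps)
    moreover have "c $$ (i, i) + 1 \<noteq> 0"
      using pos[OF that] by (auto simp: less_complex_def complex_eq_iff)
    ultimately show ?thesis by simp
  qed
  show ?thesis by (rule eq_matI) (use off dg C(1) in auto)
qed

section \<open>Differentiable dependence of the triangular QR factor\<close>

lemma differentiable_cnj:
  fixes f :: "real \<Rightarrow> complex"
  assumes "f differentiable (at t)"
  shows "(\<lambda>t. cnj (f t)) differentiable (at t)"
  using assms bounded_linear.has_derivative[OF bounded_linear_cnj] by (auto simp: differentiable_def)

text \<open>Positivity identifies \<open>f\<close> with the real square root of its square and keeps
  the argument away from 0, where the root fails to be differentiable.\<close>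

lemma differentiable_positive_root:
  fixes f :: "real \<Rightarrow> complex"
  assumes "(\<lambda>t. f t * f t) differentiable (at t)" and pos: "\<And>t. 0 < f t"
  shows "f differentiable (at t)"
proof -
  have im: "Im (f t) = 0" and re: "0 < Re (f t)" for t using pos[of t] by (auto simp: less_complex_def)
  have f: "f = (\<lambda>t. complex_of_real (sqrt (Re (f t * f t))))"
    using im re by (auto simp: fun_eq_iff complex_eq_iff less_imp_le)
  have "(\<lambda>t. Re (f t * f t)) differentiable (at t)"
    using assms(1) bounded_linear.has_derivative[OF bounded_linear_Re] unfolding differentiable_def by blast
  then obtain D where "((\<lambda>t. Re (f t * f t)) has_real_derivative D) (at t)"
    by (auto simp: real_differentiable_def)
  then have "((\<lambda>t. sqrt (Re (f t * f t))) has_real_derivative inverse (sqrt (Re (f t * f t))) / 2 * D) (at t)"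
    by (intro DERIV_chain2[OF DERIV_real_sqrt]) (use im re in auto)
  then have "(\<lambda>t. sqrt (Re (f t * f t))) differentiable (at t)"
    using real_differentiable_def by blast
  then have "(\<lambda>t. complex_of_real (sqrt (Re (f t * f t)))) differentiable (at t)"
    using bounded_linear.has_derivative[OF bounded_linear_of_real] unfolding differentiable_def by blast
  then show ?thesis by (subst f)
qed

lemma differentiable_sum_complex:
  fixes f :: "'a \<Rightarrow> real \<Rightarrow> complex"
  assumes "\<And>i. i \<in> I \<Longrightarrow> f i differentiable (at t)"
  shows "(\<lambda>t. \<Sum>i\<in>I. f i t) differentiable (at t)"
  using assms by (induction I rule: infinite_finite_induct) auto

text \<open>Entry \<open>(i, j)\<close> of the Gram matrix is a sum over earlier rows of
  \<open>c\<close> plus \<open>c_ii c_ij\<close>. Row by row, \<open>c_ii\<close> is obtained as a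
  positive square root and the rest of the row by division.\<close>

lemma cholesky_differentiable:
  fixes c :: "real \<Rightarrow> complex mat"
  assumes c: "\<And>t. c t \<in> pos_upper n"
    and G: "\<And>i j. i < n \<Longrightarrow> j < n \<Longrightarrow> (\<lambda>t. (mat_adjoint (c t) * c t) $$ (i, j)) differentiable (at t)"
  shows "i < n \<Longrightarrow> j < n \<Longrightarrow> (\<lambda>t. c t $$ (i, j)) differentiable (at t)"
proof (induction i arbitrary: j rule: less_induct)
  case (less i)
  have cc: "c t \<in> carrier_mat n n" and up: "\<And>i j. i < n \<Longrightarrow> j < i \<Longrightarrow> c t $$ (i, j) = 0"
    and pos: "\<And>i. i < n \<Longrightarrow> 0 < c t $$ (i, i)" for t
    using c[of t] by (auto simp: pos_upper_def upper_triangular_def)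
  have dims: "dim_row (c t) = n" "dim_col (c t) = n" for t using cc[of t] by auto
  have eq: "(mat_adjoint (c t) * c t) $$ (i, j) =
      (\<Sum>k<i. cnj (c t $$ (k, i)) * c t $$ (k, j)) + c t $$ (i, i) * c t $$ (i, j)" if "j < n" for j t
  proof -
    have "(mat_adjoint (c t) * c t) $$ (i, j) = (\<Sum>k<n. cnj (c t $$ (k, i)) * c t $$ (k, j))"
      using less.prems that cc[of t] dims by (simp add: index_mult_sum[of _ n n _ n])
    also have "\<dots> = (\<Sum>k<Suc i. cnj (c t $$ (k, i)) * c t $$ (k, j))"
      by (rule sum.mono_neutral_right) (use less.prems up in auto)
    also have "cnj (c t $$ (i, i)) = c t $$ (i, i)"
      using complex_nonneg_cnj[OF less_imp_le[OF pos]] less.prems by simp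
    ultimately show ?thesis by simp
  qed
  have S: "(\<lambda>t. \<Sum>k<i. cnj (c t $$ (k, i)) * c t $$ (k, j)) differentiable (at t)" if "j < n" for j
    by (intro differentiable_sum_complex differentiable_mult differentiable_cnj less.IH) (use less.prems that in auto)
  have P: "(\<lambda>t. c t $$ (i, i) * c t $$ (i, j)) differentiable (at t)" if "j < n" for j
  proof -
    have "(\<lambda>t. c t $$ (i, i) * c t $$ (i, j)) =
        (\<lambda>t. (mat_adjoint (c t) * c t) $$ (i, j) - (\<Sum>k<i. cnj (c t $$ (k, i)) * c t $$ (k, j)))"
      using eq[OF that] by auto
    then show ?thesis using G[OF \<open>i < n\<close> that] S[OF that] by simp
  qed
  have D: "(\<lambda>t. c t $$ (i, i)) differentiable (at t)"
    by (rule differentiable_positive_root[OF P]) (use less.prems pos in auto)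
  have nz: "c t $$ (i, i) \<noteq> 0" for t using pos[of i t] less.prems by auto
  have "(\<lambda>t. c t $$ (i, j)) = (\<lambda>t. (c t $$ (i, i) * c t $$ (i, j)) / c t $$ (i, i))"
    using nz by simp
  then show ?case using differentiable_divide[OF P[OF \<open>j < n\<close>] D] nz by simp
qed

text \<open>Passing to \<open>mat_adjoint (M t) * M t\<close> eliminates the unitary factor, about
  which nothing analytic is assumed, and makes \<open>c t\<close> a Cholesky factor.\<close>

lemma qr_differentiable:
  fixes M h c :: "real \<Rightarrow> complex mat"
  assumes h: "\<And>t. h t \<in> unitary_group n" and c: "\<And>t. c t \<in> pos_upper n" and M: "\<And>t. M t = h t * c t"
    and dM: "\<And>i j. i < n \<Longrightarrow> j < n \<Longrightarrow> (\<lambda>t. M t $$ (i, j)) differentiable (at t)"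
    and "i < n" "j < n"
  shows "(\<lambda>t. c t $$ (i, j)) differentiable (at t)"
proof (rule cholesky_differentiable[OF c _ assms(5,6)])
  fix i j assume ij: "i < n" "j < n"
  have cM: "mat_adjoint (c t) * c t = mat_adjoint (M t) * M t" and Mc: "M t \<in> carrier_mat n n" for t
  proof -
    note H = unitary_groupD[OF h[of t]]
    have cc: "c t \<in> carrier_mat n n" using c[of t] by (simp add: pos_upper_def)
    have "mat_adjoint (M t) * M t = mat_adjoint (c t) * ((mat_adjoint (h t) * h t) * c t)"
      unfolding M using H(1) cc by (simp add: mat_adjoint_mult[of _ n n _ n] mult_assoc[of _ n])
    then show "mat_adjoint (c t) * c t = mat_adjoint (M t) * M t" using H cc by simp
    show "M t \<in> carrier_mat n n" unfolding M using H cc by simp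
  qed
  have "(\<lambda>t. (mat_adjoint (c t) * c t) $$ (i, j)) = (\<lambda>t. \<Sum>k<n. cnj (M t $$ (k, i)) * M t $$ (k, j))"
  proof -
    have "dim_row (M t) = n" "dim_col (M t) = n" for t using Mc[of t] by auto
    then show ?thesis
      using ij cM Mc
      by (simp add: index_mult_sum[of _ n n _ n])
  qed
  moreover have "(\<lambda>t. \<Sum>k<n. cnj (M t $$ (k, i)) * M t $$ (k, j)) differentiable (at t)"
    by (intro differentiable_sum_complex differentiable_mult differentiable_cnj dM) (use ij in auto)
  ultimately show "(\<lambda>t. (mat_adjoint (c t) * c t) $$ (i, j)) differentiable (at t)" by simp
qed

subsection \<open>Perturbation to positive minors\<close>

text \<open>One common coefficient \<open>a\<close> gives a one-parameter family through
  \<open>A\<close> at \<open>a = 0\<close>. The fold applies the last entry of the list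
  first.\<close>

definition addrows :: "complex \<Rightarrow> (nat \<times> nat) list \<Rightarrow> complex mat \<Rightarrow> complex mat" where
  "addrows a ops A = foldr (\<lambda>(r, s). addrow a r s) ops A"

lemma addrows_Nil [simp]: "addrows a [] A = A"
  and addrows_Cons [simp]: "addrows a ((r, s) # ops) A = addrow a r s (addrows a ops A)"
  and addrows_append: "addrows a (xs @ ys) A = addrows a xs (addrows a ys A)"
  by (simp_all add: addrows_def)

definition adjacent_ops :: "nat \<Rightarrow> (nat \<times> nat) list" where
  "adjacent_ops n = filter (\<lambda>p. p \<in> adjacent) (List.product [0..<n] [0..<n])"

lemma set_adjacent_ops: "set (adjacent_ops n) = {(r, s). (r, s) \<in> adjacent \<and> r < n \<and> s < n}"
  by (auto simp: adjacent_ops_def)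

lemma addrows_carrier: "A \<in> carrier_mat n n \<Longrightarrow> addrows a ops A \<in> carrier_mat n n"
  by (induction ops) auto

lemma addrows_det:
  assumes "A \<in> carrier_mat n n" "set ops \<subseteq> set (adjacent_ops n)"
  shows "det (addrows a ops A) = det A"
  using assms(2)
proof (induction ops)
  case (Cons p ops)
  obtain r s where p: "p = (r, s)" by (cases p)
  then have "s < n" "r \<noteq> s" using Cons.prems by (auto simp: set_adjacent_ops adjacent_def)
  from det_addrow[OF this addrows_carrier[OF assms(1)], of a a ops] show ?case using Cons p by auto
qed simp

lemma addrows_zero: "A \<in> carrier_mat n n \<Longrightarrow> set ops \<subseteq> set (adjacent_ops n) \<Longrightarrow> addrows 0 ops A = A"
proof (induction ops)
  case (Cons p ops)
  obtain r s where p: "p = (r, s)" by (cases p)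
  have "addrow 0 r s A = A" using Cons.prems by (intro eq_matI) auto
  then show ?case using Cons p by simp
qed simp

lemma addrows_differentiable:
  assumes "A \<in> carrier_mat n n" "set ops \<subseteq> set (adjacent_ops n)"
  shows "i < n \<Longrightarrow> j < n \<Longrightarrow> (\<lambda>a. addrows (complex_of_real a) ops A $$ (i, j)) differentiable (at t)"
  using assms(2)
proof (induction ops arbitrary: i)
  case (Cons p ops)
  obtain r s where p: "p = (r, s)" by (cases p)
  have s: "s < n" using p Cons.prems by (auto simp: set_adjacent_ops)
  have d: "(\<lambda>a. complex_of_real a) differentiable (at t)"
    using bounded_linear.has_derivative[OF bounded_linear_of_real has_derivative_ident] unfolding differentiable_def by blast
  have "addrows (complex_of_real a) (p # ops) A $$ (i, j) =
      (if r = i then complex_of_real a * addrows (complex_of_real a) ops A $$ (s, j) else 0)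
      + addrows (complex_of_real a) ops A $$ (i, j)" for a
    using p Cons.prems addrows_carrier[OF assms(1), of "complex_of_real a" ops] by auto
  moreover have "(\<lambda>a. (if r = i then complex_of_real a * addrows (complex_of_real a) ops A $$ (s, j) else 0)
      + addrows (complex_of_real a) ops A $$ (i, j)) differentiable (at t)"
    using Cons.IH[of i] Cons.IH[of s] Cons.prems s d by (cases "r = i") auto
  ultimately show ?case by simp
qed auto

lemma addrows_tnn_flag:
  assumes A: "A \<in> carrier_mat n n" "tnn_flag n A" and a: "0 \<le> a" and ops: "set ops \<subseteq> set (adjacent_ops n)"
  shows "tnn_flag n (addrows a ops A)"
    and "row_choice n k f \<Longrightarrow> left_minor A k f \<le> left_minor (addrows a ops A) k f"
proof -
  have "tnn_flag n (addrows a ops A) \<and>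
    (\<forall>k f. row_choice n k f \<longrightarrow> left_minor A k f \<le> left_minor (addrows a ops A) k f)"
    using ops
  proof (induction ops)
    case (Cons p ops)
    obtain r s where p: "p = (r, s)" by (cases p)
    have rs: "(r, s) \<in> adjacent" "r < n" "s < n" using p Cons.prems by (auto simp: set_adjacent_ops)
    note IH = Cons.IH
    have tf: "tnn_flag n (addrows a ops A)" using Cons by simp
    note step = tnn_flag_addrow[OF addrows_carrier[OF A(1)] tf rs a]
    show ?case
    proof (intro conjI allI impI)
      show "tnn_flag n (addrows a (p # ops) A)" using step(1) p by simp
      fix k f assume "row_choice n k f"
      then show "left_minor A k f \<le> left_minor (addrows a (p # ops) A) k f"
        using Cons p step(2)[of k f] by (auto intro: order_trans[OF _ step(2)])
    qed
  qed (use A in simp)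
  then show "tnn_flag n (addrows a ops A)"
    and "row_choice n k f \<Longrightarrow> left_minor A k f \<le> left_minor (addrows a ops A) k f" by auto
qed

text \<open>The operation adding row \<open>f m\<close> to row \<open>r\<close> raises the minor of
  the moved choice by \<open>a\<close> times a positive minor. The list is split there: the
  operations applied before keep the old minor positive, and those applied after cannot decrease the
  new one.\<close>

lemma addrows_spread:
  assumes A: "A \<in> carrier_mat n n" "tnn_flag n A" and a: "0 < a" and ops: "set ops \<subseteq> set (adjacent_ops n)"
    and f: "row_choice n k f" "0 < left_minor A k f" and m: "m < k" "(r, f m) \<in> set ops"
    and f': "row_choice n k (f(m := r))"
  shows "0 < left_minor (addrows a ops A) k (f(m := r))"
proof -
  from m(2) obtain xs ys where ops': "ops = xs @ (r, f m) # ys" by (meson split_list)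
  define B where "B = addrows a ys A"
  have sub: "set xs \<subseteq> set (adjacent_ops n)" "set ys \<subseteq> set (adjacent_ops n)" using ops ops' by auto
  have B: "B \<in> carrier_mat n n" "tnn_flag n B" "0 < left_minor B k f"
    using addrows_tnn_flag[OF A less_imp_le[OF a] sub(2)] addrows_carrier[OF A(1)] f
    by (auto simp: B_def intro: less_le_trans)
  have rs: "(r, f m) \<in> adjacent" "r < n" "f m < n" using m(2) ops by (auto simp: set_adjacent_ops)
  define C where "C = addrow a r (f m) B"
  have "left_minor C k (f(m := r)) = left_minor B k (f(m := r)) + a * left_minor B k f"
    using left_minor_addrow[OF B(1) f' m(1) rs(3), of a] by (simp add: C_def)
  moreover have "0 \<le> left_minor B k (f(m := r))" using B(2) f' by (simp add: tnn_flag_def)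
  moreover have "0 < a * left_minor B k f" using a B(3) by (rule complex_mult_pos)
  ultimately have "0 < left_minor C k (f(m := r))" by (simp add: less_complex_def less_eq_complex_def)
  moreover have "C \<in> carrier_mat n n" "tnn_flag n C"
    using B(1) tnn_flag_addrow(1)[OF B(1,2) rs less_imp_le[OF a]] by (simp_all add: C_def)
  ultimately show ?thesis
    using addrows_tnn_flag(2)[OF _ _ less_imp_le[OF a] sub(1), of C k "f(m := r)"] f'
    by (simp add: ops' addrows_append B_def C_def less_le_trans)
qed

text \<open>With truncated subtraction, \<open>(f j - (i + j)) + ((i + j) - f j)\<close> is the
  distance of the \<open>j\<close>-th row from its target in the window starting at
  \<open>i\<close>. If some row lies beyond its target, the least such index has a gap below it and
  is decreased; otherwise the greatest index short of its target has a gap above it and is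
  increased.\<close>

lemma row_choice_move:
  assumes f: "row_choice n k f" and ik: "i + k \<le> n" and ne: "\<exists>j<k. f j \<noteq> i + j"
  obtains m r where "m < k" "(r, f m) \<in> set (adjacent_ops n)" "row_choice n k (f(m := r))"
    "(\<Sum>j<k. ((f(m := r)) j - (i + j)) + ((i + j) - (f(m := r)) j)) < (\<Sum>j<k. (f j - (i + j)) + ((i + j) - f j))"
proof -
  have dec: "(\<Sum>j<k. ((f(m := r)) j - (i + j)) + ((i + j) - (f(m := r)) j)) < (\<Sum>j<k. (f j - (i + j)) + ((i + j) - f j))"
    if "m < k" "(r - (i + m)) + ((i + m) - r) < (f m - (i + m)) + ((i + m) - f m)" for m r
    by (rule sum_strict_mono_ex1) (use that in auto)
  show thesis
  proof (cases "\<exists>j. j < k \<and> i + j < f j")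
    case True
    define m where "m = (LEAST j. j < k \<and> i + j < f j)"
    have m: "m < k" "i + m < f m" using LeastI_ex[OF True] by (auto simp: m_def)
    have least: "f j \<le> i + j" if "j < m" for j
      using not_less_Least[of j "\<lambda>j. j < k \<and> i + j < f j"] that m by (auto simp: m_def not_less)
    have "row_choice n k (f(m := f m - 1))"
      unfolding row_choice_def
    proof (intro conjI allI impI)
      fix j assume "j < k"
      then show "(f(m := f m - 1)) j < n" using row_choice_bound[OF f, of j] by auto
    next
      fix j l assume jl: "j < l" "l < k"
      show "(f(m := f m - 1)) j < (f(m := f m - 1)) l"
        using row_choice_less[OF f jl] least[of j] m jl by auto
    qed
    moreover have "(f m - 1, f m) \<in> set (adjacent_ops n)"
      using m row_choice_bound[OF f m(1)] by (auto simp: set_adjacent_ops adjacent_def)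
    ultimately show thesis using that m dec[OF m(1), of "f m - 1"] by auto
  next
    case False
    then have le: "f j \<le> i + j" if "j < k" for j using that by (meson not_less)
    with ne have ex: "\<exists>j. j < k \<and> f j < i + j" using nat_less_le by blast
    define m where "m = (GREATEST j. j < k \<and> f j < i + j)"
    have m: "m < k" "f m < i + m"
      using GreatestI_ex_nat[OF ex, of k] by (auto simp: m_def)
    have greatest: "f j = i + j" if "m < j" "j < k" for j
      using Greatest_le_nat[of "\<lambda>j. j < k \<and> f j < i + j" j k] that le[of j] by (force simp: m_def)
    have "row_choice n k (f(m := Suc (f m)))"
      unfolding row_choice_def
    proof (intro conjI allI impI)
      fix j assume "j < k"
      then show "(f(m := Suc (f m))) j < n" using row_choice_bound[OF f, of j] m ik by auto
    next
      fix j l assume jl: "j < l" "l < k"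
      show "(f(m := Suc (f m))) j < (f(m := Suc (f m))) l"
        using row_choice_less[OF f jl] greatest[of l] m jl by auto
    qed
    moreover have "(Suc (f m), f m) \<in> set (adjacent_ops n)"
      using m row_choice_bound[OF f m(1)] ik by (auto simp: set_adjacent_ops adjacent_def)
    ultimately show thesis using that m dec[OF m(1), of "Suc (f m)"] by auto
  qed
qed

text \<open>Every round contains all adjacent operations, so a single list serves all choices
  \<open>f\<close> and all windows at once.\<close>

primrec rounds :: "nat \<Rightarrow> nat \<Rightarrow> (nat \<times> nat) list" where
  "rounds n 0 = []"
| "rounds n (Suc N) = rounds n N @ adjacent_ops n"

lemma set_rounds: "set (rounds n N) \<subseteq> set (adjacent_ops n)"
  by (induction N) auto

text \<open>Each round admits one unit move towards the window, so \<open>N\<close> rounds suffice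
  for total distance \<open>N\<close>. The block appended by \<open>Suc N\<close> is the one applied
  first, which is why the induction varies \<open>A\<close> and \<open>f\<close>.\<close>

lemma rounds_positive:
  assumes "A \<in> carrier_mat n n" "tnn_flag n A" "0 < a" "row_choice n k f" "0 < left_minor A k f"
    "i + k \<le> n" "(\<Sum>j<k. (f j - (i + j)) + ((i + j) - f j)) \<le> N"
  shows "0 < block_minor (addrows a (rounds n N) A) 0 k i"
  using assms
proof (induction N arbitrary: A f)
  case (Suc N)

  let ?B = "addrows a (adjacent_ops n) A"
  have B: "?B \<in> carrier_mat n n" "tnn_flag n ?B" "0 < left_minor ?B k f"
    using addrows_carrier[OF Suc.prems(1)] addrows_tnn_flag[OF Suc.prems(1,2) less_imp_le[OF Suc.prems(3)]]
      Suc.prems(4,5) by (blast intro: less_le_trans)+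
  show ?case
  proof (cases "\<exists>j<k. f j \<noteq> i + j")
    case True
    obtain m r where
      m: "m < k" "(r, f m) \<in> set (adjacent_ops n)" "row_choice n k (f(m := r))"
      "(\<Sum>j<k. ((f(m := r)) j - (i + j)) + ((i + j) - (f(m := r)) j)) < (\<Sum>j<k. (f j - (i + j)) + ((i + j) - f j))"
      by (rule row_choice_move[OF Suc.prems(4,6) True])
    have "0 < left_minor ?B k (f(m := r))"
      by (rule addrows_spread[OF Suc.prems(1-3) _ Suc.prems(4,5) m(1-3)]) simp
    moreover have "(\<Sum>j<k. ((f(m := r)) j - (i + j)) + ((i + j) - (f(m := r)) j)) \<le> N"
      using m(4) Suc.prems(7) by linarith
    ultimately show ?thesis
      unfolding rounds.simps addrows_append by (rule Suc.IH[OF B(1,2) Suc.prems(3) m(3) _ Suc.prems(6)])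
  next
    case False
    then have "(\<Sum>j<k. (f j - (i + j)) + ((i + j) - f j)) = 0" by (intro sum.neutral) auto
    then show ?thesis
      unfolding rounds.simps addrows_append by (intro Suc.IH[OF B(1,2) Suc.prems(3,4) B(3) Suc.prems(6)]) simp
  qed
next
  case 0
  then have "(\<Sum>j<k. (f j - (i + j)) + ((i + j) - f j)) = 0" by simp
  then have "f j = i + j" if "j < k" for j using that by (simp add: sum_eq_0_iff) (meson le_antisym lessThan_iff)
  then have "block_minor A 0 k i = left_minor A k f"
    unfolding block_minor_def left_minor_def by (intro arg_cong[where f = det] eq_matI) auto
  then show ?case using 0(5) by simp
qed

section \<open>Nonnegativity is a closed condition\<close>

lemma tendsto_left_minor:
  assumes A: "\<And>i j. i < n \<Longrightarrow> j < n \<Longrightarrow> ((\<lambda>t. A t $$ (i, j)) \<longlongrightarrow> B $$ (i, j)) F" and f: "row_choice n k f"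
  shows "((\<lambda>t. left_minor (A t) k f) \<longlongrightarrow> left_minor B k f) F"
proof -
  have det: "left_minor M k f = (\<Sum>p | p permutes {0..<k}. of_int (sign p) * (\<Prod>i = 0..<k. M $$ (f i, p i)))" for M
    unfolding left_minor_def
    by (subst det_def'[of _ k]) (auto intro!: sum.cong prod.cong arg_cong2[where f = "(*)"] dest: permutes_in_image)
  show ?thesis
    unfolding det
  proof (intro tendsto_intros A)
    fix p i assume "p \<in> {p. p permutes {0..<k}}" "i \<in> {0..<k}"
    then have "p i < k" "i < k" using permutes_in_image[of p "{0..<k}" i] by auto
    then show "f i < n" "p i < n" using row_choice_bound[OF f] row_choice_le[OF f] by auto
  qed
qed

lemma tnn_flag_limit:
  assumes F: "F \<noteq> bot" and A: "\<And>i j. i < n \<Longrightarrow> j < n \<Longrightarrow> ((\<lambda>t. A t $$ (i, j)) \<longlongrightarrow> B $$ (i, j)) F"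
    and ev: "eventually (\<lambda>t. tnn_flag n (A t)) F"
  shows "tnn_flag n B"
  unfolding tnn_flag_def
proof (intro allI impI)
  fix k f assume f: "row_choice n k f"
  note lim = tendsto_left_minor[OF A f, simplified]
  have ev: "eventually (\<lambda>t. 0 \<le> left_minor (A t) k f) F"
    using ev by eventually_elim (use f in \<open>simp add: tnn_flag_def\<close>)
  have "0 \<le> Re (left_minor B k f)"
    by (rule tendsto_lowerbound[OF tendsto_Re[OF lim] _ F]) (use ev in \<open>auto simp: less_eq_complex_def elim: eventually_mono\<close>)
  moreover have "((\<lambda>t. Im (left_minor (A t) k f)) \<longlongrightarrow> 0) F"
    by (rule tendsto_eventually) (use ev in \<open>auto simp: less_eq_complex_def elim: eventually_mono\<close>)
  then have "Im (left_minor B k f) = 0" using tendsto_unique[OF F tendsto_Im[OF lim]] by blast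
  ultimately show "0 \<le> left_minor B k f" by (simp add: less_eq_complex_def)
qed

text \<open>Repeating elementary row operations with a small parameter makes every minor on consecutive
  rows positive; the unitary QR factor of the result tends to \<open>g\<close> with the parameter.\<close>

theorem tnn_flag_inverse:
  assumes g: "g \<in> unitary_group n" "tnn_flag n g"
  shows "tnn_flag n (dconj n (mat_adjoint g))"
proof -
  note G = unitary_groupD[OF g(1)]
  \<comment> \<open>A crude count of rounds: at most \<open>n\<close> rows, each at distance at most
    \<open>n + n\<close> from its target.\<close>
  define N where "N = n * (n + n)"
  define M where "M a = addrows (complex_of_real a) (rounds n N) g" for a
  have Mc: "M a \<in> carrier_mat n n" for a using addrows_carrier[OF G(1)] by (simp add: M_def)
  have "det (M a) \<noteq> 0" for a
    using addrows_det[OF G(1) set_rounds] G(4) by (simp add: M_def)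
  then have "\<forall>a. \<exists>h c. h \<in> unitary_group n \<and> c \<in> pos_upper n \<and> M a = h * c"
    using qr_decomposition[OF Mc] by blast
  then obtain h c where h: "\<And>a. h a \<in> unitary_group n" and c: "\<And>a. c a \<in> pos_upper n"
    and hc: "\<And>a. M a = h a * c a" by metis
  note H = unitary_groupD[OF h]
  have cc: "c a \<in> carrier_mat n n" for a using c[of a] by (simp add: pos_upper_def)
  have dM: "(\<lambda>a. M a $$ (i, j)) differentiable (at t)" if "i < n" "j < n" for i j t
    unfolding M_def by (rule addrows_differentiable[OF G(1) set_rounds that])
  have M0: "M 0 = g" using addrows_zero[OF G(1) set_rounds] by (simp add: M_def)
  have hMc: "mat_adjoint (h a) * M a = c a" for a
  proof -
    have "mat_adjoint (h a) * M a = (mat_adjoint (h a) * h a) * c a"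
      unfolding hc using H(1)[of a] cc[of a] by (simp add: mult_assoc[of _ n])
    then show ?thesis using H(3)[of a] left_mult_one_mat[OF cc[of a]] by simp
  qed
  have "c 0 \<in> unitary_group n"
    using hMc[of 0] M0 unitary_mult[OF unitary_adjoint[OF h[of 0]] g(1)] by simp
  then have c0: "c 0 = 1\<^sub>m n" by (rule pos_upper_unitary[OF c])
  have lim: "((\<lambda>a. F a $$ (i, j)) \<longlongrightarrow> F 0 $$ (i, j)) (at_right 0)"
    if "(\<lambda>a. F a $$ (i, j)) differentiable (at 0)" for F :: "real \<Rightarrow> complex mat" and i j
  proof -
    have "isCont (\<lambda>a. F a $$ (i, j)) 0" using that has_derivative_continuous by (auto simp: differentiable_def)
    then show ?thesis by (auto simp: isCont_def intro: tendsto_within_subset)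
  qed
  have limM: "((\<lambda>a. M a $$ (i, j) - g $$ (i, j)) \<longlongrightarrow> 0) (at_right 0)" if "i < n" "j < n" for i j
    using tendsto_diff[OF lim[OF dM[OF that]] tendsto_const[of "g $$ (i, j)"]] M0 by simp
  have limc: "((\<lambda>a. c a $$ (i, j)) \<longlongrightarrow> 1\<^sub>m n $$ (i, j)) (at_right 0)" if "i < n" "j < n" for i j
    using lim[OF qr_differentiable[OF h c hc dM that]] c0 by simp
  have limhM: "((\<lambda>a. cnj (h a $$ (l, i)) * (M a $$ (l, j) - g $$ (l, j))) \<longlongrightarrow> 0) (at_right 0)"
    if "i < n" "j < n" "l < n" for i j l
  proof (rule tendsto_0_le[OF limM[OF that(3,2)], of _ 1])
    show "\<forall>\<^sub>F a in at_right 0. norm (cnj (h a $$ (l, i)) * (M a $$ (l, j) - g $$ (l, j))) \<le> norm (M a $$ (l, j) - g $$ (l, j)) * 1"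
      using unitary_entry_bound[OF h that(3,1)] by (auto simp: norm_mult mult_left_le_one_le)
  qed
  have hg: "mat_adjoint (h a) * g = c a - mat_adjoint (h a) * (M a - g)" for a
    using H(1)[of a] G(1) Mc[of a] cc[of a] hMc[of a]
    by (simp add: mult_minus_distrib_mat[of _ n n]) (auto intro!: eq_matI)
  have limhg: "((\<lambda>a. (mat_adjoint (h a) * g) $$ (i, j)) \<longlongrightarrow> 1\<^sub>m n $$ (i, j)) (at_right 0)"
    if ij: "i < n" "j < n" for i j
  proof -
    have "(mat_adjoint (h a) * g) $$ (i, j) =
        c a $$ (i, j) - (\<Sum>l<n. cnj (h a $$ (l, i)) * (M a $$ (l, j) - g $$ (l, j)))" for a
    proof -
      have "M a - g \<in> carrier_mat n n" using G(1) by (rule minus_carrier_mat)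
      then show ?thesis
        unfolding hg using H(1)[of a] G(1) Mc[of a] cc[of a] ij by (simp add: index_mult_sum[of _ n n _ n])
    qed
    moreover have "((\<lambda>a. c a $$ (i, j) - (\<Sum>l<n. cnj (h a $$ (l, i)) * (M a $$ (l, j) - g $$ (l, j)))) \<longlongrightarrow>
        1\<^sub>m n $$ (i, j) - (\<Sum>l<n. 0)) (at_right 0)"
      by (intro tendsto_diff tendsto_sum limc limhM) (use ij in auto)
    ultimately show ?thesis by simp
  qed
  have hgg: "mat_adjoint (h a) = (mat_adjoint (h a) * g) * mat_adjoint g" for a
    using H(1)[of a] G by (simp add: mult_assoc[of _ n])
  have limh: "((\<lambda>a. mat_adjoint (h a) $$ (i, j)) \<longlongrightarrow> mat_adjoint g $$ (i, j)) (at_right 0)"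
    if ij: "i < n" "j < n" for i j
  proof -
    have "mat_adjoint (h a) $$ (i, j) = (\<Sum>l<n. (mat_adjoint (h a) * g) $$ (i, l) * mat_adjoint g $$ (l, j))" for a
      using H(1)[of a] G(1) ij by (subst hgg) (rule index_mult_sum, auto)
    moreover have "((\<lambda>a. \<Sum>l<n. (mat_adjoint (h a) * g) $$ (i, l) * mat_adjoint g $$ (l, j)) \<longlongrightarrow>
        (\<Sum>l<n. 1\<^sub>m n $$ (i, l) * mat_adjoint g $$ (l, j))) (at_right 0)"
      by (intro tendsto_sum tendsto_mult tendsto_const limhg) (use ij in auto)
    moreover have "(\<Sum>l<n. 1\<^sub>m n $$ (i, l) * mat_adjoint g $$ (l, j)) = (1\<^sub>m n * mat_adjoint g) $$ (i, j)"
      using G(1) ij by (subst index_mult_sum[of _ n n _ n]) auto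
    ultimately show ?thesis using G(1) by simp
  qed
  have pos: "tnn_flag n (dconj n (mat_adjoint (h a)))" if a: "0 < a" for a
  proof (rule tnn_flag_inverse_generic[OF h])
    fix i k assume ik: "i + k \<le> n"
    have a': "0 < complex_of_real a" using a by (simp add: less_complex_def)
    obtain f where f: "row_choice n k f" "left_minor g k f \<noteq> 0"
      using exists_nonzero_left_minor[OF G(1,4), of k] ik by auto
    then have f0: "0 < left_minor g k f" using g(2) by (auto simp: tnn_flag_def order_le_less)
    have "(\<Sum>j<k. (f j - (i + j)) + ((i + j) - f j)) \<le> (\<Sum>j<k. n + n)"
    proof (rule sum_mono)
      fix j assume "j \<in> {..<k}"
      then show "(f j - (i + j)) + ((i + j) - f j) \<le> n + n"
        using row_choice_bound[OF f(1), of j] ik by auto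
    qed
    also have "\<dots> \<le> N" using ik by (simp add: N_def)
    finally have "0 < block_minor (M a) 0 k i"
      unfolding M_def using rounds_positive[OF G(1) g(2) a' f(1) f0 ik] by blast
    moreover have "block_minor (M a) 0 k i = block_minor (h a) 0 k i * (\<Prod>j<k. c a $$ (j, j))"
    proof -
      have "row_choice n k (\<lambda>j. i + j)" using ik by (auto simp: row_choice_def)
      from left_minor_mult_upper[OF H(1)[of a] cc[of a] _ this] c[of a]
      show ?thesis by (simp add: hc left_minor_def block_minor_def pos_upper_def)
    qed
    moreover have "0 < (\<Prod>j<k. c a $$ (j, j))"
      using c[of a] ik by (intro complex_prod_pos) (auto simp: pos_upper_def)
    ultimately show "0 < block_minor (h a) 0 k i"
      using complex_divide_pos by (metis less_irrefl nonzero_mult_div_cancel_right)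
  qed
  show ?thesis
  proof (rule tnn_flag_limit[of "at_right 0" n "\<lambda>a. dconj n (mat_adjoint (h a))"])
    fix i j assume ij: "i < n" "j < n"
    have "((\<lambda>a. (- 1) ^ i * mat_adjoint (h a) $$ (i, j) * (- 1) ^ j) \<longlongrightarrow>
        (- 1) ^ i * mat_adjoint g $$ (i, j) * (- 1) ^ j) (at_right 0)"
      by (intro tendsto_intros limh ij)
    then show "((\<lambda>a. dconj n (mat_adjoint (h a)) $$ (i, j)) \<longlongrightarrow> dconj n (mat_adjoint g) $$ (i, j)) (at_right 0)"
      using H(1) G(1) ij by simp
  next
    show "\<forall>\<^sub>F a in at_right 0. tnn_flag n (dconj n (mat_adjoint (h a)))"
      using pos by (auto simp: eventually_at_filter)
  qed simp
qed

lemma square_eqI: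
  assumes "A \<in> carrier_mat n n" "B \<in> carrier_mat n n"
    and "\<And>i j. i < n \<Longrightarrow> j < n \<Longrightarrow> A $$ (i, j) = B $$ (i, j)"
  shows "A = B"
  using assms by (intro eq_matI) auto

subsection \<open>The projection and derivatives of matrix curves\<close>

text \<open>Strictly below the diagonal only the skew-Hermitian summand contributes, which fixes
  that part; skew-Hermitian symmetry then fixes the part above, and on the diagonal the real summand
  takes away the real part.\<close>

definition proj_form :: "nat \<Rightarrow> complex mat \<Rightarrow> complex mat" where
  "proj_form n A = mat n n (\<lambda>(i, j). if j < i then A $$ (i, j) else if i < j then - cnj (A $$ (j, i))
     else \<i> * Im (A $$ (i, i)))"

lemma proj_form_carrier [simp]: "proj_form n A \<in> carrier_mat n n"
  by (simp add: proj_form_def)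

lemma skew_hermitian_iff:
  "X \<in> skew_hermitian n \<longleftrightarrow> X \<in> carrier_mat n n \<and> (\<forall>i<n. \<forall>j<n. X $$ (i, j) = - cnj (X $$ (j, i)))"
proof (cases "X \<in> carrier_mat n n")
  case True
  then have "mat_adjoint X = - X \<longleftrightarrow> (\<forall>i<n. \<forall>j<n. cnj (X $$ (j, i)) = - X $$ (i, j))"
    by (auto simp: mat_eq_iff)
  also have "\<dots> \<longleftrightarrow> (\<forall>i<n. \<forall>j<n. X $$ (i, j) = - cnj (X $$ (j, i)))"
    by (simp only: equation_minus_iff[of "X $$ _" "cnj _"])
  finally show ?thesis using True by (simp add: skew_hermitian_def)
qed (simp add: skew_hermitian_def)

lemma skew_hermitian_entry: "X \<in> skew_hermitian n \<Longrightarrow> i < n \<Longrightarrow> j < n \<Longrightarrow> X $$ (i, j) = - cnj (X $$ (j, i))"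
  unfolding skew_hermitian_iff by blast

lemma skew_hermitian_carrier: "X \<in> skew_hermitian n \<Longrightarrow> X \<in> carrier_mat n n"
  by (simp add: skew_hermitian_def)

lemma proj_form_skew: "proj_form n A \<in> skew_hermitian n"
  by (auto simp: skew_hermitian_iff proj_form_def)

lemma proj_decomposition_iff:
  assumes A: "A \<in> carrier_mat n n"
  shows "U \<in> skew_hermitian n \<and> (\<exists>D\<in>real_diagonal n. \<exists>R\<in>strictly_upper n. A = U + D + R) \<longleftrightarrow> U = proj_form n A"
proof
  assume "U \<in> skew_hermitian n \<and> (\<exists>D\<in>real_diagonal n. \<exists>R\<in>strictly_upper n. A = U + D + R)"
  then obtain D R where U: "U \<in> skew_hermitian n" and D: "D \<in> real_diagonal n" and R: "R \<in> strictly_upper n"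
    and eq: "A = U + D + R" by blast
  have c: "U \<in> carrier_mat n n" "D \<in> carrier_mat n n" "R \<in> carrier_mat n n"
    using U D R by (auto simp: skew_hermitian_def real_diagonal_def strictly_upper_def)
  have e: "A $$ (i, j) = U $$ (i, j) + D $$ (i, j) + R $$ (i, j)" if "i < n" "j < n" for i j
    unfolding eq using c that by simp
  have low: "U $$ (i, j) = A $$ (i, j)" if "i < n" "j < i" for i j
    using e[of i j] that D R c by (auto simp: real_diagonal_def strictly_upper_def diagonal_mat_def)
  have dg: "U $$ (i, i) = \<i> * Im (A $$ (i, i))" if "i < n" for i
  proof -
    have "Re (U $$ (i, i)) = 0" using arg_cong[OF skew_hermitian_entry[OF U that that], of Re] by simp
    moreover have "Im (A $$ (i, i)) = Im (U $$ (i, i))"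
      using e[OF that that] that D R by (auto simp: real_diagonal_def strictly_upper_def complex_is_Real_iff)
    ultimately show ?thesis by (simp add: complex_eq_iff)
  qed
  show "U = proj_form n A"
  proof (rule eq_matI)
    fix i j assume "i < dim_row (proj_form n A)" "j < dim_col (proj_form n A)"
    then have ij: "i < n" "j < n" by (auto simp: proj_form_def)
    show "U $$ (i, j) = proj_form n A $$ (i, j)"
    proof (cases i j rule: linorder_cases)
      case less
      then show ?thesis
        using ij low[of j i] skew_hermitian_entry[OF U ij] by (simp add: proj_form_def)
    qed (use ij low[of i j] dg[of i] in \<open>auto simp: proj_form_def\<close>)
  qed (use c in \<open>auto simp: proj_form_def\<close>)
next
  assume U: "U = proj_form n A"
  let ?D = "mat n n (\<lambda>(i, j). if i = j then complex_of_real (Re (A $$ (i, i))) else 0)"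
  let ?R = "mat n n (\<lambda>(i, j). if i < j then A $$ (i, j) - U $$ (i, j) else 0)"
  have "A = U + ?D + ?R"
    using A by (intro eq_matI) (auto simp: U proj_form_def complex_eq_iff not_less)
  moreover have "?D \<in> real_diagonal n" "?R \<in> strictly_upper n"
    by (auto simp: real_diagonal_def diagonal_mat_def strictly_upper_def)
  ultimately show "U \<in> skew_hermitian n \<and> (\<exists>D\<in>real_diagonal n. \<exists>R\<in>strictly_upper n. A = U + D + R)"
    using proj_form_skew U by blast
qed

lemma proj_u_eq: "A \<in> carrier_mat n n \<Longrightarrow> proj_u n A = proj_form n A"
  unfolding proj_u_def by (simp add: proj_decomposition_iff)

lemma proj_form_dconj: "A \<in> carrier_mat n n \<Longrightarrow> proj_form n (dconj n A) = dconj n (proj_form n A)"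
proof (rule eq_matI)
  fix i j assume A: "A \<in> carrier_mat n n" and "i < dim_row (dconj n (proj_form n A))" "j < dim_col (dconj n (proj_form n A))"
  then have ij: "i < n" "j < n" by auto
  show "proj_form n (dconj n A) $$ (i, j) = dconj n (proj_form n A) $$ (i, j)"
    unfolding dconj_index[OF proj_form_carrier ij] using A ij by (auto simp: proj_form_def)
qed (auto simp: proj_form_def)

section \<open>Differential calculus of matrix curves\<close>

lemma has_mat_derivative_carrier: "has_mat_derivative n L L' t \<Longrightarrow> L' \<in> carrier_mat n n"
  by (simp add: has_mat_derivative_def)

lemma has_mat_derivative_entry:
  "has_mat_derivative n L L' t \<Longrightarrow> i < n \<Longrightarrow> j < n \<Longrightarrow>
    ((\<lambda>s. L s $$ (i, j)) has_vector_derivative L' $$ (i, j)) (at t)"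
  by (simp add: has_mat_derivative_def)

lemma has_mat_derivative_unique:
  assumes "has_mat_derivative n L L1 t" "has_mat_derivative n L L2 t"
  shows "L1 = L2"
proof (rule square_eqI[OF assms[THEN has_mat_derivative_carrier]])
  fix i j assume "i < n" "j < n"
  from assms[THEN has_mat_derivative_entry, OF this]
  have "(\<lambda>x. x *\<^sub>R L1 $$ (i, j)) = (\<lambda>x. x *\<^sub>R L2 $$ (i, j))"
    unfolding has_vector_derivative_def by (rule has_derivative_unique)
  from fun_cong[OF this, of 1] show "L1 $$ (i, j) = L2 $$ (i, j)" by simp
qed

lemma has_mat_derivative_const: "A \<in> carrier_mat n n \<Longrightarrow> has_mat_derivative n (\<lambda>_. A) (0\<^sub>m n n) t"
  by (auto simp: has_mat_derivative_def)

lemma has_mat_derivative_mult: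
  assumes "has_mat_derivative n A A' t" "has_mat_derivative n B B' t"
    and c: "\<And>s. A s \<in> carrier_mat n n" "\<And>s. B s \<in> carrier_mat n n"
  shows "has_mat_derivative n (\<lambda>s. A s * B s) (A' * B t + A t * B') t"
  unfolding has_mat_derivative_def
proof (intro conjI allI impI)
  note c' = assms(1,2)[THEN has_mat_derivative_carrier]
  show "A' * B t + A t * B' \<in> carrier_mat n n" using c c' by simp
  fix i j assume ij: "i < n" "j < n"
  have "((\<lambda>s. \<Sum>k<n. A s $$ (i, k) * B s $$ (k, j)) has_vector_derivative
      (\<Sum>k<n. A t $$ (i, k) * B' $$ (k, j) + A' $$ (i, k) * B t $$ (k, j))) (at t)"
    using ij by (intro has_vector_derivative_sum has_vector_derivative_mult
        has_mat_derivative_entry[OF assms(1)] has_mat_derivative_entry[OF assms(2)]) auto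
  moreover have "(\<Sum>k<n. A t $$ (i, k) * B' $$ (k, j) + A' $$ (i, k) * B t $$ (k, j)) = (A' * B t + A t * B') $$ (i, j)"
    using ij c[of t] c' by (simp add: index_mult_sum[of _ n n _ n] sum.distrib)
  ultimately show "((\<lambda>s. (A s * B s) $$ (i, j)) has_vector_derivative (A' * B t + A t * B') $$ (i, j)) (at t)"
    using ij c by (simp add: index_mult_sum[of _ n n _ n])
qed

lemma has_mat_derivative_left_mult:
  assumes "has_mat_derivative n B B' t" "A \<in> carrier_mat n n" "\<And>s. B s \<in> carrier_mat n n"
  shows "has_mat_derivative n (\<lambda>s. A * B s) (A * B') t"
  using has_mat_derivative_mult[OF has_mat_derivative_const[OF assms(2)] assms(1,2,3)]
    has_mat_derivative_carrier[OF assms(1)] assms(2) assms(3)[of t] by simp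

lemma has_mat_derivative_right_mult:
  assumes "has_mat_derivative n B B' t" "A \<in> carrier_mat n n" "\<And>s. B s \<in> carrier_mat n n"
  shows "has_mat_derivative n (\<lambda>s. B s * A) (B' * A) t"
  using has_mat_derivative_mult[OF assms(1) has_mat_derivative_const[OF assms(2)] assms(3,2)]
    has_mat_derivative_carrier[OF assms(1)] assms(2) assms(3)[of t] by simp

lemma has_mat_derivative_adjoint:
  assumes "has_mat_derivative n A A' t" and c: "\<And>s. A s \<in> carrier_mat n n"
  shows "has_mat_derivative n (\<lambda>s. mat_adjoint (A s)) (mat_adjoint A') t"
proof -
  note c' = has_mat_derivative_carrier[OF assms(1)]
  have d: "dim_row (A s) = n" "dim_col (A s) = n" for s using c[of s] by auto
  show ?thesis
    unfolding has_mat_derivative_def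
  proof (intro conjI allI impI)
    show "mat_adjoint A' \<in> carrier_mat n n" using c' by simp
    fix i j assume ij: "i < n" "j < n"
    have "((\<lambda>s. cnj (A s $$ (j, i))) has_vector_derivative cnj (A' $$ (j, i))) (at t)"
      by (rule bounded_linear.has_vector_derivative[OF bounded_linear_cnj has_mat_derivative_entry[OF assms(1) ij(2,1)]])
    then show "((\<lambda>s. mat_adjoint (A s) $$ (i, j)) has_vector_derivative mat_adjoint A' $$ (i, j)) (at t)"
      using c' d ij by simp
  qed
qed

lemma has_mat_derivative_dconj:
  assumes "has_mat_derivative n A A' t" and c: "\<And>s. A s \<in> carrier_mat n n"
  shows "has_mat_derivative n (\<lambda>s. dconj n (A s)) (dconj n A') t"
proof -
  have "has_mat_derivative n (\<lambda>s. delta n * A s) (delta n * A') t"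
    by (rule has_mat_derivative_left_mult[OF assms(1) delta_carrier c])
  then show ?thesis
    unfolding dconj_def by (rule has_mat_derivative_right_mult) (use c in simp_all)
qed

lemma bracket_carrier [simp]: "A \<in> carrier_mat n n \<Longrightarrow> B \<in> carrier_mat n n \<Longrightarrow> bracket A B \<in> carrier_mat n n"
  unfolding bracket_def by (rule minus_carrier_mat) simp

lemma bracket_index:
  "A \<in> carrier_mat n n \<Longrightarrow> B \<in> carrier_mat n n \<Longrightarrow> i < n \<Longrightarrow> j < n \<Longrightarrow>
    bracket A B $$ (i, j) = (\<Sum>k<n. A $$ (i, k) * B $$ (k, j) - B $$ (i, k) * A $$ (k, j))"
  by (simp add: bracket_def index_mult_sum[of _ n n _ n] sum_subtractf)

lemma dconj_minus:
  assumes "A \<in> carrier_mat n n" "B \<in> carrier_mat n n"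
  shows "dconj n (A - B) = dconj n A - dconj n B"
proof (rule eq_matI)
  fix i j assume "i < dim_row (dconj n A - dconj n B)" "j < dim_col (dconj n A - dconj n B)"
  then have ij: "i < n" "j < n" by auto
  have "A - B \<in> carrier_mat n n" using assms(2) by (rule minus_carrier_mat)
  then show "dconj n (A - B) $$ (i, j) = (dconj n A - dconj n B) $$ (i, j)"
    using assms ij by (simp add: right_diff_distrib left_diff_distrib)
qed auto

lemma dconj_bracket:
  "A \<in> carrier_mat n n \<Longrightarrow> B \<in> carrier_mat n n \<Longrightarrow> dconj n (bracket A B) = bracket (dconj n A) (dconj n B)"
  unfolding bracket_def
  by (simp add: dconj_mult[symmetric] dconj_minus)

subsection \<open>Uniqueness of the Toda flow\<close>

text \<open>Gronwall's argument in both time directions: \<open>exp (- C s) D s\<close> does not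
  increase for positive times, \<open>exp (C s) D s\<close> does not decrease for negative ones, and
  both start from 0.\<close>

lemma differential_inequality_zero:
  fixes D D' :: "real \<Rightarrow> real"
  assumes D: "\<And>s. (D has_real_derivative D' s) (at s)" and D0: "D 0 = 0" and nonneg: "0 \<le> D t"
    and bound: "\<And>s. \<bar>s\<bar> \<le> \<bar>t\<bar> \<Longrightarrow> \<bar>D' s\<bar> \<le> C * D s"
  shows "D t = 0"
proof (cases "0 \<le> t")
  case True
  have "exp (- C * t) * D t \<le> exp (- C * 0) * D 0"
  proof (rule DERIV_nonpos_imp_nonincreasing[OF True])
    fix s assume s: "0 \<le> s" "s \<le> t"
    have "((\<lambda>s. exp (- C * s)) has_real_derivative exp (- C * s) * (- C)) (at s)"
      by (auto intro!: derivative_eq_intros)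
    from DERIV_mult[OF this D]
    have "((\<lambda>s. exp (- C * s) * D s) has_real_derivative exp (- C * s) * (D' s - C * D s)) (at s)"
      by (simp add: algebra_simps)
    moreover have "exp (- C * s) * (D' s - C * D s) \<le> 0"
      using bound[of s] s by (intro mult_nonneg_nonpos) (simp_all add: abs_le_iff)
    ultimately show "\<exists>y. ((\<lambda>s. exp (- C * s) * D s) has_real_derivative y) (at s) \<and> y \<le> 0" by blast
  qed
  then show ?thesis using D0 nonneg by (simp add: mult_le_0_iff)
next
  case False
  then have "t \<le> 0" by simp
  have "exp (C * t) * D t \<le> exp (C * 0) * D 0"
  proof (rule DERIV_nonneg_imp_nondecreasing[OF \<open>t \<le> 0\<close>])
    fix s assume s: "t \<le> s" "s \<le> 0"
    have "((\<lambda>s. exp (C * s)) has_real_derivative exp (C * s) * C) (at s)"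
      by (auto intro!: derivative_eq_intros)
    from DERIV_mult[OF this D]
    have "((\<lambda>s. exp (C * s) * D s) has_real_derivative exp (C * s) * (D' s + C * D s)) (at s)"
      by (simp add: algebra_simps)
    moreover have "0 \<le> exp (C * s) * (D' s + C * D s)"
      using bound[of s] s by (intro mult_nonneg_nonneg) (simp_all add: abs_le_iff)
    ultimately show "\<exists>y. ((\<lambda>s. exp (C * s) * D s) has_real_derivative y) (at s) \<and> 0 \<le> y" by blast
  qed
  then show ?thesis using D0 nonneg by (simp add: mult_le_0_iff)
qed

lemma proj_form_entry_bound:
  assumes "\<And>i j. i < n \<Longrightarrow> j < n \<Longrightarrow> cmod (A $$ (i, j)) \<le> \<delta>" "i < n" "j < n"
  shows "cmod (proj_form n A $$ (i, j)) \<le> \<delta>"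
  using assms(1)[of i j] assms(1)[of j i] assms(2,3) order_trans[OF abs_Im_le_cmod assms(1)[of i i]]
  by (auto simp: proj_form_def norm_mult)

lemma bracket_entry_bound:
  assumes c: "A \<in> carrier_mat n n" "B \<in> carrier_mat n n" and ij: "i < n" "j < n"
    and A: "\<And>i j. i < n \<Longrightarrow> j < n \<Longrightarrow> cmod (A $$ (i, j)) \<le> \<alpha>" and B: "\<And>i j. i < n \<Longrightarrow> j < n \<Longrightarrow> cmod (B $$ (i, j)) \<le> \<beta>"
  shows "cmod (bracket A B $$ (i, j)) \<le> real n * (2 * \<alpha> * \<beta>)"
proof -
  have pos: "0 \<le> \<alpha>" "0 \<le> \<beta>" using A[OF ij] B[OF ij] norm_ge_zero order_trans by blast+
  have "cmod (bracket A B $$ (i, j)) \<le> (\<Sum>k<n. cmod (A $$ (i, k) * B $$ (k, j) - B $$ (i, k) * A $$ (k, j)))"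
    unfolding bracket_index[OF c ij] by (rule norm_sum)
  also have "\<dots> \<le> (\<Sum>k<n. 2 * \<alpha> * \<beta>)"
  proof (rule sum_mono)
    fix k assume "k \<in> {..<n}"
    then have "cmod (A $$ (i, k) * B $$ (k, j)) \<le> \<alpha> * \<beta>" "cmod (B $$ (i, k) * A $$ (k, j)) \<le> \<beta> * \<alpha>"
      using A B ij pos by (auto simp: norm_mult intro!: mult_mono)
    then show "cmod (A $$ (i, k) * B $$ (k, j) - B $$ (i, k) * A $$ (k, j)) \<le> 2 * \<alpha> * \<beta>"
      using norm_triangle_ineq4[of "A $$ (i, k) * B $$ (k, j)" "B $$ (i, k) * A $$ (k, j)"]
        mult.commute[of \<beta> \<alpha>] by linarith
  qed
  finally show ?thesis by simp
qed

text \<open>The Toda field is quadratic over the reals, so its increment splits by bilinearity into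
  two brackets, each containing the difference \<open>L - K\<close> once. This is the local
  Lipschitz estimate in algebraic form.\<close>

lemma toda_field_difference:
  assumes c: "L \<in> carrier_mat n n" "K \<in> carrier_mat n n"
  shows "bracket L (proj_form n (- \<i> \<cdot>\<^sub>m L)) - bracket K (proj_form n (- \<i> \<cdot>\<^sub>m K)) =
    bracket (L - K) (proj_form n (- \<i> \<cdot>\<^sub>m L)) + bracket K (proj_form n (- \<i> \<cdot>\<^sub>m (L - K)))"
proof -
  have LK: "L - K \<in> carrier_mat n n" using c by (intro minus_carrier_mat)
  have p: "proj_form n (- \<i> \<cdot>\<^sub>m (L - K)) $$ (i, j) = proj_form n (- \<i> \<cdot>\<^sub>m L) $$ (i, j) - proj_form n (- \<i> \<cdot>\<^sub>m K) $$ (i, j)"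
    if "i < n" "j < n" for i j
    using c that by (auto simp: proj_form_def algebra_simps)
  note bc = bracket_carrier[OF _ proj_form_carrier]
  show ?thesis
  proof (rule square_eqI[of _ n])
    show "bracket L (proj_form n (- \<i> \<cdot>\<^sub>m L)) - bracket K (proj_form n (- \<i> \<cdot>\<^sub>m K)) \<in> carrier_mat n n"
      by (rule minus_carrier_mat[OF bc[OF c(2)]])
    show "bracket (L - K) (proj_form n (- \<i> \<cdot>\<^sub>m L)) + bracket K (proj_form n (- \<i> \<cdot>\<^sub>m (L - K))) \<in> carrier_mat n n"
      by (rule add_carrier_mat[OF bc[OF c(2)]])
    fix i j assume ij: "i < n" "j < n"
    show "(bracket L (proj_form n (- \<i> \<cdot>\<^sub>m L)) - bracket K (proj_form n (- \<i> \<cdot>\<^sub>m K))) $$ (i, j) =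
      (bracket (L - K) (proj_form n (- \<i> \<cdot>\<^sub>m L)) + bracket K (proj_form n (- \<i> \<cdot>\<^sub>m (L - K)))) $$ (i, j)"
    proof -
      have "(bracket L (proj_form n (- \<i> \<cdot>\<^sub>m L)) - bracket K (proj_form n (- \<i> \<cdot>\<^sub>m K))) $$ (i, j) =
          bracket L (proj_form n (- \<i> \<cdot>\<^sub>m L)) $$ (i, j) - bracket K (proj_form n (- \<i> \<cdot>\<^sub>m K)) $$ (i, j)"
        using carrier_matD[OF bc[OF c(2), of "- \<i> \<cdot>\<^sub>m K"]] ij by simp
      also have "\<dots> = bracket (L - K) (proj_form n (- \<i> \<cdot>\<^sub>m L)) $$ (i, j) + bracket K (proj_form n (- \<i> \<cdot>\<^sub>m (L - K))) $$ (i, j)"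
        unfolding bracket_index[OF c(1) proj_form_carrier ij] bracket_index[OF c(2) proj_form_carrier ij]
          bracket_index[OF LK proj_form_carrier ij] sum.distrib[symmetric] sum_subtractf[symmetric]
        by (rule sum.cong) (use ij c in \<open>auto simp: p right_diff_distrib left_diff_distrib\<close>)
      also have "\<dots> = (bracket (L - K) (proj_form n (- \<i> \<cdot>\<^sub>m L)) + bracket K (proj_form n (- \<i> \<cdot>\<^sub>m (L - K)))) $$ (i, j)"
        using carrier_matD[OF bc[OF c(2), of "- \<i> \<cdot>\<^sub>m (L - K)"]] ij by simp
      finally show ?thesis .
    qed
  qed
qed

text \<open>The squared Frobenius distance \<open>D\<close> of two solutions satisfies a linear
  differential inequality with \<open>D 0 = 0\<close>. This lets the explicit QR solution speak for
  every Toda flow from the same point.\<close>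

theorem toda_flow_unique:
  assumes L: "toda_flow n L0 L" and K: "toda_flow n L0 K"
  shows "L t = K t"
proof -
  have Lc: "L s \<in> carrier_mat n n" and Kc: "K s \<in> carrier_mat n n" for s using L K by (auto simp: toda_flow_def)
  have LKc: "L s - K s \<in> carrier_mat n n" for s using Kc by (rule minus_carrier_mat)
  define V where "V M = bracket M (proj_form n (- \<i> \<cdot>\<^sub>m M))" for M
  have dL: "has_mat_derivative n L (V (L s)) s" and dK: "has_mat_derivative n K (V (K s)) s" for s
  proof -
    have "has_mat_derivative n L (bracket (L s) (proj_u n (- \<i> \<cdot>\<^sub>m L s))) s"
      "has_mat_derivative n K (bracket (K s) (proj_u n (- \<i> \<cdot>\<^sub>m K s))) s"
      using L K unfolding toda_flow_def by blast+
    then show "has_mat_derivative n L (V (L s)) s" "has_mat_derivative n K (V (K s)) s"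
      using proj_u_eq[of "- \<i> \<cdot>\<^sub>m L s" n] proj_u_eq[of "- \<i> \<cdot>\<^sub>m K s" n] Lc Kc by (simp_all add: V_def)
  qed
  define \<Delta> where "\<Delta> s i j = L s $$ (i, j) - K s $$ (i, j)" for s i j
  define \<Delta>' where "\<Delta>' s i j = V (L s) $$ (i, j) - V (K s) $$ (i, j)" for s i j
  define D where "D s = (\<Sum>i<n. \<Sum>j<n. (cmod (\<Delta> s i j))\<^sup>2)" for s
  define D' where "D' s = (\<Sum>i<n. \<Sum>j<n. 2 * Re (cnj (\<Delta> s i j) * \<Delta>' s i j))" for s
  have d\<Delta>: "((\<lambda>s. \<Delta> s i j) has_vector_derivative \<Delta>' s i j) (at s)" if "i < n" "j < n" for i j s
    unfolding \<Delta>_def \<Delta>'_def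
    by (intro has_vector_derivative_diff has_mat_derivative_entry[OF dL] has_mat_derivative_entry[OF dK] that)
  have dD: "(D has_real_derivative D' s) (at s)" for s
  proof -
    have "((\<lambda>s. (cmod (\<Delta> s i j))\<^sup>2) has_real_derivative 2 * Re (cnj (\<Delta> s i j) * \<Delta>' s i j)) (at s)"
      if "i < n" "j < n" for i j
    proof -
      have r: "((\<lambda>s. Re (\<Delta> s i j)) has_real_derivative Re (\<Delta>' s i j)) (at s)"
        and i: "((\<lambda>s. Im (\<Delta> s i j)) has_real_derivative Im (\<Delta>' s i j)) (at s)"
        using bounded_linear.has_vector_derivative[OF bounded_linear_Re d\<Delta>[OF that, of s]]
          bounded_linear.has_vector_derivative[OF bounded_linear_Im d\<Delta>[OF that, of s]]
        by (simp_all add: has_real_derivative_iff_has_vector_derivative)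
      from DERIV_add[OF DERIV_mult[OF r r] DERIV_mult[OF i i]] show ?thesis
        unfolding cmod_power2 unfolding power2_eq_square by (simp add: algebra_simps)
    qed
    then show ?thesis unfolding D_def D'_def by (intro DERIV_sum) auto
  qed
  \<comment> \<open>The a priori bound comes from continuity on a compact time interval, because an
    arbitrary solution is not yet known to remain on the compact orbit.\<close>
  have "\<exists>B. \<forall>s. - \<bar>t\<bar> \<le> s \<and> s \<le> \<bar>t\<bar> \<longrightarrow> (\<Sum>i<n. \<Sum>j<n. cmod (L s $$ (i, j)) + cmod (K s $$ (i, j))) \<le> B"
  proof (rule isCont_bounded)
    have cont: "isCont (\<lambda>s. L s $$ (i, j)) s" "isCont (\<lambda>s. K s $$ (i, j)) s" if "i < n" "j < n" for i j s
      by (rule has_vector_derivative_continuous[OF has_mat_derivative_entry[OF dL that]])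
        (rule has_vector_derivative_continuous[OF has_mat_derivative_entry[OF dK that]])
    show "\<forall>s. - \<bar>t\<bar> \<le> s \<and> s \<le> \<bar>t\<bar> \<longrightarrow> isCont (\<lambda>s. \<Sum>i<n. \<Sum>j<n. cmod (L s $$ (i, j)) + cmod (K s $$ (i, j))) s"
      by (intro allI impI continuous_sum continuous_add continuous_norm cont) simp_all
  qed simp
  then obtain B where B0: "\<forall>s. - \<bar>t\<bar> \<le> s \<and> s \<le> \<bar>t\<bar> \<longrightarrow> (\<Sum>i<n. \<Sum>j<n. cmod (L s $$ (i, j)) + cmod (K s $$ (i, j))) \<le> B"
    by blast
  have B: "(\<Sum>i<n. \<Sum>j<n. cmod (L s $$ (i, j)) + cmod (K s $$ (i, j))) \<le> B" if "\<bar>s\<bar> \<le> \<bar>t\<bar>" for s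
  proof -
    have "- \<bar>t\<bar> \<le> s \<and> s \<le> \<bar>t\<bar>" using that by linarith
    then show ?thesis using B0 by blast
  qed
  have LB: "cmod (L s $$ (i, j)) \<le> B" and KB: "cmod (K s $$ (i, j)) \<le> B" if s: "\<bar>s\<bar> \<le> \<bar>t\<bar>" and ij: "i < n" "j < n" for s i j
  proof -
    have "cmod (L s $$ (i, j)) + cmod (K s $$ (i, j)) \<le> (\<Sum>j<n. cmod (L s $$ (i, j)) + cmod (K s $$ (i, j)))"
      by (rule member_le_sum) (use ij in auto)
    also have "\<dots> \<le> (\<Sum>i<n. \<Sum>j<n. cmod (L s $$ (i, j)) + cmod (K s $$ (i, j)))"
      by (rule member_le_sum) (use ij in \<open>auto intro!: sum_nonneg add_nonneg_nonneg\<close>)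
    finally have *: "cmod (L s $$ (i, j)) + cmod (K s $$ (i, j)) \<le> B" using B[OF s] by simp
    show "cmod (L s $$ (i, j)) \<le> B" "cmod (K s $$ (i, j)) \<le> B"
      using * norm_ge_zero[of "L s $$ (i, j)"] norm_ge_zero[of "K s $$ (i, j)"] by linarith+
  qed
  \<comment> \<open>Two brackets of size \<open>2 n B \<delta>\<close> bound an entry of the field
    difference by \<open>4 n B \<delta>\<close>; the factor 2 comes from differentiating a square,
    and the outer \<open>n * n\<close> counts the entries.\<close>
  define C where "C = real n * (real n * (2 * (real n * (4 * B))))"
  have bound: "\<bar>D' s\<bar> \<le> C * D s" if s: "\<bar>s\<bar> \<le> \<bar>t\<bar>" for s
  proof -
    define \<delta> where "\<delta> = sqrt (D s)"
    have D0: "0 \<le> D s" by (auto simp: D_def intro!: sum_nonneg)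
    have \<delta>: "cmod (\<Delta> s i j) \<le> \<delta>" if ij: "i < n" "j < n" for i j
    proof -
      have "(cmod (\<Delta> s i j))\<^sup>2 \<le> (\<Sum>j<n. (cmod (\<Delta> s i j))\<^sup>2)"
        by (rule member_le_sum) (use ij in auto)
      also have "\<dots> \<le> D s"
        unfolding D_def by (rule member_le_sum) (use ij in \<open>auto intro: sum_nonneg\<close>)
      finally show ?thesis unfolding \<delta>_def by (rule real_le_rsqrt)
    qed
    have \<Delta>': "cmod (\<Delta>' s i j) \<le> real n * (4 * B) * \<delta>" if ij: "i < n" "j < n" for i j
    proof -
      have dim: "dim_row (L s) = n" "dim_col (L s) = n" "dim_row (K s) = n" "dim_col (K s) = n"
        using Lc[of s] Kc[of s] by auto
      have 1: "cmod (bracket (L s - K s) (proj_form n (- \<i> \<cdot>\<^sub>m L s)) $$ (i, j)) \<le> real n * (2 * \<delta> * B)"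
        by (rule bracket_entry_bound[OF LKc proj_form_carrier ij])
          (use \<delta> LB[OF s] dim in \<open>auto simp: \<Delta>_def norm_mult intro!: proj_form_entry_bound\<close>)
      have 2: "cmod (bracket (K s) (proj_form n (- \<i> \<cdot>\<^sub>m (L s - K s))) $$ (i, j)) \<le> real n * (2 * B * \<delta>)"
        by (rule bracket_entry_bound[OF Kc proj_form_carrier ij])
          (use \<delta> KB[OF s] dim in \<open>auto simp: \<Delta>_def norm_mult intro!: proj_form_entry_bound\<close>)
      have "\<Delta>' s i j = (V (L s) - V (K s)) $$ (i, j)"
        using ij carrier_matD[OF bracket_carrier[OF Kc[of s] proj_form_carrier[of n "- \<i> \<cdot>\<^sub>m K s"]]]
        by (simp add: \<Delta>'_def V_def)
      also have "\<dots> = bracket (L s - K s) (proj_form n (- \<i> \<cdot>\<^sub>m L s)) $$ (i, j)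
          + bracket (K s) (proj_form n (- \<i> \<cdot>\<^sub>m (L s - K s))) $$ (i, j)"
        unfolding V_def toda_field_difference[OF Lc Kc]
        using ij carrier_matD[OF bracket_carrier[OF Kc[of s] proj_form_carrier[of n "- \<i> \<cdot>\<^sub>m (L s - K s)"]]]
        by simp
      finally show ?thesis
        using norm_triangle_mono[OF 1 2] by (simp add: algebra_simps)
    qed
    have "\<bar>2 * Re (cnj (\<Delta> s i j) * \<Delta>' s i j)\<bar> \<le> 2 * (real n * (4 * B)) * D s" if ij: "i < n" "j < n" for i j
    proof -
      have "\<bar>Re (cnj (\<Delta> s i j) * \<Delta>' s i j)\<bar> \<le> cmod (\<Delta> s i j) * cmod (\<Delta>' s i j)"
        using abs_Re_le_cmod[of "cnj (\<Delta> s i j) * \<Delta>' s i j"] by (simp add: norm_mult)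
      also have "\<dots> \<le> \<delta> * (real n * (4 * B) * \<delta>)"
        using \<delta>[OF ij] \<Delta>'[OF ij] by (intro mult_mono) (auto simp: \<delta>_def D0)
      also have "\<dots> = real n * (4 * B) * D s" using D0 by (simp add: \<delta>_def)
      finally show ?thesis by simp
    qed
    then have "\<bar>D' s\<bar> \<le> (\<Sum>i<n. \<Sum>j<n. 2 * (real n * (4 * B)) * D s)"
      unfolding D'_def by (intro order_trans[OF sum_abs] sum_mono) auto
    then show ?thesis by (simp add: C_def algebra_simps)
  qed
  have "D t = 0"
  proof (rule differential_inequality_zero[OF dD _ _ bound])
    show "D 0 = 0" using L K by (simp add: D_def \<Delta>_def toda_flow_def)
    show "0 \<le> D t" by (auto simp: D_def intro!: sum_nonneg)
  qed
  then have "\<Delta> t i j = 0" if "i < n" "j < n" for i j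
    using that by (auto simp: D_def sum_nonneg_eq_0_iff sum_nonneg)
  then show ?thesis using Lc[of t] Kc[of t] by (intro eq_matI) (auto simp: \<Delta>_def)
qed

lemma left_mult_one_square [simp]: "A \<in> carrier_mat n n \<Longrightarrow> 1\<^sub>m n * A = A"
  and right_mult_one_square [simp]: "A \<in> carrier_mat n n \<Longrightarrow> A * 1\<^sub>m n = A"
  for A :: "complex mat"
  by simp_all

subsection \<open>The orbit and the twist map\<close>

definition spectrum_diag :: "nat \<Rightarrow> real vec \<Rightarrow> complex mat" where
  "spectrum_diag n lam = mat_diag n (\<lambda>i. \<i> * complex_of_real (lam $ i))"

lemma spectrum_diag_carrier [simp]: "spectrum_diag n lam \<in> carrier_mat n n"
  by (simp add: spectrum_diag_def)

lemma spectrum_diag_eq: "\<i> \<cdot>\<^sub>m Diag n lam = spectrum_diag n lam"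
  by (rule eq_matI) (auto simp: Diag_def spectrum_diag_def)

lemma Diag_carrier [simp]: "Diag n lam \<in> carrier_mat n n"
  by (simp add: Diag_def)

lemma orbit_point_eq:
  "g \<in> unitary_group n \<Longrightarrow> orbit_point n lam g = g * spectrum_diag n lam * mat_adjoint g"
  by (simp add: orbit_point_def spectrum_diag_eq unitary_groupD(5))

lemma unitary_nonneg_iff: "g \<in> unitary_nonneg n \<longleftrightarrow> g \<in> unitary_group n \<and> tnn_flag n g"
  using left_minors_nonneg_iff unitary_groupD(1) by (auto simp: unitary_nonneg_def)

lemma strictly_decreasing_neq:
  assumes "strictly_decreasing lam" "lam \<in> carrier_vec n" "i < n" "j < n" "i \<noteq> j"
  shows "lam $ i \<noteq> lam $ j"
  using assms by (cases i j rule: linorder_cases) (force simp: strictly_decreasing_def)+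

text \<open>A flag minor of size \<open>k\<close> picks up the product of the first \<open>k\<close>
  numbers \<open>d j\<close>. Some minor of each size is positive, so that product is a nonnegative
  number of modulus 1, hence 1; consecutive products then give each \<open>d i\<close>.\<close>

lemma unimodular_diag_one:
  assumes g: "g \<in> carrier_mat n n" "det g \<noteq> 0" "tnn_flag n g"
    and d: "\<And>i. i < n \<Longrightarrow> cmod (d i) = 1" and gT: "tnn_flag n (g * mat_diag n d)" and "i < n"
  shows "d i = 1"
proof -
  have P: "(\<Prod>j<k. d j) = 1" if kn: "k \<le> n" for k
  proof -
    obtain f where f: "row_choice n k f" "left_minor g k f \<noteq> 0"
      using exists_nonzero_left_minor[OF g(1,2) kn] by blast
    have pos: "0 < left_minor g k f" using f g(3) by (auto simp: tnn_flag_def order_le_less)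
    have "left_minor (g * mat_diag n d) k f = left_minor g k f * (\<Prod>j<k. mat_diag n d $$ (j, j))"
      by (rule left_minor_mult_upper[OF g(1) _ _ f(1)]) (auto simp: upper_triangular_def)
    also have "(\<Prod>j<k. mat_diag n d $$ (j, j)) = (\<Prod>j<k. d j)"
      using kn by (intro prod.cong) auto
    finally have e: "left_minor (g * mat_diag n d) k f = left_minor g k f * (\<Prod>j<k. d j)" .
    have "0 \<le> left_minor g k f * (\<Prod>j<k. d j)"
      unfolding e[symmetric] using gT f(1) unfolding tnn_flag_def by blast
    from complex_divide_nonneg[OF this pos] pos have "0 \<le> (\<Prod>j<k. d j)" by auto
    moreover have "cmod (\<Prod>j<k. d j) = 1" using d kn by (simp add: prod_norm[symmetric])
    ultimately show ?thesis
      by (simp add: less_eq_complex_def complex_eq_iff cmod_def real_sqrt_unique)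
  qed
  from P[of "Suc i"] P[of i] \<open>i < n\<close> show ?thesis by simp
qed

text \<open>The matrix \<open>T = mat_adjoint g * g'\<close> commutes with a diagonal matrix having
  distinct entries, so it is diagonal and unitary. Positivity of flag minors removes the remaining
  torus of phases.\<close>

lemma orbit_point_inj:
  assumes lam: "strictly_decreasing lam" "lam \<in> carrier_vec n"
    and g: "g \<in> unitary_nonneg n" and g': "g' \<in> unitary_nonneg n"
    and eq: "orbit_point n lam g = orbit_point n lam g'"
  shows "g = g'"
proof -
  have gu: "g \<in> unitary_group n" "g' \<in> unitary_group n" and gt: "tnn_flag n g" "tnn_flag n g'"
    using g g' by (auto simp: unitary_nonneg_iff)
  note G = unitary_groupD[OF gu(1)] and G' = unitary_groupD[OF gu(2)]
  let ?S = "spectrum_diag n lam"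
  define T where "T = mat_adjoint g * g'"
  have Tc: "T \<in> carrier_mat n n" using G G' by (simp add: T_def)
  have gT: "g' = g * T"
  proof -
    have "g * T = (g * mat_adjoint g) * g'" unfolding T_def using G(1) G'(1) by (simp add: mult_assoc[of _ n])
    then show ?thesis using G(2) G'(1) by simp
  qed
  have "?S * T = T * ?S"
  proof -
    have "g * ?S * mat_adjoint g = g' * ?S * mat_adjoint g'" using eq gu by (simp add: orbit_point_eq)
    then have "mat_adjoint g * (g * ?S * mat_adjoint g) * g' = mat_adjoint g * (g' * ?S * mat_adjoint g') * g'" by simp
    moreover have "mat_adjoint g * (g * ?S * mat_adjoint g) * g' = (mat_adjoint g * g) * (?S * T)"
      unfolding T_def using G(1) G'(1) by (simp add: mult_assoc[of _ n])
    moreover have "mat_adjoint g * (g' * ?S * mat_adjoint g') * g' = T * (?S * (mat_adjoint g' * g'))"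
      unfolding T_def using G(1) G'(1) by (simp add: mult_assoc[of _ n])
    ultimately show ?thesis using G(3) G'(3) Tc by simp
  qed
  then have off: "T $$ (i, j) = 0" if "i < n" "j < n" "i \<noteq> j" for i j
  proof -
    have "(?S * T) $$ (i, j) = (T * ?S) $$ (i, j)" using \<open>?S * T = T * ?S\<close> by simp
    then have "complex_of_real (lam $ i) * T $$ (i, j) = complex_of_real (lam $ j) * T $$ (i, j)"
      using that Tc by (simp add: spectrum_diag_def index_diag_mult[of _ n n] index_mult_diag[of _ n n])
    then show ?thesis using strictly_decreasing_neq[OF lam that] by simp
  qed
  have Td: "T = mat_diag n (\<lambda>i. T $$ (i, i))"
    by (rule square_eqI[OF Tc]) (use off in auto)
  have Tu: "T \<in> unitary_group n" unfolding T_def using unitary_mult[OF unitary_adjoint[OF gu(1)] gu(2)] .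
  have "cmod (T $$ (i, i)) = 1" if "i < n" for i
  proof -
    have "(mat_adjoint T * T) $$ (i, i) = (\<Sum>k<n. cnj (T $$ (k, i)) * T $$ (k, i))"
      using Tc that by (simp add: index_mult_sum[of _ n n _ n])
    also have "\<dots> = (\<Sum>k<n. if k = i then cnj (T $$ (i, i)) * T $$ (i, i) else 0)"
      by (rule sum.cong) (use off that in auto)
    finally have "cnj (T $$ (i, i)) * T $$ (i, i) = 1"
      using unitary_groupD(3)[OF Tu] that by simp
    then have "complex_of_real ((cmod (T $$ (i, i)))\<^sup>2) = complex_of_real 1"
      unfolding complex_norm_square by (simp add: mult.commute)
    then have "(cmod (T $$ (i, i)))\<^sup>2 = 1" using of_real_eq_iff by blast
    then show ?thesis using norm_ge_zero[of "T $$ (i, i)"] unfolding power2_eq_1_iff by linarith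
  qed
  note unim = this
  have "tnn_flag n (g * mat_diag n (\<lambda>i. T $$ (i, i)))"
    unfolding Td[symmetric] gT[symmetric] by (rule gt(2))
  from unimodular_diag_one[OF G(1,4) gt(1) unim this]
  have "T $$ (i, i) = 1" if "i < n" for i using that by blast
  then have "T = 1\<^sub>m n" by (intro square_eqI[OF Tc]) (use off in auto)
  then show ?thesis using gT G(1) by simp
qed

section \<open>The twist on unitary representatives\<close>

lemma delta_unitary: "delta n \<in> unitary_group n"
  using delta_square by (simp add: unitary_group_def)

lemma dconj_unitary: "g \<in> unitary_group n \<Longrightarrow> dconj n g \<in> unitary_group n"
  unfolding dconj_def by (intro unitary_mult delta_unitary)

lemma dconj_adjoint_nonneg:
  assumes "g \<in> unitary_nonneg n"
  shows "dconj n (mat_adjoint g) \<in> unitary_nonneg n"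
  using assms tnn_flag_inverse dconj_unitary unitary_adjoint by (auto simp: unitary_nonneg_iff)

lemma orbit_point_dconj_adjoint:
  assumes g: "g \<in> unitary_group n"
  shows "orbit_point n lam (dconj n (mat_adjoint g)) = dconj n (mat_adjoint g * spectrum_diag n lam * g)"
proof -
  have c: "g \<in> carrier_mat n n" using unitary_groupD[OF g] by simp
  have S: "dconj n (spectrum_diag n lam) = spectrum_diag n lam" by (simp add: spectrum_diag_def)
  show ?thesis
    using c g by (simp add: orbit_point_eq dconj_unitary unitary_adjoint dconj_adjoint dconj_mult S)
qed

text \<open>Injectivity of \<open>orbit_point\<close> on nonnegative unitary matrices leaves one
  candidate for the definite description, and its value depends only on that representative.\<close>

lemma twist_orbit_point:
  assumes lam: "strictly_decreasing lam" "lam \<in> carrier_vec n" and g: "g \<in> unitary_nonneg n"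
  shows "twist n lam (orbit_point n lam g) = orbit_point n lam (dconj n (mat_adjoint g))"
proof -
  have gu: "g \<in> unitary_group n" using g by (simp add: unitary_nonneg_iff)
  have c: "g \<in> carrier_mat n n" using unitary_groupD[OF gu] by simp
  have val: "delta n * minv g * (\<i> \<cdot>\<^sub>m Diag n lam) * g * delta n = orbit_point n lam (dconj n (mat_adjoint g))"
    unfolding orbit_point_dconj_adjoint[OF gu] unfolding dconj_def spectrum_diag_eq unitary_groupD(5)[OF gu]
    using c by (simp add: mult_assoc[of _ n])
  show ?thesis
    unfolding twist_def
  proof (rule the_equality)
    show "\<exists>ga\<in>unitary_nonneg n. orbit_point n lam g = orbit_point n lam ga \<and>
        orbit_point n lam (dconj n (mat_adjoint g)) = delta n * minv ga * (\<i> \<cdot>\<^sub>m Diag n lam) * ga * delta n"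
      using g val by auto
  next
    fix M assume "\<exists>ga\<in>unitary_nonneg n. orbit_point n lam g = orbit_point n lam ga \<and>
        M = delta n * minv ga * (\<i> \<cdot>\<^sub>m Diag n lam) * ga * delta n"
    then obtain ga where "ga \<in> unitary_nonneg n" "orbit_point n lam g = orbit_point n lam ga"
      and M: "M = delta n * minv ga * (\<i> \<cdot>\<^sub>m Diag n lam) * ga * delta n" by blast
    then have "g = ga" using orbit_point_inj[OF lam g] by blast
    then show "M = orbit_point n lam (dconj n (mat_adjoint g))" using M val by simp
  qed
qed

subsection \<open>The QR flow\<close>

definition exp_diag :: "nat \<Rightarrow> real vec \<Rightarrow> real \<Rightarrow> complex mat" where
  "exp_diag n lam t = mat_diag n (\<lambda>i. complex_of_real (exp (t * lam $ i)))"

lemma exp_diag_carrier [simp]: "exp_diag n lam t \<in> carrier_mat n n"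
  by (simp add: exp_diag_def)

lemma exp_diag_inverse: "exp_diag n lam (- t) * exp_diag n lam t = 1\<^sub>m n"
  by (simp add: exp_diag_def exp_minus flip: of_real_mult)

lemma exp_diag_adjoint: "mat_adjoint (exp_diag n lam t) = exp_diag n lam t"
  by (simp add: exp_diag_def mat_adjoint_diag)

lemma exp_diag_derivative: "has_mat_derivative n (exp_diag n lam) (Diag n lam * exp_diag n lam t) t"
  unfolding has_mat_derivative_def
proof (intro conjI allI impI)
  show "Diag n lam * exp_diag n lam t \<in> carrier_mat n n" by simp
  fix i j assume ij: "i < n" "j < n"
  have "((\<lambda>s. exp (s * lam $ i)) has_real_derivative lam $ i * exp (t * lam $ i)) (at t)"
    by (auto intro!: derivative_eq_intros)
  then have "((\<lambda>s. complex_of_real (exp (s * lam $ i))) has_vector_derivative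
      complex_of_real (lam $ i * exp (t * lam $ i))) (at t)"
    by (intro bounded_linear.has_vector_derivative[OF bounded_linear_of_real])
      (simp add: has_real_derivative_iff_has_vector_derivative)
  then show "((\<lambda>s. exp_diag n lam s $$ (i, j)) has_vector_derivative (Diag n lam * exp_diag n lam t) $$ (i, j)) (at t)"
    using ij unfolding exp_diag_def Diag_def by auto
qed

lemma differentiable_iff_vector_derivative:
  fixes f :: "real \<Rightarrow> 'a :: real_normed_vector"
  shows "f differentiable (at t) \<longleftrightarrow> (\<exists>d. (f has_vector_derivative d) (at t))"
proof
  assume "f differentiable (at t)"
  then obtain f' where f': "(f has_derivative f') (at t)" by (auto simp: differentiable_def)
  then interpret bounded_linear f' by (rule has_derivative_bounded_linear)
  have "f' x = x *\<^sub>R f' 1" for x using scaleR[of x 1] by simp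
  then have eq: "f' = (\<lambda>x. x *\<^sub>R f' 1)" by (rule ext)
  have "(f has_vector_derivative f' 1) (at t)"
    unfolding has_vector_derivative_def
    by (rule iffD1[OF arg_cong[OF eq, of "\<lambda>g. (f has_derivative g) (at t)"] f'])
  then show "\<exists>d. (f has_vector_derivative d) (at t)" by blast
qed (auto simp: has_vector_derivative_def differentiable_def)

lemma differentiable_mat_derivative:
  fixes A :: "real \<Rightarrow> complex mat"
  assumes "\<And>i j. i < n \<Longrightarrow> j < n \<Longrightarrow> (\<lambda>s. A s $$ (i, j)) differentiable (at t)"
  shows "\<exists>A'. has_mat_derivative n A A' t"
proof -
  define d where "d i j = (SOME d. ((\<lambda>s. A s $$ (i, j)) has_vector_derivative d) (at t))" for i j
  have "((\<lambda>s. A s $$ (i, j)) has_vector_derivative d i j) (at t)" if "i < n" "j < n" for i j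
    unfolding d_def using assms[OF that] unfolding differentiable_iff_vector_derivative by (rule someI_ex)
  then have "has_mat_derivative n A (mat n n (\<lambda>(i, j). d i j)) t" by (auto simp: has_mat_derivative_def)
  then show ?thesis by blast
qed

lemma has_mat_derivative_differentiable:
  "has_mat_derivative n A A' t \<Longrightarrow> i < n \<Longrightarrow> j < n \<Longrightarrow> (\<lambda>s. A s $$ (i, j)) differentiable (at t)"
  using has_mat_derivative_entry differentiable_iff_vector_derivative by blast

text \<open>Entries, or imaginary parts, that vanish identically have derivative 0. Positivity on
  the diagonal does not survive differentiation, but reality does, and this is what the summand
  \<open>real_diagonal\<close> asks for.\<close>

lemma pos_upper_derivative:
  assumes c: "\<And>t. c t \<in> pos_upper n" and d: "has_mat_derivative n c c' t"
  shows "upper_triangular c'" and "i < n \<Longrightarrow> c' $$ (i, i) \<in> \<real>"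
proof -
  have up: "c s $$ (i, j) = 0" if "i < n" "j < i" for s i j
    using c[of s] that by (auto simp: pos_upper_def upper_triangular_def)
  have im: "Im (c s $$ (i, i)) = 0" if "i < n" for s i
    using c[of s] that by (auto simp: pos_upper_def less_complex_def)
  have zero: "x = 0" if "((\<lambda>s. 0 :: complex) has_vector_derivative x) (at t)" for x
  proof -
    have "(\<lambda>r. r *\<^sub>R x) = (\<lambda>r. r *\<^sub>R 0)"
      using that has_vector_derivative_const[of "0 :: complex" "at t"]
      unfolding has_vector_derivative_def by (rule has_derivative_unique)
    from fun_cong[OF this, of 1] show ?thesis by simp
  qed
  have "c' $$ (i, j) = 0" if "i < n" "j < i" for i j
  proof (rule zero)
    have "((\<lambda>s. c s $$ (i, j)) has_vector_derivative c' $$ (i, j)) (at t)"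
      using has_mat_derivative_entry[OF d, of i j] that by simp
    then show "((\<lambda>s. 0) has_vector_derivative c' $$ (i, j)) (at t)" using up[OF that] by simp
  qed
  then show "upper_triangular c'"
    using has_mat_derivative_carrier[OF d] by (auto simp: upper_triangular_def)
  show "c' $$ (i, i) \<in> \<real>" if "i < n"
  proof -
    have "((\<lambda>s. Im (c s $$ (i, i))) has_vector_derivative Im (c' $$ (i, i))) (at t)"
      by (rule bounded_linear.has_vector_derivative[OF bounded_linear_Im has_mat_derivative_entry[OF d that that]])
    then have "((\<lambda>s. 0 :: real) has_vector_derivative Im (c' $$ (i, i))) (at t)" using im[OF that] by simp
    from bounded_linear.has_vector_derivative[OF bounded_linear_of_real this]
    have "complex_of_real (Im (c' $$ (i, i))) = 0" by (intro zero) simp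
    then have "Im (c' $$ (i, i)) = 0" by simp
    then show ?thesis by (simp add: complex_is_Real_iff)
  qed
qed

text \<open>The QR factorization of \<open>exp(t \<Lambda>) h\<^sub>0\<close> integrates the flow
  \<open>h' = h \<pi>\<^sub>u(h\<^sup>* \<Lambda> h)\<close>: differentiate \<open>h c = exp(t \<Lambda>) h\<^sub>0\<close>.\<close>

theorem qr_flow:
  assumes h0: "h0 \<in> unitary_group n"
  obtains h c where "\<And>t. h t \<in> unitary_group n" "\<And>t. c t \<in> pos_upper n"
    "\<And>t. h t * c t = exp_diag n lam t * h0" "h 0 = h0"
    "\<And>t. has_mat_derivative n h (h t * proj_form n (mat_adjoint (h t) * Diag n lam * h t)) t"
proof -
  note H0 = unitary_groupD[OF h0]
  define M where "M t = exp_diag n lam t * h0" for t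
  have Mc: "M t \<in> carrier_mat n n" for t using H0 by (simp add: M_def)
  have "det (M t) \<noteq> 0" for t
    using det_mult[of "exp_diag n lam t" n h0] H0 inverse_det_nonzero[of "exp_diag n lam t" n "exp_diag n lam (- t)"]
      exp_diag_inverse[of n lam "- t"] by (simp add: M_def)
  then have "\<forall>t. \<exists>h c. h \<in> unitary_group n \<and> c \<in> pos_upper n \<and> M t = h * c"
    using qr_decomposition[OF Mc] by blast
  then obtain h c where h: "\<And>t. h t \<in> unitary_group n" and c: "\<And>t. c t \<in> pos_upper n"
    and hc: "\<And>t. M t = h t * c t" by metis
  note H = unitary_groupD[OF h]
  have cc: "c t \<in> carrier_mat n n" for t using c[of t] by (simp add: pos_upper_def)
  have M0: "M 0 = h0" using H0 by (simp add: M_def exp_diag_def)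
  have hMc: "mat_adjoint (h t) * M t = c t" for t
  proof -
    have "mat_adjoint (h t) * M t = (mat_adjoint (h t) * h t) * c t"
      unfolding hc using H(1)[of t] cc[of t] by (simp add: mult_assoc[of _ n])
    then show ?thesis using H(3)[of t] left_mult_one_mat[OF cc[of t]] by simp
  qed
  have "c 0 \<in> unitary_group n"
    using hMc[of 0] M0 unitary_mult[OF unitary_adjoint[OF h[of 0]] h0] by simp
  then have "c 0 = 1\<^sub>m n" by (rule pos_upper_unitary[OF c])
  then have h00: "h 0 = h0" using hc[of 0] M0 H(1)[of 0] by simp
  have dM: "has_mat_derivative n M (Diag n lam * M t) t" for t
  proof -
    have "M = (\<lambda>t. exp_diag n lam t * h0)" by (auto simp: M_def)
    then show ?thesis
      using has_mat_derivative_right_mult[OF exp_diag_derivative[of n lam t] H0(1)] H0(1)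
      by (simp add: mult_assoc[of _ n])
  qed
  have dc: "\<exists>c'. has_mat_derivative n c c' t" for t
    by (rule differentiable_mat_derivative, rule qr_differentiable[OF h c hc])
      (use has_mat_derivative_differentiable[OF dM] in auto)
  \<comment> \<open>Unitarity of \<open>h t\<close> and \<open>h0\<close> lets the adjoint of
    \<open>c t\<close> replace the inverse of \<open>c (- t)\<close>-like factors: solving
    \<open>h c = exp(t \<Lambda>) h0\<close> through adjoints gives \<open>h\<close> as a product of
    differentiable curves, with no inverse of \<open>c t\<close>.\<close>
  have hE: "h t = exp_diag n lam (- t) * h0 * mat_adjoint (c t)" for t
  proof -

    have "exp_diag n lam t * h0 * mat_adjoint h0 = exp_diag n lam t" using H0 by (simp add: mult_assoc[of _ n])
    then have "h t * c t * mat_adjoint h0 = exp_diag n lam t" using hc[of t] by (simp add: M_def)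
    then have "c t * mat_adjoint h0 = mat_adjoint (h t) * exp_diag n lam t"
    proof -
      assume a: "h t * c t * mat_adjoint h0 = exp_diag n lam t"
      have "mat_adjoint (h t) * (h t * c t * mat_adjoint h0) = (mat_adjoint (h t) * h t) * (c t * mat_adjoint h0)"
        using H(1)[of t] cc[of t] H0(1) by (simp add: mult_assoc[of _ n])
      then show ?thesis using a H(3)[of t] cc[of t] H0(1) by simp
    qed
    from arg_cong[OF this, of mat_adjoint] have "h0 * mat_adjoint (c t) = exp_diag n lam t * h t"
      using H(1)[of t] cc[of t] H0(1) by (simp add: mat_adjoint_mult[of _ n n _ n] exp_diag_adjoint)
    then have "exp_diag n lam (- t) * (h0 * mat_adjoint (c t)) = (exp_diag n lam (- t) * exp_diag n lam t) * h t"
      using H(1)[of t] by (simp add: mult_assoc[of _ n])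
    then show ?thesis using exp_diag_inverse[of n lam t] H(1)[of t] H0(1) cc[of t] by (simp add: mult_assoc[of _ n])
  qed
  have dexpm: "\<exists>E'. has_mat_derivative n (\<lambda>t. exp_diag n lam (- t)) E' t" for t
  proof -
    have "exp_diag n lam (- t) = exp_diag n (vec n (\<lambda>i. - lam $ i)) t" for t
      by (rule square_eqI[of _ n]) (auto simp: exp_diag_def)
    then show ?thesis using exp_diag_derivative[of n "vec n (\<lambda>i. - lam $ i)" t] by auto
  qed
  have dh: "\<exists>h'. has_mat_derivative n h h' t" for t
  proof -
    obtain c' E' where c': "has_mat_derivative n c c' t" and E': "has_mat_derivative n (\<lambda>t. exp_diag n lam (- t)) E' t"
      using dc dexpm by metis
    have "\<exists>F'. has_mat_derivative n (\<lambda>t. exp_diag n lam (- t) * h0 * mat_adjoint (c t)) F' t"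
      using has_mat_derivative_mult[OF has_mat_derivative_right_mult[OF E' H0(1)] has_mat_derivative_adjoint[OF c' cc]] cc H0(1)
      by auto
    moreover have "h = (\<lambda>t. exp_diag n lam (- t) * h0 * mat_adjoint (c t))" using hE by auto
    ultimately show ?thesis by simp
  qed
  have main: "has_mat_derivative n h (h t * proj_form n (mat_adjoint (h t) * Diag n lam * h t)) t" for t
  proof -
    obtain h' c' where h': "has_mat_derivative n h h' t" and c': "has_mat_derivative n c c' t"
      using dh dc by metis
    have h'c: "h' \<in> carrier_mat n n" and c'c: "c' \<in> carrier_mat n n"
      using h' c' has_mat_derivative_carrier by blast+
    \<comment> \<open>\<open>U\<close> is the velocity of \<open>h\<close> translated to the
      identity. Differentiating \<open>mat_adjoint (h s) * h s = 1\<close> makes it skew-Hermitian;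
      it remains to recognize it as the projection of \<open>A\<close>.\<close>
    define U where "U = mat_adjoint (h t) * h'"
    define A where "A = mat_adjoint (h t) * Diag n lam * h t"
    have Uc: "U \<in> carrier_mat n n" and Ac: "A \<in> carrier_mat n n" using H(1)[of t] h'c by (auto simp: U_def A_def)
    have "has_mat_derivative n (\<lambda>s. mat_adjoint (h s) * h s) (mat_adjoint h' * h t + U) t"
      unfolding U_def by (rule has_mat_derivative_mult[OF has_mat_derivative_adjoint[OF h'] h']) (use H(1) in auto)
    then have "has_mat_derivative n (\<lambda>s. 1\<^sub>m n) (mat_adjoint h' * h t + U) t" using H(3) by simp
    from has_mat_derivative_unique[OF this has_mat_derivative_const]
    have sum0: "mat_adjoint h' * h t + U = 0\<^sub>m n n" by simp
    have Ua: "mat_adjoint U = mat_adjoint h' * h t"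
      using h'c H(1)[of t] by (simp add: U_def mat_adjoint_mult[of _ n n _ n])
    have Usk: "U \<in> skew_hermitian n"
      unfolding skew_hermitian_def
    proof (intro CollectI conjI Uc square_eqI[of _ n])
      show "mat_adjoint U \<in> carrier_mat n n" "- U \<in> carrier_mat n n" using Uc by auto
      fix i j assume ij: "i < n" "j < n"
      have "(mat_adjoint U + U) $$ (i, j) = 0" using sum0 Ua ij by simp
      then show "mat_adjoint U $$ (i, j) = (- U) $$ (i, j)" using ij Uc by (simp add: add_eq_0_iff2)
    qed
    have "has_mat_derivative n (\<lambda>s. h s * c s) (h' * c t + h t * c') t"
      by (rule has_mat_derivative_mult[OF h' c' H(1) cc])
    moreover have "(\<lambda>s. h s * c s) = M" using hc by auto
    ultimately have "has_mat_derivative n M (h' * c t + h t * c') t" by simp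
    then have eq: "h' * c t + h t * c' = Diag n lam * (h t * c t)"
      unfolding hc[of t, symmetric] using dM by (rule has_mat_derivative_unique)
    \<comment> \<open>Differentiating \<open>h c = exp(t \<Lambda>) h0\<close> and multiplying by
      the adjoint of \<open>h\<close> gives \<open>S c = c'\<close>. So \<open>S\<close> is upper
      triangular with real diagonal, and \<open>A = U + S\<close> is the decomposition that defines
      the projection.\<close>
    define S where "S = A - U"
    have Sc: "S \<in> carrier_mat n n" unfolding S_def by (rule minus_carrier_mat[OF Uc])
    have Sc': "S * c t = c'"
    proof -
      have "U * c t + c' = mat_adjoint (h t) * (h' * c t + h t * c')"
      proof -
        have "mat_adjoint (h t) * (h' * c t + h t * c') = U * c t + (mat_adjoint (h t) * h t) * c'"
          using H(1)[of t] h'c cc[of t] c'c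
          by (simp add: U_def mult_add_distrib_mat[of _ n n _ n] mult_assoc[of _ n])
        then show ?thesis using H(3)[of t] c'c by simp
      qed
      also have "\<dots> = A * c t"
        unfolding eq A_def using H(1)[of t] cc[of t] by (simp add: mult_assoc[of _ n])
      finally have e: "U * c t + c' = A * c t" .
      have "S * c t = A * c t - U * c t"
        unfolding S_def by (rule minus_mult_distrib_mat[OF Ac Uc cc])
      also have "\<dots> = c'"
      proof (rule square_eqI[of _ n])
        show "A * c t - U * c t \<in> carrier_mat n n" using Uc cc[of t] by (intro minus_carrier_mat) simp
        show "c' \<in> carrier_mat n n" by (rule c'c)
        fix i j assume ij: "i < n" "j < n"
        have "(U * c t + c') $$ (i, j) = (A * c t) $$ (i, j)" using e by simp
        then show "(A * c t - U * c t) $$ (i, j) = c' $$ (i, j)"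
          using ij Uc cc[of t] c'c by (simp add: diff_eq_eq add.commute)
      qed
      finally show ?thesis .
    qed
    have cup: "upper_triangular (c t)" using c[of t] unfolding pos_upper_def by blast
    have cpos: "0 < c t $$ (i, i)" if "i < n" for i using c[of t] that unfolding pos_upper_def by blast
    have cnz: "c t $$ (i, i) \<noteq> 0" if "i < n" for i using cpos[OF that] by auto
    have up: "upper_triangular (S * c t)" unfolding Sc' by (rule pos_upper_derivative(1)[OF c c'])
    have Sup: "upper_triangular S" by (rule upper_triangular_factor(1)[OF Sc cc cup cnz up])
    have Sd: "c' $$ (i, i) = S $$ (i, i) * c t $$ (i, i)" if "i < n" for i
      using upper_triangular_factor(2)[OF Sc cc cup cnz up that] unfolding Sc' .
    have Sr: "S $$ (i, i) \<in> \<real>" if "i < n" for i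
    proof -
      have "c t $$ (i, i) \<in> \<real>" using cpos[OF that] by (simp add: less_complex_def complex_is_Real_iff)
      moreover have "S $$ (i, i) = c' $$ (i, i) / c t $$ (i, i)" using Sd[OF that] cnz[OF that] by simp
      ultimately show ?thesis using pos_upper_derivative(2)[OF c c' that] by simp
    qed
    let ?D = "mat_diag n (\<lambda>i. S $$ (i, i))"
    let ?R = "mat n n (\<lambda>(i, j). if i < j then S $$ (i, j) else 0)"
    have "A = U + ?D + ?R"
    proof (rule square_eqI[OF Ac])
      show "U + ?D + ?R \<in> carrier_mat n n" by simp
      fix i j assume ij: "i < n" "j < n"
      have "(U + ?D + ?R) $$ (i, j) = U $$ (i, j) + S $$ (i, j)"
        using Sup Sc Uc ij by (cases i j rule: linorder_cases) (auto simp: upper_triangular_def)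
      moreover have "S $$ (i, j) = A $$ (i, j) - U $$ (i, j)" using Uc ij by (simp add: S_def)
      ultimately show "A $$ (i, j) = (U + ?D + ?R) $$ (i, j)" by simp
    qed
    moreover have "?D \<in> real_diagonal n" using Sr by (auto simp: real_diagonal_def diagonal_mat_def)
    moreover have "?R \<in> strictly_upper n" by (auto simp: strictly_upper_def)
    ultimately have "\<exists>D\<in>real_diagonal n. \<exists>R\<in>strictly_upper n. A = U + D + R" by (intro bexI)
    with Usk have UA: "U = proj_form n A" by (intro proj_decomposition_iff[OF Ac, THEN iffD1] conjI)
    have hU: "h t * U = h'"
    proof -
      have "h t * U = (h t * mat_adjoint (h t)) * h'"
        unfolding U_def using H(1)[of t] h'c by (simp add: mult_assoc[of _ n])
      then show ?thesis using H(2)[of t] h'c by simp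
    qed
    show ?thesis using h' unfolding hU[symmetric] unfolding UA A_def .
  qed
  have "h t * c t = exp_diag n lam t * h0" for t using hc[of t] unfolding M_def by (rule sym)
  from that[of h c, OF h c this h00 main] show thesis .
qed

lemma complex_nonneg_cancel: "0 \<le> x * p \<Longrightarrow> 0 < p \<Longrightarrow> 0 \<le> (x :: complex)"
  by (cases x, cases p) (auto simp: less_eq_complex_def less_complex_def zero_le_mult_iff)

lemma tnn_flag_qr:
  assumes h: "h \<in> carrier_mat n n" and c: "c \<in> pos_upper n" and M: "tnn_flag n (h * c)"
  shows "tnn_flag n h"
  unfolding tnn_flag_def
proof (intro allI impI)
  fix k f assume f: "row_choice n k f"
  have eq: "left_minor (h * c) k f = left_minor h k f * (\<Prod>j<k. c $$ (j, j))"
    using c unfolding pos_upper_def by (intro left_minor_mult_upper[OF h _ _ f]) blast+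
  have pos: "0 < (\<Prod>j<k. c $$ (j, j))"
    using c row_choice_le[OF f] unfolding pos_upper_def by (intro complex_prod_pos) auto
  have "0 \<le> left_minor (h * c) k f" using M f unfolding tnn_flag_def by blast
  then show "0 \<le> left_minor h k f" unfolding eq using pos by (rule complex_nonneg_cancel)
qed

subsection \<open>The Kaehler metric in the frame of a unitary matrix\<close>

lemma tr_mult_commute:
  assumes "A \<in> carrier_mat n n" "B \<in> carrier_mat n n"
  shows "tr (A * B) = tr (B * A)"
proof -
  have "tr (A * B) = (\<Sum>i<n. \<Sum>k<n. A $$ (i, k) * B $$ (k, i))"
    using assms by (simp add: tr_def index_mult_sum[of _ n n _ n])
  also have "\<dots> = (\<Sum>k<n. \<Sum>i<n. A $$ (i, k) * B $$ (k, i))" by (rule sum.swap)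
  also have "\<dots> = tr (B * A)"
    using assms by (simp add: tr_def index_mult_sum[of _ n n _ n] mult.commute)
  finally show ?thesis .
qed

text \<open>Tangent vectors at an orbit point, seen in an eigenbasis of that point.\<close>

definition hollow_skew :: "nat \<Rightarrow> complex mat set" where
  "hollow_skew n = {x \<in> skew_hermitian n. \<forall>i<n. x $$ (i, i) = 0}"

lemma hollow_skew_carrier: "x \<in> hollow_skew n \<Longrightarrow> x \<in> carrier_mat n n"
  by (simp add: hollow_skew_def skew_hermitian_def)

lemma hollow_skewI:
  assumes "x \<in> carrier_mat n n" "\<And>i j. i < n \<Longrightarrow> j < n \<Longrightarrow> x $$ (i, j) = - cnj (x $$ (j, i))"
    "\<And>i. i < n \<Longrightarrow> x $$ (i, i) = 0"
  shows "x \<in> hollow_skew n"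
  using assms unfolding hollow_skew_def skew_hermitian_iff by blast

lemma hollow_skew_entry: "x \<in> hollow_skew n \<Longrightarrow> i < n \<Longrightarrow> j < n \<Longrightarrow> x $$ (i, j) = - cnj (x $$ (j, i))"
  unfolding hollow_skew_def skew_hermitian_iff by blast

lemma hollow_skew_diag: "x \<in> hollow_skew n \<Longrightarrow> i < n \<Longrightarrow> x $$ (i, i) = 0"
  unfolding hollow_skew_def by blast

lemma hollow_skew_skew: "x \<in> hollow_skew n \<Longrightarrow> x \<in> skew_hermitian n"
  unfolding hollow_skew_def by blast

text \<open>Entrywise multiplication by a weight. In an eigenbasis \<open>ad\<close>, its inverse on
  tangent vectors, the splitting off of the kernel and the square root all have this form, so each
  identity between them is one between scalars.\<close>

definition hadamard :: "nat \<Rightarrow> (nat \<Rightarrow> nat \<Rightarrow> complex) \<Rightarrow> complex mat \<Rightarrow> complex mat" where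
  "hadamard n w x = mat n n (\<lambda>(i, j). w i j * x $$ (i, j))"

lemma hadamard_carrier [simp]: "hadamard n w x \<in> carrier_mat n n"
  by (simp add: hadamard_def)

lemma hadamard_dims [simp]: "dim_row (hadamard n w x) = n" "dim_col (hadamard n w x) = n"
  by (simp_all add: hadamard_def)

lemma hadamard_index [simp]: "i < n \<Longrightarrow> j < n \<Longrightarrow> hadamard n w x $$ (i, j) = w i j * x $$ (i, j)"
  by (simp add: hadamard_def)

lemma hadamard_hollow_skew:
  assumes x: "x \<in> skew_hermitian n" and w: "\<And>i j. i < n \<Longrightarrow> j < n \<Longrightarrow> w i j = cnj (w j i)" "\<And>i. i < n \<Longrightarrow> w i i = 0"
  shows "hadamard n w x \<in> hollow_skew n"
proof (rule hollow_skewI)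
  fix i j assume ij: "i < n" "j < n"
  show "hadamard n w x $$ (i, j) = - cnj (hadamard n w x $$ (j, i))"
    unfolding hadamard_index[OF ij] hadamard_index[OF ij(2,1)] w(1)[OF ij]
    by (subst skew_hermitian_entry[OF x ij]) simp
qed (simp_all add: w(2))

lemma kappa_hollow:
  assumes x: "x \<in> carrier_mat n n" "\<And>i. i < n \<Longrightarrow> x $$ (i, i) = 0" and y: "y \<in> carrier_mat n n"
  shows "kappa n x y = 2 * real n * (\<Sum>i<n. \<Sum>j<n. Re (x $$ (i, j) * y $$ (j, i)))"
proof -
  have "tr x = 0" using x by (simp add: tr_def)
  moreover have "tr (x * y) = (\<Sum>i<n. \<Sum>j<n. x $$ (i, j) * y $$ (j, i))"
    using x y by (simp add: tr_def index_mult_sum[of _ n n _ n])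
  ultimately show ?thesis by (simp add: kappa_def Re_sum)
qed

lemma kappa_hollow_skew:
  assumes x: "x \<in> hollow_skew n" and y: "y \<in> hollow_skew n"
  shows "- kappa n x y = 2 * real n * (\<Sum>i<n. \<Sum>j<n. Re (x $$ (i, j) * cnj (y $$ (i, j))))"
proof -
  have e: "Re (x $$ (i, j) * y $$ (j, i)) = - Re (x $$ (i, j) * cnj (y $$ (i, j)))" if "i < n" "j < n" for i j
    by (subst hollow_skew_entry[OF y that(2,1)]) simp
  have "(\<Sum>i<n. \<Sum>j<n. Re (x $$ (i, j) * y $$ (j, i))) = (\<Sum>i<n. \<Sum>j<n. - Re (x $$ (i, j) * cnj (y $$ (i, j))))"
    by (intro sum.cong refl e) (simp_all only: lessThan_iff)
  also have "\<dots> = - (\<Sum>i<n. \<Sum>j<n. Re (x $$ (i, j) * cnj (y $$ (i, j))))"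
    by (simp only: sum_negf)
  finally have s: "(\<Sum>i<n. \<Sum>j<n. Re (x $$ (i, j) * y $$ (j, i))) = - (\<Sum>i<n. \<Sum>j<n. Re (x $$ (i, j) * cnj (y $$ (i, j))))" .
  have "kappa n x y = 2 * real n * (\<Sum>i<n. \<Sum>j<n. Re (x $$ (i, j) * y $$ (j, i)))"
    by (rule kappa_hollow[OF hollow_skew_carrier[OF x] _ hollow_skew_carrier[OF y]]) (rule hollow_skew_diag[OF x])
  then show ?thesis unfolding s by (simp only: mult_minus_right minus_minus)
qed

context
  fixes n :: nat and lam :: "real vec" and h M :: "complex mat"
  assumes lam: "strictly_decreasing lam" "lam \<in> carrier_vec n" and h: "h \<in> unitary_group n"
    and M: "M = h * spectrum_diag n lam * mat_adjoint h"
begin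

definition frame :: "complex mat \<Rightarrow> complex mat" where
  "frame x = h * x * mat_adjoint h"

definition coframe :: "complex mat \<Rightarrow> complex mat" where
  "coframe X = mat_adjoint h * X * h"

text \<open>The eigenvalue of \<open>ad\<close> of the diagonal matrix
  \<open>spectrum_diag n lam\<close> on the matrix unit at \<open>(i, j)\<close>.\<close>

definition gap :: "nat \<Rightarrow> nat \<Rightarrow> complex" where
  "gap i j = \<i> * complex_of_real (lam $ i - lam $ j)"

lemmas h_unitary = unitary_groupD[OF h]

lemma frame_carrier [simp]: "x \<in> carrier_mat n n \<Longrightarrow> frame x \<in> carrier_mat n n"
  using h_unitary(1) by (simp add: frame_def)

lemma coframe_carrier [simp]: "x \<in> carrier_mat n n \<Longrightarrow> coframe x \<in> carrier_mat n n"
  using h_unitary(1) by (simp add: coframe_def)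

lemma unitary_cancel:
  assumes "A \<in> carrier_mat n n"
  shows "mat_adjoint h * (h * A) = A" "h * (mat_adjoint h * A) = A"
  using assms h_unitary(1-3) by (simp_all add: mult_assoc[of _ n, symmetric])

lemma frame_coframe [simp]: "X \<in> carrier_mat n n \<Longrightarrow> frame (coframe X) = X"
  using h_unitary(1,2) by (simp add: frame_def coframe_def mult_assoc[of _ n] unitary_cancel)

lemma coframe_frame [simp]: "X \<in> carrier_mat n n \<Longrightarrow> coframe (frame X) = X"
  using h_unitary(1,3) by (simp add: frame_def coframe_def mult_assoc[of _ n] unitary_cancel)

lemma frame_inj: "x \<in> carrier_mat n n \<Longrightarrow> y \<in> carrier_mat n n \<Longrightarrow> frame x = frame y \<Longrightarrow> x = y"
  using coframe_frame by metis

lemma frame_mult: "x \<in> carrier_mat n n \<Longrightarrow> y \<in> carrier_mat n n \<Longrightarrow> frame x * frame y = frame (x * y)"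
  using h_unitary(1) by (simp add: frame_def mult_assoc[of _ n] unitary_cancel)

lemma frame_add: "x \<in> carrier_mat n n \<Longrightarrow> y \<in> carrier_mat n n \<Longrightarrow> frame (x + y) = frame x + frame y"
  using h_unitary(1) by (simp add: frame_def mult_add_distrib_mat[of _ n n _ n] add_mult_distrib_mat[of _ n n _ _ n])

lemma frame_smult: "x \<in> carrier_mat n n \<Longrightarrow> frame (a \<cdot>\<^sub>m x) = a \<cdot>\<^sub>m frame x"
  using h_unitary(1) by (simp add: frame_def mult_smult_distrib[of _ n n _ n] mult_smult_assoc_mat[of _ n n _ n])

lemma frame_minus: "x \<in> carrier_mat n n \<Longrightarrow> y \<in> carrier_mat n n \<Longrightarrow> frame (x - y) = frame x - frame y"
  using h_unitary(1) by (simp add: frame_def mult_minus_distrib_mat[of _ n n _ n] minus_mult_distrib_mat[of _ n n _ _ n])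

lemma frame_uminus: "x \<in> carrier_mat n n \<Longrightarrow> frame (- x) = - frame x"
  using frame_smult[of x "- 1"] frame_carrier[of x] by (simp add: uminus_mat_def smult_mat_def map_mat_def)

lemma frame_bracket: "x \<in> carrier_mat n n \<Longrightarrow> y \<in> carrier_mat n n \<Longrightarrow> bracket (frame x) (frame y) = frame (bracket x y)"
  by (simp add: bracket_def frame_mult frame_minus)

lemma frame_adjoint: "x \<in> carrier_mat n n \<Longrightarrow> mat_adjoint (frame x) = frame (mat_adjoint x)"
  using h_unitary(1) by (simp add: frame_def mat_adjoint_mult[of _ n n _ n] mult_assoc[of _ n])

lemma M_frame: "M = frame (spectrum_diag n lam)"
  by (simp add: M frame_def)

lemma M_carrier: "M \<in> carrier_mat n n"
  by (simp add: M_frame)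

lemma frame_skew: "x \<in> skew_hermitian n \<Longrightarrow> frame x \<in> skew_hermitian n"
  by (simp add: skew_hermitian_def frame_adjoint frame_uminus)

lemma frame_tr: "x \<in> carrier_mat n n \<Longrightarrow> tr (frame x) = tr x"
  using tr_mult_commute[of "h * x" n "mat_adjoint h"] h_unitary(1) by (simp add: frame_def unitary_cancel)

lemma frame_kappa: "x \<in> carrier_mat n n \<Longrightarrow> y \<in> carrier_mat n n \<Longrightarrow> kappa n (frame x) (frame y) = kappa n x y"
  by (simp add: kappa_def frame_mult frame_tr)

lemma coframe_skew: "x \<in> skew_hermitian n \<Longrightarrow> coframe x \<in> skew_hermitian n"
proof -
  assume x: "x \<in> skew_hermitian n"
  then have c: "x \<in> carrier_mat n n" by (rule skew_hermitian_carrier)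
  have "frame (mat_adjoint (coframe x)) = frame (- coframe x)"
    using x c by (simp add: frame_adjoint[symmetric] frame_uminus skew_hermitian_def)
  then show ?thesis using c frame_inj[of "mat_adjoint (coframe x)" "- coframe x"] by (simp add: skew_hermitian_def)
qed

lemma bracket_spectrum: "x \<in> carrier_mat n n \<Longrightarrow> bracket (spectrum_diag n lam) x = hadamard n gap x"
  by (rule square_eqI[of _ n])
    (simp_all add: bracket_def spectrum_diag_def gap_def minus_carrier_mat algebra_simps)

lemma bracket_M: "x \<in> carrier_mat n n \<Longrightarrow> bracket M (frame x) = frame (hadamard n gap x)"
  by (simp add: M_frame frame_bracket bracket_spectrum)

lemma gap_sym: "gap i j = cnj (gap j i)" and gap_diag [simp]: "gap i i = 0"
  by (simp_all add: gap_def complex_eq_iff)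

lemma inverse_gap_sym: "inverse (gap i j) = cnj (inverse (gap j i))"
  by (simp add: gap_sym[of i j])

lemma gap_nonzero: "i < n \<Longrightarrow> j < n \<Longrightarrow> i \<noteq> j \<Longrightarrow> gap i j \<noteq> 0"
  using strictly_decreasing_neq[OF lam] by (simp add: gap_def)

lemma hadamard_gap_inverse:
  assumes "u \<in> hollow_skew n"
  shows "hadamard n gap (hadamard n (\<lambda>i j. inverse (gap i j)) u) = u"
proof (rule square_eqI[OF hadamard_carrier hollow_skew_carrier[OF assms]])
  fix i j assume "i < n" "j < n"
  then show "hadamard n gap (hadamard n (\<lambda>i j. inverse (gap i j)) u) $$ (i, j) = u $$ (i, j)"
    using hollow_skew_diag[OF assms] gap_nonzero[of i j] by (cases "i = j") simp_all
qed

text \<open>In the frame, \<open>ad M\<close> multiplies entries by \<open>gap\<close>, which kills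
  the diagonal and is invertible off it because the eigenvalues are distinct. The inverse weights
  have the same conjugation symmetry, so preimages are skew-Hermitian.\<close>

lemma ad_image_frame: "ad_image n M = frame ` hollow_skew n"
proof
  show "ad_image n M \<subseteq> frame ` hollow_skew n"
  proof
    fix U assume "U \<in> ad_image n M"
    then obtain X where X: "X \<in> skew_hermitian n" "U = bracket M X" by (auto simp: ad_image_def)
    have c: "X \<in> carrier_mat n n" using X(1) by (rule skew_hermitian_carrier)
    have "U = frame (hadamard n gap (coframe X))" using X(2) bracket_M[of "coframe X"] c by simp
    moreover have "hadamard n gap (coframe X) \<in> hollow_skew n"
      by (rule hadamard_hollow_skew[OF coframe_skew[OF X(1)] gap_sym]) simp
    ultimately show "U \<in> frame ` hollow_skew n" by blast
  qed
  show "frame ` hollow_skew n \<subseteq> ad_image n M"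
  proof
    fix U assume "U \<in> frame ` hollow_skew n"
    then obtain u where u: "u \<in> hollow_skew n" "U = frame u" by blast
    define x where "x = hadamard n (\<lambda>i j. inverse (gap i j)) u"
    have "x \<in> hollow_skew n" unfolding x_def
      by (rule hadamard_hollow_skew[OF hollow_skew_skew[OF u(1)] inverse_gap_sym]) simp
    moreover have "hadamard n gap x = u"
      unfolding x_def by (rule hadamard_gap_inverse[OF u(1)])
    ultimately have "frame u = bracket M (frame x)" "frame x \<in> skew_hermitian n"
      using bracket_M[OF hollow_skew_carrier] frame_skew[OF hollow_skew_skew] by simp_all
    then show "U \<in> ad_image n M" unfolding ad_image_def u(2) by blast
  qed
qed

text \<open>Distinct eigenvalues make the kernel of \<open>ad M\<close> the diagonal matrices of the
  frame, so the image part is what remains after deleting the diagonal.\<close>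

lemma im_part_frame:
  assumes x: "x \<in> skew_hermitian n"
  shows "im_part n M (frame x) = frame (hadamard n (\<lambda>i j. if i = j then 0 else 1) x)"
proof -
  let ?o = "\<lambda>x. hadamard n (\<lambda>i j. if i = j then 0 else 1) x"
  have c: "x \<in> carrier_mat n n" using x by (rule skew_hermitian_carrier)
  have ker: "Z \<in> ad_kernel n M \<longleftrightarrow> Z \<in> skew_hermitian n \<and> (\<forall>i<n. \<forall>j<n. i \<noteq> j \<longrightarrow> coframe Z $$ (i, j) = 0)"
    if Zc: "Z \<in> carrier_mat n n" for Z
  proof -
    have "bracket M Z = frame (hadamard n gap (coframe Z))" using bracket_M[of "coframe Z"] Zc by simp
    moreover have "frame (0\<^sub>m n n) = 0\<^sub>m n n" using h_unitary(1) by (simp add: frame_def)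
    ultimately have "bracket M Z = 0\<^sub>m n n \<longleftrightarrow> hadamard n gap (coframe Z) = 0\<^sub>m n n"
      using frame_inj[of "hadamard n gap (coframe Z)" "0\<^sub>m n n"] by auto
    also have "\<dots> \<longleftrightarrow> (\<forall>i<n. \<forall>j<n. gap i j * coframe Z $$ (i, j) = 0)"
      by (auto simp: mat_eq_iff hadamard_def)
    also have "\<dots> \<longleftrightarrow> (\<forall>i<n. \<forall>j<n. i \<noteq> j \<longrightarrow> coframe Z $$ (i, j) = 0)"
      using gap_nonzero by (metis gap_diag mult_eq_0_iff)
    finally show ?thesis by (simp add: ad_kernel_def)
  qed
  show ?thesis
    unfolding im_part_def
  proof (rule the_equality)
    let ?d = "hadamard n (\<lambda>i j. if i = j then 1 else 0) x"
    have od: "x = ?o x + ?d" by (rule square_eqI[OF c]) auto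
    have ds: "?d \<in> skew_hermitian n"
      unfolding skew_hermitian_iff
    proof (intro conjI allI impI)
      fix i j assume ij: "i < n" "j < n"
      show "?d $$ (i, j) = - cnj (?d $$ (j, i))"
        unfolding hadamard_index[OF ij] hadamard_index[OF ij(2,1)]
        by (subst skew_hermitian_entry[OF x ij]) simp
    qed simp
    then have "frame ?d \<in> ad_kernel n M" by (subst ker) (auto intro: frame_skew)
    moreover have "frame x = frame (?o x) + frame ?d" by (subst od) (simp add: frame_add)
    moreover have "frame (?o x) \<in> ad_image n M"
      unfolding ad_image_frame by (rule imageI, rule hadamard_hollow_skew[OF x]) auto
    ultimately show "frame (?o x) \<in> ad_image n M \<and> (\<exists>Z\<in>ad_kernel n M. frame x = frame (?o x) + Z)" by blast
  next
    fix Y assume "Y \<in> ad_image n M \<and> (\<exists>Z\<in>ad_kernel n M. frame x = Y + Z)"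
    then obtain y Z where y: "y \<in> hollow_skew n" "Y = frame y" and Z: "Z \<in> ad_kernel n M" "frame x = Y + Z"
      unfolding ad_image_frame by blast
    have yc: "y \<in> carrier_mat n n" using y(1) by (rule hollow_skew_carrier)
    have Zc: "Z \<in> carrier_mat n n" using Z(1) by (simp add: ad_kernel_def skew_hermitian_def)
    have "frame x = frame (y + coframe Z)" using Z(2) y(2) yc Zc by (simp add: frame_add)
    then have xy: "x = y + coframe Z" using frame_inj[of x "y + coframe Z"] c yc Zc by simp
    have "y = ?o x"
    proof (rule square_eqI[OF yc])
      fix i j assume ij: "i < n" "j < n"
      have "x $$ (i, j) = y $$ (i, j) + coframe Z $$ (i, j)"
        using arg_cong[OF xy, of "\<lambda>A. A $$ (i, j)"] ij carrier_matD[OF coframe_carrier[OF Zc]] by simp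
      then show "y $$ (i, j) = ?o x $$ (i, j)"
        using ker[OF Zc] Z(1) hollow_skew_diag[OF y(1)] ij by auto
    qed simp
    then show "Y = frame (?o x)" using y(2) by simp
  qed
qed

text \<open>A preimage under \<open>ad M\<close> is determined up to a diagonal matrix, which
  \<open>im_part\<close> discards. Its image part is therefore always the entrywise quotient by
  \<open>gap\<close>, and the description has a single value.\<close>

lemma normal_metric_frame:
  assumes u: "u \<in> hollow_skew n" and v: "v \<in> hollow_skew n"
  shows "normal_metric n M (frame u) (frame v) =
    - kappa n (hadamard n (\<lambda>i j. inverse (gap i j)) u) (hadamard n (\<lambda>i j. inverse (gap i j)) v)"
proof -
  let ?p = "\<lambda>u. hadamard n (\<lambda>i j. inverse (gap i j)) u" and ?o = "\<lambda>x. hadamard n (\<lambda>i j. if i = j then 0 else 1) x"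
  have p: "?p u \<in> hollow_skew n" if "u \<in> hollow_skew n" for u
    by (rule hadamard_hollow_skew[OF hollow_skew_skew[OF that] inverse_gap_sym]) simp
  have gp: "hadamard n gap (?p u) = u" if "u \<in> hollow_skew n" for u
    by (rule hadamard_gap_inverse[OF that])
  have op: "?o (?p u) = ?p u" for u
    by (rule square_eqI[of _ n]) auto
  have key: "im_part n M X = frame (?p u)" if X: "X \<in> skew_hermitian n" "frame u = bracket M X" and u: "u \<in> hollow_skew n" for X u
  proof -
    have Xc: "X \<in> carrier_mat n n" using X(1) by (rule skew_hermitian_carrier)
    have "frame u = frame (hadamard n gap (coframe X))" using X(2) bracket_M[of "coframe X"] Xc by simp
    then have e: "u = hadamard n gap (coframe X)" using frame_inj hollow_skew_carrier[OF u] by simp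
    have "?o (coframe X) = ?p u"
    proof (rule square_eqI[of _ n])
      fix i j assume "i < n" "j < n"
      then show "?o (coframe X) $$ (i, j) = ?p u $$ (i, j)"
        unfolding e using gap_nonzero[of i j] by (cases "i = j") simp_all
    qed simp_all
    then show ?thesis using im_part_frame[OF coframe_skew[OF X(1)]] Xc by simp
  qed
  have kf: "kappa n (frame (?p u)) (frame (?p v)) = kappa n (?p u) (?p v)" by (simp add: frame_kappa)
  show ?thesis
    unfolding normal_metric_def
  proof (rule the_equality)
    have pre: "frame (?p u) \<in> skew_hermitian n" "frame u = bracket M (frame (?p u))" if "u \<in> hollow_skew n" for u
    proof -
      show "frame (?p u) \<in> skew_hermitian n" by (rule frame_skew[OF hollow_skew_skew[OF p[OF that]]])
      show "frame u = bracket M (frame (?p u))" unfolding bracket_M[OF hadamard_carrier] gp[OF that] by (rule refl)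
    qed
    have "- kappa n (?p u) (?p v) = - kappa n (im_part n M (frame (?p u))) (im_part n M (frame (?p v)))"
      unfolding key[OF pre[OF u] u] key[OF pre[OF v] v] kf by (rule refl)
    then show "\<exists>X\<in>skew_hermitian n. \<exists>Y\<in>skew_hermitian n. frame u = bracket M X \<and> frame v = bracket M Y \<and>
        - kappa n (?p u) (?p v) = - kappa n (im_part n M X) (im_part n M Y)"
      using pre[OF u] pre[OF v] by blast
  next
    fix r assume "\<exists>X\<in>skew_hermitian n. \<exists>Y\<in>skew_hermitian n. frame u = bracket M X \<and> frame v = bracket M Y \<and>
        r = - kappa n (im_part n M X) (im_part n M Y)"
    then obtain X Y where X: "X \<in> skew_hermitian n" "frame u = bracket M X"
      and Y: "Y \<in> skew_hermitian n" "frame v = bracket M Y" and r: "r = - kappa n (im_part n M X) (im_part n M Y)" by blast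
    show "r = - kappa n (?p u) (?p v)" unfolding r key[OF X u] key[OF Y v] kf by (rule refl)
  qed
qed

section \<open>The positive square root of \<open>- (ad M)\<close> squared\<close>

definition absgap :: "nat \<Rightarrow> nat \<Rightarrow> complex" where
  "absgap i j = complex_of_real \<bar>lam $ i - lam $ j\<bar>"

lemma absgap_sym: "absgap i j = cnj (absgap j i)" and absgap_diag [simp]: "absgap i i = 0"
  by (simp_all add: absgap_def abs_minus_commute)

lemma absgap_square: "absgap i j * absgap i j = - (gap i j * gap i j)"
proof -
  have "absgap i j * absgap i j = complex_of_real ((lam $ i - lam $ j) * (lam $ i - lam $ j))"
    by (simp only: absgap_def of_real_mult[symmetric] abs_mult_self_eq)
  then show ?thesis by (simp add: gap_def complex_eq_iff)
qed

lemma absgap_hollow: "u \<in> hollow_skew n \<Longrightarrow> hadamard n absgap u \<in> hollow_skew n"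
  by (rule hadamard_hollow_skew[OF hollow_skew_skew absgap_sym]) simp_all

lemma hollow_add: "u \<in> hollow_skew n \<Longrightarrow> v \<in> hollow_skew n \<Longrightarrow> u + v \<in> hollow_skew n"
proof (rule hollow_skewI)
  assume u: "u \<in> hollow_skew n" and v: "v \<in> hollow_skew n"
  note c = hollow_skew_carrier[OF u] hollow_skew_carrier[OF v]
  show "u + v \<in> carrier_mat n n" using c by simp
  show "(u + v) $$ (i, i) = 0" if "i < n" for i using hollow_skew_diag[OF u that] hollow_skew_diag[OF v that] c that by simp
  fix i j assume ij: "i < n" "j < n"
  show "(u + v) $$ (i, j) = - cnj ((u + v) $$ (j, i))"
    using c ij hollow_skew_entry[OF u ij] hollow_skew_entry[OF v ij] by simp
qed

lemma hollow_smult: "u \<in> hollow_skew n \<Longrightarrow> complex_of_real c \<cdot>\<^sub>m u \<in> hollow_skew n"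
proof (rule hollow_skewI)
  assume u: "u \<in> hollow_skew n"
  note c = hollow_skew_carrier[OF u]
  show "complex_of_real c \<cdot>\<^sub>m u \<in> carrier_mat n n" using c by simp
  show "(complex_of_real c \<cdot>\<^sub>m u) $$ (i, i) = 0" if "i < n" for i using hollow_skew_diag[OF u that] c that by simp
  fix i j assume ij: "i < n" "j < n"
  show "(complex_of_real c \<cdot>\<^sub>m u) $$ (i, j) = - cnj ((complex_of_real c \<cdot>\<^sub>m u) $$ (j, i))"
    using c ij hollow_skew_entry[OF u ij] by simp
qed

lemma neg_ad_square_frame:
  assumes u: "u \<in> hollow_skew n"
  shows "- bracket M (bracket M (frame u)) = frame (hadamard n absgap (hadamard n absgap u))"
proof -
  have "- bracket M (bracket M (frame u)) = frame (- hadamard n gap (hadamard n gap u))"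
    using hollow_skew_carrier[OF u] by (simp add: bracket_M frame_uminus)
  also have "- hadamard n gap (hadamard n gap u) = hadamard n absgap (hadamard n absgap u)"
  proof (rule square_eqI[of _ n])
    fix i j assume ij: "i < n" "j < n"
    show "(- hadamard n gap (hadamard n gap u)) $$ (i, j) = hadamard n absgap (hadamard n absgap u) $$ (i, j)"
      using ij absgap_square[of i j] by (simp add: hadamard_def mult.assoc[symmetric])
  qed simp_all
  finally show ?thesis .
qed


text \<open>With zero diagonal the trace term of \<open>kappa\<close> drops out, and
  \<open>- kappa\<close> is a positive multiple of the squared Frobenius norm.\<close>

lemma hollow_kappa_definite:
  assumes w: "w \<in> hollow_skew n" and k: "0 \<le> kappa n w w"
  shows "i < n \<Longrightarrow> j < n \<Longrightarrow> w $$ (i, j) = 0"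
proof -
  assume ij: "i < n" "j < n"
  have "2 * real n * (\<Sum>i<n. \<Sum>j<n. Re (w $$ (i, j) * cnj (w $$ (i, j)))) \<le> 0"
    using kappa_hollow_skew[OF w w] k by linarith
  then have "(\<Sum>i<n. \<Sum>j<n. Re (w $$ (i, j) * cnj (w $$ (i, j)))) \<le> 0"
    using ij by (simp add: mult_le_0_iff)
  then have s: "(\<Sum>i<n. \<Sum>j<n. (cmod (w $$ (i, j)))\<^sup>2) \<le> 0"
    by (simp only: complex_norm_square[symmetric] Re_complex_of_real)
  have "(cmod (w $$ (i, j)))\<^sup>2 \<le> (\<Sum>j<n. (cmod (w $$ (i, j)))\<^sup>2)"
    by (rule member_le_sum) (use ij in auto)
  also have "\<dots> \<le> (\<Sum>i<n. \<Sum>j<n. (cmod (w $$ (i, j)))\<^sup>2)"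
    by (rule member_le_sum) (use ij in \<open>auto intro: sum_nonneg\<close>)
  finally have "(cmod (w $$ (i, j)))\<^sup>2 \<le> 0" using s by linarith
  then show "w $$ (i, j) = 0" by simp
qed

text \<open>The body of the definite description \<open>sqrt_neg_ad_sq\<close> at \<open>M\<close>,
  named so that existence and uniqueness can be argued separately.\<close>

definition sqrt_conditions :: "(complex mat \<Rightarrow> complex mat) \<Rightarrow> bool" where
  "sqrt_conditions S \<longleftrightarrow> (let T = ad_image n M in
     S \<in> T \<rightarrow>\<^sub>E T \<and>
     (\<forall>U\<in>T. \<forall>V\<in>T. S (U + V) = S U + S V) \<and>
     (\<forall>c. \<forall>U\<in>T. S (complex_of_real c \<cdot>\<^sub>m U) = complex_of_real c \<cdot>\<^sub>m S U) \<and>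
     (\<forall>U\<in>T. \<forall>V\<in>T. - kappa n (S U) V = - kappa n U (S V)) \<and>
     (\<forall>U\<in>T. 0 \<le> - kappa n (S U) U) \<and>
     (\<forall>U\<in>T. S (S U) = - bracket M (bracket M U)))"

lemma sqrt_conditionsD:
  assumes "sqrt_conditions S"
  shows "\<And>u. u \<in> hollow_skew n \<Longrightarrow> S (frame u) \<in> frame ` hollow_skew n"
    and "\<And>u v. u \<in> hollow_skew n \<Longrightarrow> v \<in> hollow_skew n \<Longrightarrow> S (frame u + frame v) = S (frame u) + S (frame v)"
    and "\<And>u c. u \<in> hollow_skew n \<Longrightarrow> S (complex_of_real c \<cdot>\<^sub>m frame u) = complex_of_real c \<cdot>\<^sub>m S (frame u)"
    and "\<And>u. u \<in> hollow_skew n \<Longrightarrow> 0 \<le> - kappa n (S (frame u)) (frame u)"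
    and "\<And>u. u \<in> hollow_skew n \<Longrightarrow> S (S (frame u)) = - bracket M (bracket M (frame u))"
    and "S \<in> extensional (ad_image n M)"
  using assms unfolding sqrt_conditions_def Let_def ad_image_frame PiE_def Pi_def by blast+

text \<open>Let \<open>w\<close> be \<open>S e - l e\<close>, read in the frame. From
  \<open>S (S e) = l^2 e\<close> one gets \<open>S w = - l w\<close>; positive semidefiniteness of
  \<open>S\<close> and \<open>0 < l\<close> then force the norm of \<open>w\<close> to
  vanish.\<close>

lemma sqrt_eigenvector:
  assumes S: "sqrt_conditions S" and e: "e \<in> hollow_skew n" and l: "0 < l"
    and el: "hadamard n absgap e = complex_of_real l \<cdot>\<^sub>m e"
  shows "S (frame e) = frame (hadamard n absgap e)"
proof -
  note D = sqrt_conditionsD[OF S]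
  have ec: "e \<in> carrier_mat n n" using e by (rule hollow_skew_carrier)
  from D(1)[OF e] obtain s where s: "s \<in> hollow_skew n" and Se: "S (frame e) = frame s" by blast
  have sc: "s \<in> carrier_mat n n" using s by (rule hollow_skew_carrier)
  define w where "w = s + complex_of_real (- l) \<cdot>\<^sub>m e"
  have w: "w \<in> hollow_skew n" unfolding w_def by (intro hollow_add s hollow_smult e)
  have wc: "w \<in> carrier_mat n n" using w by (rule hollow_skew_carrier)
  have fw: "frame w = frame s + frame (complex_of_real (- l) \<cdot>\<^sub>m e)"
    unfolding w_def using ec by (intro frame_add sc) simp
  have SS: "S (frame s) = frame (hadamard n absgap (hadamard n absgap e))"
    unfolding Se[symmetric] D(5)[OF e] by (rule neg_ad_square_frame[OF e])
  have Sl: "S (frame (complex_of_real (- l) \<cdot>\<^sub>m e)) = frame (complex_of_real (- l) \<cdot>\<^sub>m s)"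
    unfolding frame_smult[OF ec] frame_smult[OF sc] D(3)[OF e] Se by (rule refl)
  have "S (frame w) = frame (hadamard n absgap (hadamard n absgap e)) + frame (complex_of_real (- l) \<cdot>\<^sub>m s)"
    unfolding fw D(2)[OF s hollow_smult[OF e]] SS Sl by (rule refl)
  also have "\<dots> = frame (hadamard n absgap (hadamard n absgap e) + complex_of_real (- l) \<cdot>\<^sub>m s)"
    using sc by (intro frame_add[symmetric]) simp_all
  also have "hadamard n absgap (hadamard n absgap e) + complex_of_real (- l) \<cdot>\<^sub>m s = complex_of_real (- l) \<cdot>\<^sub>m w"
  proof (rule square_eqI[of _ n])
    fix i j assume ij: "i < n" "j < n"
    have 1: "hadamard n absgap e $$ (i, j) = complex_of_real l * e $$ (i, j)" unfolding el using ec ij by simp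
    have "hadamard n absgap (hadamard n absgap e) $$ (i, j) = absgap i j * (complex_of_real l * e $$ (i, j))"
      using ij 1 by (simp add: hadamard_def)
    also have "\<dots> = complex_of_real l * (hadamard n absgap e $$ (i, j))" using ij by (simp add: mult.left_commute)
    finally have 2: "hadamard n absgap (hadamard n absgap e) $$ (i, j) = complex_of_real l * (complex_of_real l * e $$ (i, j))"
      unfolding 1 .
    show "(hadamard n absgap (hadamard n absgap e) + complex_of_real (- l) \<cdot>\<^sub>m s) $$ (i, j) = (complex_of_real (- l) \<cdot>\<^sub>m w) $$ (i, j)"
      using ij ec sc 2 by (simp add: w_def algebra_simps del: hadamard_index)
  qed (use sc wc in simp_all)
  finally have Sw: "S (frame w) = frame (complex_of_real (- l) \<cdot>\<^sub>m w)" .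
  have "kappa n (complex_of_real (- l) \<cdot>\<^sub>m w) w = - l * kappa n w w"
  proof -
    have "kappa n (complex_of_real (- l) \<cdot>\<^sub>m w) w = 2 * real n * (\<Sum>i<n. \<Sum>j<n. - l * Re (w $$ (i, j) * w $$ (j, i)))"
      using wc hollow_skew_diag[OF w]
      by (subst kappa_hollow) (simp_all add: algebra_simps)
    then show ?thesis
      using kappa_hollow[OF wc hollow_skew_diag[OF w] wc] by (simp only: sum_distrib_left[symmetric] mult.left_commute)
  qed
  then have "0 \<le> l * kappa n w w"
    using D(4)[OF w] wc unfolding Sw by (simp add: frame_kappa)
  then have "0 \<le> kappa n w w" using l by (simp add: zero_le_mult_iff)
  note w0 = hollow_kappa_definite[OF w this]
  have "s = hadamard n absgap e"
    unfolding el
  proof (rule square_eqI[OF sc])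
    fix i j assume ij: "i < n" "j < n"
    show "s $$ (i, j) = (complex_of_real l \<cdot>\<^sub>m e) $$ (i, j)"
      using w0[OF ij] ij sc ec by (simp add: w_def)
  qed (use ec in simp)
  then show ?thesis using Se by simp
qed

text \<open>The matrix \<open>u\<close> is a sum of pieces supported on one pair of positions
  \<open>(p, q)\<close> and \<open>(q, p)\<close>. Each piece is an eigenvector with eigenvalue
  \<open>|lam_p - lam_q| > 0\<close>. The two positions stay together because a single matrix unit
  is not skew-Hermitian and \<open>S\<close> is only real-linear.\<close>

lemma sqrt_unique:
  assumes S: "sqrt_conditions S" and u: "u \<in> hollow_skew n"
  shows "S (frame u) = frame (hadamard n absgap u)"
proof -
  note D = sqrt_conditionsD[OF S]
  have uc: "u \<in> carrier_mat n n" using u by (rule hollow_skew_carrier)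
  define r where "r F = hadamard n (\<lambda>i j. if (i, j) \<in> F \<or> (j, i) \<in> F then 1 else 0) u" for F
  have r: "r F \<in> hollow_skew n" if "F \<subseteq> {(p, q). p < q}" for F
    unfolding r_def by (rule hadamard_hollow_skew[OF hollow_skew_skew[OF u]]) (use that in auto)
  have rc: "r F \<in> carrier_mat n n" for F by (simp add: r_def)
  have "S (frame (r F)) = frame (hadamard n absgap (r F))" if "finite F" "F \<subseteq> {(p, q). p < q \<and> q < n}" for F
    using that
  proof (induction F rule: finite_induct)
    case empty
    \<comment> \<open>The zero matrix is written as a zero multiple of \<open>u\<close>, so that
      homogeneity yields its image under \<open>S\<close>.\<close>
    have r0: "r {} = complex_of_real 0 \<cdot>\<^sub>m u" and r0': "hadamard n absgap (r {}) = complex_of_real 0 \<cdot>\<^sub>m u"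
      by (rule square_eqI[of _ n]; use uc in \<open>simp add: r_def\<close>)+
    obtain s where s: "s \<in> hollow_skew n" "S (frame u) = frame s" using D(1)[OF u] by blast
    have "S (frame (r {})) = complex_of_real 0 \<cdot>\<^sub>m frame s"
      unfolding r0 frame_smult[OF uc] D(3)[OF u] s(2) by (rule refl)
    also have "\<dots> = complex_of_real 0 \<cdot>\<^sub>m frame u"
      by (rule square_eqI[of _ n]) (use hollow_skew_carrier[OF s(1)] uc carrier_matD[OF frame_carrier[OF hollow_skew_carrier[OF s(1)]]]
        carrier_matD[OF frame_carrier[OF uc]] in simp_all)
    finally show ?case unfolding r0' frame_smult[OF uc] .
  next
    case (insert x F)
    obtain p q where x: "x = (p, q)" by (cases x)
    have pq: "p < q" "q < n" using insert.prems x by auto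
    have F: "F \<subseteq> {(p, q). p < q}" using insert.prems by auto
    have e: "r {x} \<in> hollow_skew n" using pq x by (intro r) auto
    have add: "r (insert x F) = r F + r {x}"
    proof (rule square_eqI[of _ n])
      fix i j assume ij: "i < n" "j < n"
      have "\<not> (((i, j) \<in> F \<or> (j, i) \<in> F) \<and> ((i, j) = x \<or> (j, i) = x))"
        using insert.hyps(2) F pq x by auto
      then show "r (insert x F) $$ (i, j) = (r F + r {x}) $$ (i, j)" using ij by (auto simp: r_def)
    qed (use rc in simp_all)
    define l where "l = \<bar>lam $ p - lam $ q\<bar>"
    have l: "0 < l" using strictly_decreasing_neq[OF lam, of p q] pq by (simp add: l_def)
    have el: "hadamard n absgap (r {x}) = complex_of_real l \<cdot>\<^sub>m r {x}"
      by (rule square_eqI[of _ n]) (use rc x in \<open>auto simp: r_def absgap_def l_def abs_minus_commute\<close>)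
    have "S (frame (r (insert x F))) = frame (hadamard n absgap (r F)) + frame (hadamard n absgap (r {x}))"
      unfolding add frame_add[OF rc rc] D(2)[OF r[OF F] e] sqrt_eigenvector[OF S e l el]
      using insert.IH insert.prems by simp
    also have "\<dots> = frame (hadamard n absgap (r F) + hadamard n absgap (r {x}))"
      by (rule frame_add[symmetric]) simp_all
    also have "hadamard n absgap (r F) + hadamard n absgap (r {x}) = hadamard n absgap (r F + r {x})"
      by (rule square_eqI[of _ n]) (use rc[of F] rc[of "{x}"] in \<open>simp_all add: distrib_left carrier_matD[OF rc]\<close>)
    finally show ?case unfolding add .
  qed
  moreover have "finite {(p, q). p < q \<and> q < n}"
    by (rule finite_subset[of _ "{..<n} \<times> {..<n}"]) auto
  ultimately have *: "S (frame (r {(p, q). p < q \<and> q < n})) = frame (hadamard n absgap (r {(p, q). p < q \<and> q < n}))"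
    by blast
  have "r {(p, q). p < q \<and> q < n} = u"
  proof (rule square_eqI[OF rc uc])
    fix i j assume ij: "i < n" "j < n"
    show "r {(p, q). p < q \<and> q < n} $$ (i, j) = u $$ (i, j)"
      using ij hollow_skew_diag[OF u] by (cases "i = j") (auto simp: r_def)
  qed
  with * show ?thesis by simp
qed

text \<open>The weights \<open>|lam_i - lam_j|\<close> are real, symmetric and nonnegative, so
  self-adjointness and positivity can be read off from the weighted double sum \<open>kap\<close>;
  restriction to the tangent space provides extensionality.\<close>

lemma sqrt_exists: "sqrt_conditions (\<lambda>U\<in>ad_image n M. frame (hadamard n absgap (coframe U)))"
proof -
  let ?S = "\<lambda>U\<in>ad_image n M. frame (hadamard n absgap (coframe U))"
  have mem: "frame u \<in> ad_image n M" if "u \<in> hollow_skew n" for u using that unfolding ad_image_frame by blast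
  have S: "?S (frame u) = frame (hadamard n absgap u)" if "u \<in> hollow_skew n" for u
    using mem[OF that] hollow_skew_carrier[OF that] by simp
  have kap: "- kappa n (hadamard n absgap u) v = 2 * real n * (\<Sum>i<n. \<Sum>j<n. \<bar>lam $ i - lam $ j\<bar> * Re (u $$ (i, j) * cnj (v $$ (i, j))))"
    if "u \<in> hollow_skew n" "v \<in> hollow_skew n" for u v
    unfolding kappa_hollow_skew[OF absgap_hollow[OF that(1)] that(2)]
    by (intro arg_cong2[where f = "(*)"] refl sum.cong) (simp_all add: absgap_def algebra_simps)
  have c: "u \<in> carrier_mat n n" if "u \<in> hollow_skew n" for u using that by (rule hollow_skew_carrier)
  show ?thesis
    unfolding sqrt_conditions_def Let_def
  proof (intro conjI ballI allI)
    show "?S \<in> ad_image n M \<rightarrow>\<^sub>E ad_image n M"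
    proof (rule PiE_I)
      fix U assume "U \<in> ad_image n M"
      then obtain u where u: "u \<in> hollow_skew n" "U = frame u" unfolding ad_image_frame by blast
      show "?S U \<in> ad_image n M" unfolding u(2) S[OF u(1)] by (rule mem[OF absgap_hollow[OF u(1)]])
    qed simp
  next
    fix U V assume "U \<in> ad_image n M" "V \<in> ad_image n M"
    then obtain u v where u: "u \<in> hollow_skew n" "U = frame u" and v: "v \<in> hollow_skew n" "V = frame v"
      unfolding ad_image_frame by blast
    have "hadamard n absgap (u + v) = hadamard n absgap u + hadamard n absgap v"
      by (rule square_eqI[of _ n]) (use c[OF u(1)] c[OF v(1)] in \<open>simp_all add: distrib_left\<close>)
    then show "?S (U + V) = ?S U + ?S V"
      unfolding u(2) v(2) frame_add[OF c[OF u(1)] c[OF v(1)], symmetric] S[OF u(1)] S[OF v(1)] S[OF hollow_add[OF u(1) v(1)]]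
      by (simp add: frame_add)
    have "- kappa n (?S U) V = - kappa n (hadamard n absgap u) v"
      unfolding u(2) v(2) S[OF u(1)] using c[OF v(1)] by (simp add: frame_kappa)
    also have "\<dots> = - kappa n (hadamard n absgap v) u"
      unfolding kap[OF u(1) v(1)] kap[OF v(1) u(1)]
      by (intro arg_cong2[where f = "(*)"] refl sum.cong) (simp_all add: algebra_simps)
    also have "\<dots> = - kappa n U (?S V)"
    proof -
      have "kappa n u (hadamard n absgap v) = kappa n (hadamard n absgap v) u"
        using tr_mult_commute[OF c[OF u(1)], of "hadamard n absgap v"] by (simp add: kappa_def mult.commute)
      then show ?thesis unfolding u(2) v(2) S[OF v(1)] using c[OF u(1)] by (simp add: frame_kappa)
    qed
    finally show "- kappa n (?S U) V = - kappa n U (?S V)" .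
  next
    fix a U assume "U \<in> ad_image n M"
    then obtain u where u: "u \<in> hollow_skew n" "U = frame u" unfolding ad_image_frame by blast
    have "hadamard n absgap (complex_of_real a \<cdot>\<^sub>m u) = complex_of_real a \<cdot>\<^sub>m hadamard n absgap u"
      by (rule square_eqI[of _ n]) (use c[OF u(1)] in simp_all)
    then show "?S (complex_of_real a \<cdot>\<^sub>m U) = complex_of_real a \<cdot>\<^sub>m ?S U"
      unfolding u(2) frame_smult[OF c[OF u(1)], symmetric] S[OF u(1)] S[OF hollow_smult[OF u(1)]]
      by (simp add: frame_smult)
  next
    fix U assume "U \<in> ad_image n M"
    then obtain u where u: "u \<in> hollow_skew n" "U = frame u" unfolding ad_image_frame by blast
    have "- kappa n (?S U) U = - kappa n (hadamard n absgap u) u"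
      unfolding u(2) S[OF u(1)] using c[OF u(1)] by (simp add: frame_kappa)
    also have "0 \<le> - kappa n (hadamard n absgap u) u"
      unfolding kap[OF u(1) u(1)] complex_norm_square[symmetric] Re_complex_of_real
      by (intro mult_nonneg_nonneg sum_nonneg) simp_all
    finally show "0 \<le> - kappa n (?S U) U" .
    show "?S (?S U) = - bracket M (bracket M U)"
      unfolding u(2) S[OF u(1)] S[OF absgap_hollow[OF u(1)]] neg_ad_square_frame[OF u(1)] by (rule refl)
  qed
qed

lemma sqrt_neg_ad_sq_frame:
  assumes "u \<in> hollow_skew n"
  shows "sqrt_neg_ad_sq n M (frame u) = frame (hadamard n absgap u)"
proof -
  have "sqrt_conditions (THE S. sqrt_conditions S)"
  proof (rule theI[of sqrt_conditions, OF sqrt_exists])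
    fix S assume S: "sqrt_conditions S"
    show "S = (\<lambda>U\<in>ad_image n M. frame (hadamard n absgap (coframe U)))"
    proof (rule extensionalityI[OF sqrt_conditionsD(6)[OF S] sqrt_conditionsD(6)[OF sqrt_exists]])
      fix U assume "U \<in> ad_image n M"
      then obtain u where u: "u \<in> hollow_skew n" "U = frame u" unfolding ad_image_frame by blast
      show "S U = (\<lambda>U\<in>ad_image n M. frame (hadamard n absgap (coframe U))) U"
        unfolding u(2) sqrt_unique[OF S u(1)] sqrt_unique[OF sqrt_exists u(1)] by (rule refl)
    qed
  qed
  from sqrt_unique[OF this assms] show ?thesis
    unfolding sqrt_neg_ad_sq_def sqrt_conditions_def .
qed

section \<open>The Kaehler gradient in the eigenbasis\<close>

lemma kaehler_metric_frame:
  assumes u: "u \<in> hollow_skew n" and v: "v \<in> hollow_skew n"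
  shows "kaehler_metric n M (frame u) (frame v) = 2 * real n * (\<Sum>i<n. \<Sum>j<n.
    Re (inverse (gap i j) * (absgap i j * u $$ (i, j)) * cnj (inverse (gap i j) * v $$ (i, j))))"
proof -
  let ?p = "\<lambda>u. hadamard n (\<lambda>i j. inverse (gap i j)) u"
  have p: "?p u \<in> hollow_skew n" if "u \<in> hollow_skew n" for u
    by (rule hadamard_hollow_skew[OF hollow_skew_skew[OF that] inverse_gap_sym]) simp
  show ?thesis
    unfolding kaehler_metric_def sqrt_neg_ad_sq_frame[OF u] normal_metric_frame[OF absgap_hollow[OF u] v]
      kappa_hollow_skew[OF p[OF absgap_hollow[OF u]] p[OF v]]
    by (intro arg_cong2[where f = "(*)"] refl sum.cong) simp_all
qed

text \<open>In the frame the metric has weight \<open>1 / |lam_i - lam_j|\<close>, and the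
  differential of the height function pairs with \<open>- \<i> A\<close> for the Hermitian matrix
  \<open>A = coframe (Diag n lam)\<close>. The gradient must therefore have off-diagonal entries
  \<open>\<i> |lam_i - lam_j| A_ij\<close>. These equal \<open>- gap i j * U_ij\<close> exactly
  because the projection multiplies \<open>A_ij\<close> by \<open>- 1\<close> above the diagonal and
  by \<open>1\<close> below it, while \<open>lam_i - lam_j\<close> is positive above and negative
  below.\<close>

lemma kaehler_gradient_frame:
  defines "U \<equiv> proj_form n (mat_adjoint h * Diag n lam * h)"
  shows "is_kaehler_gradient n (\<lambda>A. kappa n A (- \<i> \<cdot>\<^sub>m Diag n lam)) M (frame (bracket U (spectrum_diag n lam)))"
proof -
  define A where "A = coframe (Diag n lam)"
  define N where "N = - \<i> \<cdot>\<^sub>m Diag n lam"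
  have Ac: "A \<in> carrier_mat n n" by (simp add: A_def)
  have Nc: "N \<in> carrier_mat n n" by (simp add: N_def)
  have UA: "U = proj_form n A" by (simp add: U_def A_def coframe_def)
  have Uc: "U \<in> carrier_mat n n" by (simp add: UA)
  have Diag_adj: "mat_adjoint (Diag n lam) = Diag n lam" by (simp add: Diag_def mat_adjoint_diag)
  have "mat_adjoint A = A"
    using h_unitary(1) by (simp add: A_def coframe_def mat_adjoint_mult[of _ n n _ n] mult_assoc[of _ n] Diag_adj)
  then have Aij: "A $$ (i, j) = cnj (A $$ (j, i))" if "i < n" "j < n" for i j
    using mat_adjoint_index[of i A j] that Ac by simp
  have Nf: "N = frame (- \<i> \<cdot>\<^sub>m A)" by (simp add: N_def A_def frame_smult)
  define g where "g = bracket U (spectrum_diag n lam)"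
  have gh: "g = hadamard n (\<lambda>i j. - gap i j) U"
    unfolding g_def by (rule square_eqI[of _ n]) (use Uc in \<open>simp_all add: bracket_def spectrum_diag_def gap_def algebra_simps minus_carrier_mat\<close>)
  have gij: "g $$ (i, j) = - gap i j * U $$ (i, j)" if "i < n" "j < n" for i j using that by (simp add: gh)
  have ghol: "g \<in> hollow_skew n"
    unfolding gh UA by (rule hadamard_hollow_skew[OF proj_form_skew]) (simp_all add: gap_sym[symmetric])
  have metric: "kaehler_metric n M (frame g) (frame v) = kappa n (frame v) N" if v: "v \<in> hollow_skew n" for v
  proof -
    have vc: "v \<in> carrier_mat n n" using v by (rule hollow_skew_carrier)
    have "kappa n (frame v) N = 2 * real n * (\<Sum>i<n. \<Sum>j<n. Re (v $$ (i, j) * (- \<i> * A $$ (j, i))))"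
      unfolding Nf using vc Ac hollow_skew_diag[OF v] by (subst frame_kappa) (simp_all add: kappa_hollow)
    \<comment> \<open>Off the diagonal the two numbers are complex conjugates of each other; only
      their real parts agree in general.\<close>
    moreover have "Re (inverse (gap i j) * (absgap i j * g $$ (i, j)) * cnj (inverse (gap i j) * v $$ (i, j))) =
        Re (v $$ (i, j) * (- \<i> * A $$ (j, i)))" if ij: "i < n" "j < n" for i j
    proof -
      define d where "d = lam $ i - lam $ j"
      consider "i = j" | "i < j" | "j < i" by linarith
      then show ?thesis
      proof cases
        case 1
        then show ?thesis using hollow_skew_diag[OF v] ij by simp
      next
        case 2
        then have d: "0 < d" using lam ij by (auto simp: d_def strictly_decreasing_def)
        have "inverse (gap i j) * (absgap i j * g $$ (i, j)) * cnj (inverse (gap i j) * v $$ (i, j)) =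
            cnj (v $$ (i, j) * (- \<i> * A $$ (j, i)))"
          unfolding gij[OF ij] using d 2 ij
          by (simp add: gap_def absgap_def d_def[symmetric] UA proj_form_def field_simps flip: of_real_diff)
        from arg_cong[OF this, of Re] show ?thesis by (simp only: cnj.simps)
      next
        case 3
        then have d: "d < 0" using lam ij by (auto simp: d_def strictly_decreasing_def)
        have "inverse (gap i j) * (absgap i j * g $$ (i, j)) * cnj (inverse (gap i j) * v $$ (i, j)) =
            cnj (v $$ (i, j) * (- \<i> * A $$ (j, i)))"
          unfolding gij[OF ij] using d 3 ij Aij[OF ij]
          by (simp add: gap_def absgap_def d_def[symmetric] UA proj_form_def field_simps flip: of_real_diff)
        from arg_cong[OF this, of Re] show ?thesis by (simp only: cnj.simps)
      qed
    qed
    ultimately show ?thesis unfolding kaehler_metric_frame[OF ghol v]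
      by (simp only:) (intro arg_cong2[where f = "(*)"] refl sum.cong, simp_all only: lessThan_iff)
  qed
  show ?thesis
    unfolding is_kaehler_gradient_def N_def[symmetric] g_def[symmetric]
  proof (intro conjI ballI)
    show "frame g \<in> ad_image n M" using ghol unfolding ad_image_frame by blast
    fix V assume "V \<in> ad_image n M"
    then obtain v where v: "v \<in> hollow_skew n" "V = frame v" unfolding ad_image_frame by blast
    have Vc: "V \<in> carrier_mat n n" using v hollow_skew_carrier by simp
    have lin: "kappa n (M + complex_of_real s \<cdot>\<^sub>m V) N = kappa n M N + s * kappa n V N" for s
    proof -
      have "tr ((M + complex_of_real s \<cdot>\<^sub>m V) * N) = tr (M * N) + complex_of_real s * tr (V * N)"
        "tr (M + complex_of_real s \<cdot>\<^sub>m V) = tr M + complex_of_real s * tr V"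
        using M_carrier Vc Nc
        by (auto simp: tr_def index_mult_sum[of _ n n _ n] sum.distrib sum_distrib_left algebra_simps)
      then show ?thesis by (simp add: kappa_def algebra_simps)
    qed
    have "((\<lambda>s. kappa n M N + s * kappa n V N) has_real_derivative kappa n V N) (at 0)"
      by (auto intro!: derivative_eq_intros)
    then show "((\<lambda>s. kappa n (M + complex_of_real s \<cdot>\<^sub>m V) N) has_real_derivative kaehler_metric n M (frame g) V) (at 0)"
      unfolding lin unfolding v(2) metric[OF v(1)] .
  qed
qed

end

subsection \<open>The rank criterion for the Bruhat order\<close>

text \<open>The number of ones in the top left \<open>p\<close> by \<open>q\<close> block of the
  permutation matrix of \<open>w\<close>. Going up in Bruhat order lowers these counts.\<close>

definition rank_count :: "(nat \<Rightarrow> nat) \<Rightarrow> nat \<Rightarrow> nat \<Rightarrow> nat" where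
  "rank_count w p q = card {j. j < q \<and> w j < p}"

lemma rank_count_split:
  assumes "p \<le> P"
  shows "rank_count w P q = rank_count w p q + card {x. x < q \<and> p \<le> w x \<and> w x < P}"
proof -
  have "{j. j < q \<and> w j < P} = {j. j < q \<and> w j < p} \<union> {x. x < q \<and> p \<le> w x \<and> w x < P}"
    using assms by auto
  then show ?thesis unfolding rank_count_def by (simp add: card_Un_disjoint disjoint_iff)
qed

text \<open>Inversions of \<open>v\<close> inject into those of the swapped permutation: both
  positions are transposed if their order survives, and the pair is kept otherwise. The image misses
  the new inversion \<open>(j, k)\<close>, which makes the inequality strict.\<close>

lemma perm_length_transpose_less:
  assumes jk: "j < k" "k < n" "v j < v k"
  shows "perm_length n v < perm_length n (v \<circ> Transposition.transpose j k)"
proof -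
  let ?t = "Transposition.transpose j k"
  let ?I = "\<lambda>w. {(i, j). i < j \<and> j < n \<and> w j < (w i :: nat)}"
  define \<phi> where "\<phi> = (\<lambda>(a, b). if ?t a < ?t b then (?t a, ?t b) else (a, b))"
  have fin: "finite (?I w)" for w by (rule finite_subset[of _ "{..<n} \<times> {..<n}"]) auto
  have tt: "?t (?t a) = a" for a by simp
  have tn: "?t a < n \<longleftrightarrow> a < n" for a using jk by (auto simp: Transposition.transpose_def)
  have mem: "\<phi> x \<in> ?I (v \<circ> ?t) - {(j, k)}" if x: "x \<in> ?I v" for x
  proof -
    obtain a b where ab: "x = (a, b)" "a < b" "b < n" "v b < v a" using x by auto
    show ?thesis
    proof (cases "?t a < ?t b")
      case True
      have "(?t a, ?t b) \<noteq> (j, k)"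
      proof
        assume "(?t a, ?t b) = (j, k)"
        then have "?t (?t a) = ?t j" "?t (?t b) = ?t k" by simp_all
        then have "a = k" "b = j" unfolding tt by simp_all
        then show False using ab jk by simp
      qed
      then show ?thesis using ab True tn[of b] by (simp add: \<phi>_def)
    next
      case False
      then have "(a = j \<and> b < k) \<or> (b = k \<and> j < a) \<or> (a = j \<and> b = k)"
        using ab(2) jk by (auto simp: Transposition.transpose_def split: if_splits)
      moreover have "\<not> (a = j \<and> b = k)" using ab(4) jk by auto
      ultimately consider "a = j" "b < k" | "b = k" "j < a" by blast
      then show ?thesis
      proof cases
        case 1
        then show ?thesis using ab jk False by (auto simp: \<phi>_def Transposition.transpose_def)
      next
        case 2
        then show ?thesis using ab jk False by (auto simp: \<phi>_def Transposition.transpose_def)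
      qed
    qed
  qed
  have inj: "inj_on \<phi> (?I v)"
  proof (rule inj_onI)
    fix x y assume xy: "x \<in> ?I v" "y \<in> ?I v" "\<phi> x = \<phi> y"
    obtain a b c d where ab: "x = (a, b)" "a < b" and cd: "y = (c, d)" "c < d" using xy by auto
    show "x = y"
    proof (cases "?t a < ?t b")
      case True
      show ?thesis
      proof (cases "?t c < ?t d")
        case T2: True
        then have "?t a = ?t c" "?t b = ?t d" using True xy(3) ab cd by (auto simp: \<phi>_def)
        then have "?t (?t a) = ?t (?t c)" "?t (?t b) = ?t (?t d)" by simp_all
        then show ?thesis using ab cd unfolding tt by simp
      next
        case False
        then have "c = ?t a" "d = ?t b" using True xy(3) ab cd by (auto simp: \<phi>_def)
        then show ?thesis using False ab(2) tt by simp
      qed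
    next
      case F1: False
      show ?thesis
      proof (cases "?t c < ?t d")
        case True
        then have "a = ?t c" "b = ?t d" using F1 xy(3) ab cd by (auto simp: \<phi>_def)
        then show ?thesis using F1 cd(2) tt by simp
      next
        case False
        then show ?thesis using F1 xy(3) ab cd by (auto simp: \<phi>_def)
      qed
    qed
  qed
  have "\<phi> ` ?I v \<subseteq> ?I (v \<circ> ?t) - {(j, k)}" by (rule image_subsetI) (rule mem)
  from card_inj_on_le[OF inj this finite_Diff[OF fin]]
  have "card (?I v) \<le> card (?I (v \<circ> ?t) - {(j, k)})" .
  also have "\<dots> < card (?I (v \<circ> ?t))"
    by (rule card_Diff1_less[OF fin]) (use jk in simp)
  finally show ?thesis unfolding perm_length_def .
qed

lemma rank_count_transpose:
  assumes jk: "j < k" and q: "\<not> (j < q \<and> q \<le> k)"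
  shows "rank_count (v \<circ> Transposition.transpose j k) p q = rank_count v p q"
proof -
  let ?t = "Transposition.transpose j k"
  have tq: "?t x < q \<longleftrightarrow> x < q" for x using jk q by (auto simp: Transposition.transpose_def)
  have "{x. x < q \<and> v x < p} = ?t ` {x. x < q \<and> (v \<circ> ?t) x < p}"
  proof (intro equalityI subsetI)
    fix x assume "x \<in> {x. x < q \<and> v x < p}"
    then have "?t x \<in> {x. x < q \<and> (v \<circ> ?t) x < p}" using tq by simp
    from imageI[OF this, of ?t] show "x \<in> ?t ` {x. x < q \<and> (v \<circ> ?t) x < p}" by simp
  qed (use tq in auto)
  moreover have "inj_on ?t X" for X by (rule inj_on_inverseI[of _ ?t]) simp
  ultimately show ?thesis unfolding rank_count_def by (simp add: card_image)
qed

text \<open>At the first disagreement \<open>j\<close> the counts force \<open>v j < w j\<close>.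
  Swapping \<open>j\<close> with the nearest later \<open>k\<close> satisfying
  \<open>v j < v k <= w j\<close> can lower counts only for \<open>j < q <= k\<close> and
  \<open>v j < p <= v k\<close>, and there by at most one. The minimality of \<open>k\<close> and
  the entry of \<open>w\<close> at \<open>j\<close> provide a slack of one in precisely that
  rectangle.\<close>

lemma bruhat_step_exists:
  assumes v: "v permutes {..<n}" and w: "w permutes {..<n}" and ne: "v \<noteq> w"
    and N: "\<And>p q. p \<le> n \<Longrightarrow> q \<le> n \<Longrightarrow> rank_count w p q \<le> rank_count v p q"
  shows "\<exists>v'. bruhat_step n v v' \<and> v' permutes {..<n} \<and> (\<forall>p q. p \<le> n \<longrightarrow> q \<le> n \<longrightarrow> rank_count w p q \<le> rank_count v' p q)"
proof -
  have inn: "u x < n \<longleftrightarrow> x < n" if "u permutes {..<n}" for u :: "nat \<Rightarrow> nat" and x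
    using permutes_in_image[OF that, of x] by simp
  define j where "j = (LEAST j. v j \<noteq> w j)"
  have ex: "\<exists>j. v j \<noteq> w j" using ne by auto
  have j: "v j \<noteq> w j" unfolding j_def by (rule LeastI_ex[OF ex])
  have eq: "v x = w x" if "x < j" for x using not_less_Least[of x "\<lambda>j. v j \<noteq> w j"] that by (auto simp: j_def)
  have jn: "j < n"
  proof (rule ccontr)
    assume "\<not> j < n"
    then have "v j = j" "w j = j" using permutes_not_in[OF v, of j] permutes_not_in[OF w, of j] by auto
    then show False using j by simp
  qed
  have wn: "w j < n" and vn: "v j < n" using jn inn[OF w] inn[OF v] by auto
  have vj: "v j < w j"
  proof (rule ccontr)
    assume "\<not> v j < w j"
    then have gt: "w j < v j" using j by simp
    let ?P = "Suc (w j)"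
    have "{x. x < Suc j \<and> w x < ?P} = insert j {x. x < j \<and> w x < ?P}" by (auto simp: less_Suc_eq)
    then have 1: "rank_count w ?P (Suc j) = Suc (card {x. x < j \<and> w x < ?P})" by (simp add: rank_count_def)
    have "{x. x < Suc j \<and> v x < ?P} = {x. x < j \<and> w x < ?P}" using gt eq by (auto simp: less_Suc_eq)
    then have 2: "rank_count v ?P (Suc j) = card {x. x < j \<and> w x < ?P}" by (simp add: rank_count_def)
    show False using N[of ?P "Suc j"] 1 2 wn jn by simp
  qed
  define k where "k = (LEAST k. j < k \<and> v j < v k \<and> v k \<le> w j)"
  have exk: "\<exists>k. j < k \<and> v j < v k \<and> v k \<le> w j"
  proof -
    obtain k0 where k0: "v k0 = w j" using permutes_surj[OF v] by (metis surjD)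
    have "\<not> k0 < j"
    proof
      assume "k0 < j"
      then have "w k0 = w j" using eq k0 by simp
      then show False using permutes_inj[OF w] \<open>k0 < j\<close> by (auto dest: injD)
    qed
    moreover have "k0 \<noteq> j" using k0 j by auto
    ultimately show ?thesis using k0 vj by (intro exI[of _ k0]) auto
  qed
  have k: "j < k" "v j < v k" "v k \<le> w j" using LeastI_ex[OF exk] by (auto simp: k_def)
  have kmin: "\<not> (v j < v x \<and> v x \<le> w j)" if "j < x" "x < k" for x
    using not_less_Least[of x "\<lambda>k. j < k \<and> v j < v k \<and> v k \<le> w j"] that by (auto simp: k_def)
  have "v k < n" using k wn by simp
  then have kn: "k < n" using inn[OF v] by simp
  let ?t = "Transposition.transpose j k"
  let ?v = "v \<circ> ?t"
  have perm: "?v permutes {..<n}"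
    using jn kn by (intro permutes_compose[OF _ v] permutes_swap_id) auto
  have step: "bruhat_step n v ?v"
    unfolding bruhat_step_def using v jn kn k perm_length_transpose_less[OF k(1) kn k(2)] by (intro conjI exI[of _ j] exI[of _ k]) auto
  have "rank_count w p q \<le> rank_count ?v p q" if pq: "p \<le> n" "q \<le> n" for p q
  proof (cases "j < q \<and> q \<le> k")
    case False
    then show ?thesis using N[OF pq] rank_count_transpose[OF k(1) False] by simp
  next
    case True
    have vx: "?v x = v x" if "x < q" "x \<noteq> j" for x using that True by (simp add: Transposition.transpose_def)
    have vj': "?v j = v k" by simp
    show ?thesis
    proof (cases "v j < p \<and> p \<le> v k")
      case False
      then have jj: "v j < p \<longleftrightarrow> v k < p" using k(2) by linarith
      have "?v x < p \<longleftrightarrow> v x < p" if "x < q" for x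
        using vx[OF that] jj vj' by (cases "x = j") auto
      then have "{x. x < q \<and> ?v x < p} = {x. x < q \<and> v x < p}" by blast
      then show ?thesis using N[OF pq] by (simp add: rank_count_def)
    next
      case T: True
      \<comment> \<open>Counts are compared at the height just above \<open>w j\<close>. In the
        strip from \<open>p\<close> to \<open>?P\<close> and left of \<open>q\<close>,
        \<open>v\<close> has only the positions before \<open>j\<close> that it shares with
        \<open>w\<close>, while \<open>w\<close> has the position \<open>j\<close> in
        addition.\<close>
      let ?P = "Suc (w j)"
      let ?X = "{x. x < j \<and> p \<le> w x \<and> w x < ?P}"
      have pP: "p \<le> ?P" using T k(3) by simp
      have "{x. x < q \<and> p \<le> v x \<and> v x < ?P} = ?X"
      proof (intro equalityI subsetI)
        fix x assume x: "x \<in> {x. x < q \<and> p \<le> v x \<and> v x < ?P}"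
        have "\<not> j < x"
        proof
          assume "j < x"
          then show False using kmin[of x] x T True by auto
        qed
        moreover have "x \<noteq> j" using x T by auto
        ultimately show "x \<in> ?X" using x eq by auto
      next
        fix x assume "x \<in> ?X"
        then show "x \<in> {x. x < q \<and> p \<le> v x \<and> v x < ?P}" using eq True by auto
      qed
      then have 1: "rank_count v ?P q = rank_count v p q + card ?X" using rank_count_split[OF pP, of v q] by simp
      have "insert j ?X \<subseteq> {x. x < q \<and> p \<le> w x \<and> w x < ?P}" using True T k(3) by auto
      from card_mono[OF _ this] have 2: "Suc (card ?X) \<le> card {x. x < q \<and> p \<le> w x \<and> w x < ?P}" by simp
      have 3: "rank_count w ?P q = rank_count w p q + card {x. x < q \<and> p \<le> w x \<and> w x < ?P}"
        by (rule rank_count_split[OF pP])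
      have 4: "rank_count w ?P q \<le> rank_count v ?P q" using wn pq by (intro N) auto
      have "{x. x < q \<and> v x < p} \<subseteq> insert j {x. x < q \<and> ?v x < p}"
      proof
        fix x assume "x \<in> {x. x < q \<and> v x < p}"
        then have x: "x < q" "v x < p" by auto
        show "x \<in> insert j {x. x < q \<and> ?v x < p}"
        proof (cases "x = j")
          case False
          then have "?v x < p" using vx[OF x(1) False] x(2) by (simp only:)
          then show ?thesis using x(1) by blast
        qed simp
      qed
      from card_mono[OF _ this] have "rank_count v p q \<le> card (insert j {x. x < q \<and> ?v x < p})"
        unfolding rank_count_def by simp
      also have "\<dots> \<le> Suc (rank_count ?v p q)" unfolding rank_count_def by (rule card_insert_le_m1) simp_all
      finally show ?thesis using 1 2 3 4 by linarith
    qed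
  qed
  then show ?thesis using step perm by blast
qed

text \<open>Every exchange raises the length, which is at most \<open>n * n\<close>, so the
  exchanges end, and they can only end at \<open>w\<close>.\<close>

theorem bruhat_le_of_rank:
  assumes v: "v permutes {..<n}" and w: "w permutes {..<n}"
    and N: "\<And>p q. p \<le> n \<Longrightarrow> q \<le> n \<Longrightarrow> rank_count w p q \<le> rank_count v p q"
  shows "bruhat_le n v w"
proof -
  have bound: "perm_length n u \<le> n * n" for u
  proof -
    have "perm_length n u \<le> card ({..<n} \<times> {..<n})"
      unfolding perm_length_def by (rule card_mono) auto
    then show ?thesis by simp
  qed
  have "(bruhat_step n)\<^sup>*\<^sup>* v w"
    using v N
  proof (induction "n * n - perm_length n v" arbitrary: v rule: less_induct)
    case less
    show ?case
    proof (cases "v = w")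
      case False
      from bruhat_step_exists[OF less.prems(1) w False less.prems(2)] obtain v' where
        v': "bruhat_step n v v'" "v' permutes {..<n}"
        "\<And>p q. p \<le> n \<Longrightarrow> q \<le> n \<Longrightarrow> rank_count w p q \<le> rank_count v' p q" by blast
      have "n * n - perm_length n v' < n * n - perm_length n v"
      proof (rule diff_less_mono2)
        show "perm_length n v < perm_length n v'" using v'(1) unfolding bruhat_step_def by blast
        then show "perm_length n v < n * n" using bound[of v'] by (rule less_le_trans)
      qed
      then have "(bruhat_step n)\<^sup>*\<^sup>* v' w" by (rule less.hyps[OF _ v'(2)]) (rule v'(3))
      with v'(1) show ?thesis by (rule converse_rtranclp_into_rtranclp)
    qed simp
  qed
  then show ?thesis using v w by (simp add: bruhat_le_def)
qed

subsection \<open>Bruhat decomposition\<close>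

definition perm_mat :: "nat \<Rightarrow> (nat \<Rightarrow> nat) \<Rightarrow> complex mat" where
  "perm_mat n w = mat n n (\<lambda>(i, j). if i = w j then 1 else 0)"

lemma perm_mat_carrier [simp]: "perm_mat n w \<in> carrier_mat n n"
  by (simp add: perm_mat_def)

lemma perm_mat_index [simp]: "i < n \<Longrightarrow> j < n \<Longrightarrow> perm_mat n w $$ (i, j) = (if i = w j then 1 else 0)"
  by (simp add: perm_mat_def)

text \<open>Triangularity with respect to either direction of the order on the indices, so that both
  Bruhat decompositions are instances of a single elimination.\<close>

definition tri :: "(nat \<Rightarrow> nat \<Rightarrow> bool) \<Rightarrow> nat \<Rightarrow> complex mat set" where
  "tri R n = {a \<in> carrier_mat n n. det a \<noteq> 0 \<and> (\<forall>i<n. \<forall>j<n. R j i \<longrightarrow> a $$ (i, j) = 0)}"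

text \<open>The third clause supplies the pivot row of an elimination step; applied to singletons it
  also yields irreflexivity.\<close>

definition elimination_order :: "(nat \<Rightarrow> nat \<Rightarrow> bool) \<Rightarrow> bool" where
  "elimination_order R \<longleftrightarrow> (\<forall>x y z. R x y \<longrightarrow> R y z \<longrightarrow> R x z) \<and> (\<forall>x y. x \<noteq> y \<longrightarrow> R x y \<or> R y x) \<and>
    (\<forall>X. finite X \<longrightarrow> X \<noteq> {} \<longrightarrow> (\<exists>r\<in>X. \<forall>i\<in>X. \<not> R r i))"

lemma elimination_orderD:
  assumes "elimination_order R"
  shows "R x y \<Longrightarrow> R y z \<Longrightarrow> R x z" "x \<noteq> y \<Longrightarrow> R x y \<or> R y x"
    "finite X \<Longrightarrow> X \<noteq> {} \<Longrightarrow> \<exists>r\<in>X. \<forall>i\<in>X. \<not> R r i"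
proof -
  note D = assms[unfolded elimination_order_def]
  show "R x y \<Longrightarrow> R y z \<Longrightarrow> R x z" by (rule D[THEN conjunct1, rule_format])
  show "x \<noteq> y \<Longrightarrow> R x y \<or> R y x" by (rule D[THEN conjunct2, THEN conjunct1, rule_format])
  show "finite X \<Longrightarrow> X \<noteq> {} \<Longrightarrow> \<exists>r\<in>X. \<forall>i\<in>X. \<not> R r i"
    by (rule D[THEN conjunct2, THEN conjunct2, rule_format])
qed

lemma elimination_order_less: "elimination_order (<)"
proof -
  have "\<exists>r\<in>X. \<forall>i\<in>X. \<not> r < i" if "finite X" "X \<noteq> {}" for X :: "nat set"
    using that by (intro bexI[of _ "Max X"]) (auto simp: not_less)
  note ext = this
  show ?thesis
    unfolding elimination_order_def
  proof (intro conjI allI impI)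
    fix x y z :: nat assume "x < y" "y < z"
    then show "x < z" by simp
  next
    fix x y :: nat assume "x \<noteq> y"
    then show "x < y \<or> y < x" by linarith
  next
    fix X :: "nat set" assume "finite X" "X \<noteq> {}"
    then show "\<exists>r\<in>X. \<forall>i\<in>X. \<not> r < i" by (rule ext)
  qed
qed

lemma elimination_order_greater: "elimination_order (>)"
proof -
  have "\<exists>r\<in>X. \<forall>i\<in>X. \<not> i < r" if "finite X" "X \<noteq> {}" for X :: "nat set"
    using that by (intro bexI[of _ "Min X"]) (auto simp: not_less)
  note ext = this
  show ?thesis
    unfolding elimination_order_def
  proof (intro conjI allI impI)
    fix x y z :: nat assume "y < x" "z < y"
    then show "z < x" by simp
  next
    fix x y :: nat assume "x \<noteq> y"
    then show "y < x \<or> x < y" by linarith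
  next
    fix X :: "nat set" assume "finite X" "X \<noteq> {}"
    then show "\<exists>r\<in>X. \<forall>i\<in>X. \<not> i < r" by (rule ext)
  qed
qed

lemma tri_mult:
  assumes "elimination_order R" and a: "a \<in> tri R n" and b: "b \<in> tri R n"
  shows "a * b \<in> tri R n"
proof -
  note R = elimination_orderD[OF assms(1)]
  have c: "a \<in> carrier_mat n n" "b \<in> carrier_mat n n" "det a \<noteq> 0" "det b \<noteq> 0" using a b by (auto simp: tri_def)
  have "(a * b) $$ (i, j) = 0" if ij: "i < n" "j < n" "R j i" for i j
  proof -
    have "a $$ (i, k) * b $$ (k, j) = 0" if "k \<in> {..<n}" for k
    proof (cases "R k i \<or> R j k")
      case True
      then show ?thesis using a b ij that by (auto simp: tri_def)
    next
      case False
      then have "R i k \<or> i = k" "R k j \<or> k = j" using R(2)[of i k] R(2)[of k j] by auto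
      then have "R k i \<or> R j k" using ij(3) R(1)[of j i k] by auto
      with False show ?thesis by simp
    qed
    then show ?thesis unfolding index_mult_sum[OF c(1,2) ij(1,2)] by (rule sum.neutral[OF ballI])
  qed
  then show ?thesis using c det_mult[OF c(1,2)] by (simp add: tri_def)
qed

lemma tri_upper_borel: "tri (<) n = upper_borel n"
  by (auto simp: tri_def upper_borel_def upper_triangular_def invertible_mat_iff_det)

lemma tri_lower_borel: "tri (>) n = lower_borel n"
  by (auto simp: tri_def lower_borel_def upper_triangular_def invertible_mat_iff_det)

text \<open>Column operations \<open>u\<close> clear the entries of column \<open>k\<close> in rows
  that already carry a one. Among the remaining nonzero entries the pivot row \<open>r\<close> is
  extremal for \<open>R\<close>, which makes the clearing matrix \<open>L\<close> triangular in the
  sense of \<open>R\<close>. Earlier columns survive because they vanish in row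
  \<open>r\<close>.\<close>

lemma bruhat_column_step:
  assumes R: "elimination_order R"
    and X: "X \<in> carrier_mat n n" "det X \<noteq> 0" and k: "k < n" and w: "inj_on w {..<k}" "w ` {..<k} \<subseteq> {..<n}"
    and cols': "\<forall>i<n. \<forall>j<k. X $$ (i, j) = (if i = w j then 1 else 0)"
  shows "\<exists>L\<in>tri R n. \<exists>u\<in>tri (<) n. \<exists>Y\<in>carrier_mat n n. \<exists>r<n. r \<notin> w ` {..<k} \<and> X = L * Y * u \<and>
    (\<forall>i<n. \<forall>j<Suc k. Y $$ (i, j) = (if i = (w(k := r)) j then 1 else 0))"
proof -
  have cols: "X $$ (i, j) = (if i = w j then 1 else 0)" if "i < n" "j < k" for i j using cols' that by blast
  have Rm: "\<exists>r\<in>X. \<forall>i\<in>X. \<not> R r i" if "finite X" "X \<noteq> {}" for X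
    by (rule elimination_orderD(3)[OF R that])
  define y where "y i = (if i \<in> w ` {..<k} then 0 else X $$ (i, k))" for i
  define X1 where "X1 = mat n n (\<lambda>(i, j). if j = k then y i else X $$ (i, j))"
  define u where "u = mat n n (\<lambda>(i, j). if j = k \<and> i < k then X $$ (w i, k) else if i = j then 1 else (0 :: complex))"
  have X1c: "X1 \<in> carrier_mat n n" and uc: "u \<in> carrier_mat n n" by (simp_all add: X1_def u_def)
  have Xu: "X = X1 * u"
  proof (rule square_eqI[OF X(1)])
    show "X1 * u \<in> carrier_mat n n" using X1c uc by simp
    fix i j assume ij: "i < n" "j < n"
    have "(X1 * u) $$ (i, j) = (\<Sum>l<n. X1 $$ (i, l) * u $$ (l, j))" by (rule index_mult_sum[OF X1c uc ij])
    also have "\<dots> = X $$ (i, j)"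
    proof (cases "j = k")
      case False
      have "(\<Sum>l<n. X1 $$ (i, l) * u $$ (l, j)) = (\<Sum>l<n. if l = j then X $$ (i, j) else 0)"
        by (rule sum.cong) (use False ij in \<open>auto simp: X1_def u_def\<close>)
      then show ?thesis using ij by simp
    next
      case True
      have "(\<Sum>l<n. X1 $$ (i, l) * u $$ (l, j)) = (\<Sum>l\<in>{..<Suc k}. X1 $$ (i, l) * u $$ (l, j))"
        by (rule sum.mono_neutral_right) (use True k ij in \<open>auto simp: u_def\<close>)
      also have "\<dots> = (\<Sum>l<k. if i = w l then X $$ (i, k) else 0) + y i"
        using True k ij cols by (auto simp: X1_def u_def intro!: sum.cong)
      also have "(\<Sum>l<k. if i = w l then X $$ (i, k) else 0) = (if i \<in> w ` {..<k} then X $$ (i, k) else 0)"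
      proof (cases "i \<in> w ` {..<k}")
        case True
        then obtain l0 where l0: "l0 < k" "i = w l0" by auto
        have "(\<Sum>l<k. if i = w l then X $$ (i, k) else 0) = (\<Sum>l<k. if l = l0 then X $$ (i, k) else 0)"
          by (rule sum.cong) (use l0 w(1) in \<open>auto simp: inj_on_def\<close>)
        then show ?thesis using l0 True by simp
      qed (auto intro!: sum.neutral)
      finally show ?thesis using True by (simp add: y_def)
    qed
    finally show "X $$ (i, j) = (X1 * u) $$ (i, j)" by simp
  qed
  have "det X1 \<noteq> 0" and detu: "det u \<noteq> 0" using X(2) det_mult[OF X1c uc] unfolding Xu by auto
  have "{i. i < n \<and> y i \<noteq> 0} \<noteq> {}"
  proof
    assume "{i. i < n \<and> y i \<noteq> 0} = {}"
    then have "X1 $$ (i, k) = 0" if "i < n" for i using that k by (auto simp: X1_def)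
    then have "det X1 = 0" unfolding laplace_expansion_column[OF X1c k] by simp
    then show False using \<open>det X1 \<noteq> 0\<close> by simp
  qed
  from Rm[OF _ this] obtain r where r: "r < n" "y r \<noteq> 0" and rmax: "\<And>i. i < n \<Longrightarrow> y i \<noteq> 0 \<Longrightarrow> \<not> R r i" by auto
  have rw: "r \<notin> w ` {..<k}" using r by (auto simp: y_def)
  define Y where "Y = mat n n (\<lambda>(i, j). if i = r then X1 $$ (r, j) / y r else X1 $$ (i, j) - y i / y r * X1 $$ (r, j))"
  define L where "L = mat n n (\<lambda>(i, j). if j = r then y i else if i = j then 1 else 0)"
  have Yc: "Y \<in> carrier_mat n n" and Lc: "L \<in> carrier_mat n n" by (simp_all add: Y_def L_def)
  have LY: "X1 = L * Y"
  proof (rule square_eqI[OF X1c])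
    show "L * Y \<in> carrier_mat n n" using Lc Yc by simp
    fix i j assume ij: "i < n" "j < n"
    have "(L * Y) $$ (i, j) = (\<Sum>l<n. L $$ (i, l) * Y $$ (l, j))" by (rule index_mult_sum[OF Lc Yc ij])
    also have "\<dots> = (\<Sum>l<n. (if l = r then y i * Y $$ (r, j) else 0) + (if l = i then (if i = r then 0 else Y $$ (i, j)) else 0))"
      by (rule sum.cong) (use ij r in \<open>auto simp: L_def\<close>)
    also have "\<dots> = y i * Y $$ (r, j) + (if i = r then 0 else Y $$ (i, j))"
      using ij r by (simp add: sum.distrib)
    also have "\<dots> = X1 $$ (i, j)" using ij r by (auto simp: Y_def)
    finally show "X1 $$ (i, j) = (L * Y) $$ (i, j)" by simp
  qed
  have detL: "det L \<noteq> 0" using \<open>det X1 \<noteq> 0\<close> det_mult[OF Lc Yc] unfolding LY by auto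
  have irr: "\<not> R x x" for x using Rm[of "{x}"] by auto
  have "L \<in> tri R n"
    using Lc detL rmax irr by (auto simp: tri_def L_def)
  moreover have "u \<in> tri (<) n" using uc detu by (auto simp: tri_def u_def)
  moreover have "X = L * Y * u" using Xu LY by simp
  moreover have "Y $$ (i, j) = (if i = (w(k := r)) j then 1 else 0)" if ij: "i < n" "j < Suc k" for i j
  proof (cases "j = k")
    case True
    then show ?thesis using ij r k by (auto simp: Y_def X1_def)
  next
    case False
    then have jk: "j < k" using ij by simp
    then have "X1 $$ (l, j) = (if l = w j then 1 else 0)" if "l < n" for l using that cols k by (simp add: X1_def)
    moreover have "r \<noteq> w j" using rw jk by auto
    ultimately show ?thesis using ij r jk k by (auto simp: Y_def)
  qed
  ultimately show ?thesis using Yc r(1) rw by blast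
qed

lemma bruhat_decomposition:
  assumes R: "elimination_order R"
    and g: "g \<in> carrier_mat n n" "det g \<noteq> 0"
  shows "\<exists>a\<in>tri R n. \<exists>b\<in>tri (<) n. \<exists>w. w permutes {..<n} \<and> g = a * perm_mat n w * b"
proof -
  have irr: "\<not> R x x" for x
    using elimination_orderD(3)[OF R, of "{x}"] by simp
  have "\<exists>a\<in>tri R n. \<exists>b\<in>tri (<) n. \<exists>X\<in>carrier_mat n n. \<exists>w. g = a * X * b \<and> inj_on w {..<k} \<and> w ` {..<k} \<subseteq> {..<n} \<and>
      (\<forall>i<n. \<forall>j<k. X $$ (i, j) = (if i = w j then 1 else 0))" if "k \<le> n" for k
    using that
  proof (induction k)
    case 0
    have "1\<^sub>m n \<in> tri R n" "1\<^sub>m n \<in> tri (<) n" using irr by (auto simp: tri_def)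
    then show ?case using g by (intro bexI[of _ "1\<^sub>m n"] bexI[of _ g]) auto
  next
    case (Suc k)
    from Suc.IH[OF Suc_leD[OF Suc.prems]] obtain a b X w where
      a: "a \<in> tri R n" and b: "b \<in> tri (<) n" and X: "X \<in> carrier_mat n n" and gX: "g = a * X * b"
      and w: "inj_on w {..<k}" "w ` {..<k} \<subseteq> {..<n}"
      and cols: "\<forall>i<n. \<forall>j<k. X $$ (i, j) = (if i = w j then 1 else 0)"
      by blast
    have k: "k < n" using Suc by simp
    have ac: "a \<in> carrier_mat n n" and bc: "b \<in> carrier_mat n n" using a b by (auto simp: tri_def)
    have "det X \<noteq> 0" using g(2) unfolding gX using ac bc X by (auto simp: det_mult[of _ n])
    from bruhat_column_step[OF R X this k w cols] obtain L u Y r where L: "L \<in> tri R n" and u: "u \<in> tri (<) n"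
      and Y: "Y \<in> carrier_mat n n" and r: "r < n" "r \<notin> w ` {..<k}" and XY: "X = L * Y * u"
      and Ycols: "\<forall>i<n. \<forall>j<Suc k. Y $$ (i, j) = (if i = (w(k := r)) j then 1 else 0)" by blast
    have Lc: "L \<in> carrier_mat n n" and uc: "u \<in> carrier_mat n n" using L u by (auto simp: tri_def)
    have "g = (a * L) * Y * (u * b)" unfolding gX XY using ac bc Lc uc Y by (simp add: mult_assoc[of _ n])
    moreover have "a * L \<in> tri R n" by (rule tri_mult[OF R a L])
    moreover have "u * b \<in> tri (<) n" by (rule tri_mult[OF elimination_order_less u b])
    moreover have "inj_on (w(k := r)) {..<Suc k}"
    proof -
      have "{..<Suc k} = insert k {..<k}" by auto
      moreover have "inj_on (w(k := r)) {..<k}" using w(1) by (auto simp: inj_on_def)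
      moreover have "(w(k := r)) ` {..<k} = w ` {..<k}" by auto
      ultimately show ?thesis using r(2) by (simp del: fun_upd_apply) simp
    qed
    moreover have "(w(k := r)) ` {..<Suc k} \<subseteq> {..<n}" using w(2) r(1) by (auto simp: less_Suc_eq image_subset_iff)
    ultimately show ?case using Y Ycols by blast
  qed
  from this[of n] obtain a b X w where a: "a \<in> tri R n" and b: "b \<in> tri (<) n" and X: "X \<in> carrier_mat n n"
    and gX: "g = a * X * b" and w: "inj_on w {..<n}" "w ` {..<n} \<subseteq> {..<n}"
    and cols: "\<And>i j. i < n \<Longrightarrow> j < n \<Longrightarrow> X $$ (i, j) = (if i = w j then 1 else 0)" by auto
  \<comment> \<open>The matrix determines \<open>w\<close> only below \<open>n\<close>; the identity
    elsewhere makes it a permutation of \<open>{..<n}\<close>.\<close>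
  define w' where "w' i = (if i < n then w i else i)" for i
  have "inj_on w' {..<n}" using w(1) by (auto simp: w'_def inj_on_def)
  moreover have "w' ` {..<n} \<subseteq> {..<n}" using w(2) by (auto simp: w'_def image_subset_iff)
  ultimately have "bij_betw w' {..<n} {..<n}"
    unfolding bij_betw_def using endo_inj_surj[of "{..<n}" w'] by blast
  then have perm: "w' permutes {..<n}" by (rule bij_imp_permutes) (simp add: w'_def)
  have "X = perm_mat n w'" by (rule square_eqI[OF X]) (auto simp: cols w'_def)
  then show ?thesis using a b gX perm by blast
qed


section \<open>The two Bruhat decompositions and the Borel subgroups\<close>

lemma bruhat_upper:
  assumes "g \<in> carrier_mat n n" "det g \<noteq> 0"
  shows "\<exists>a\<in>upper_borel n. \<exists>b\<in>upper_borel n. \<exists>w. w permutes {..<n} \<and> g = a * perm_mat n w * b"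
  unfolding tri_upper_borel[symmetric]
  by (rule bruhat_decomposition[OF elimination_order_less assms])

lemma bruhat_lower:
  assumes "g \<in> carrier_mat n n" "det g \<noteq> 0"
  shows "\<exists>a\<in>lower_borel n. \<exists>b\<in>upper_borel n. \<exists>w. w permutes {..<n} \<and> g = a * perm_mat n w * b"
  unfolding tri_upper_borel[symmetric] tri_lower_borel[symmetric]
  by (rule bruhat_decomposition[OF elimination_order_greater assms])

lemma upper_borelD:
  assumes "b \<in> upper_borel n"
  shows "b \<in> carrier_mat n n" "upper_triangular b" "det b \<noteq> 0" "i < n \<Longrightarrow> b $$ (i, i) \<noteq> 0"
proof -
  show c: "b \<in> carrier_mat n n" "upper_triangular b" using assms by (auto simp: upper_borel_def)
  show d: "det b \<noteq> 0" using assms invertible_mat_iff_det[OF c(1)] by (auto simp: upper_borel_def)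
  show "i < n \<Longrightarrow> b $$ (i, i) \<noteq> 0" using d unfolding upper_triangular_det[OF c] by auto
qed

lemma upper_borel_inverse:
  assumes b: "b \<in> upper_borel n"
  obtains c where "c \<in> upper_borel n" "b * c = 1\<^sub>m n" "c * b = 1\<^sub>m n"
proof -
  note B = upper_borelD[OF b]
  obtain c where c: "c \<in> carrier_mat n n" "b * c = 1\<^sub>m n" "c * b = 1\<^sub>m n"
    using det_nonzero_inverse[OF B(1,3)] by metis
  have "upper_triangular (c * b)" unfolding c(3) by simp
  from upper_triangular_factor(1)[OF c(1) B(1,2,4) this] have "upper_triangular c" .
  moreover have "det c \<noteq> 0" using inverse_det_nonzero[OF c(1) B(1) c(3)] .
  ultimately have "c \<in> upper_borel n" using c invertible_mat_iff_det[OF c(1)] by (simp add: upper_borel_def)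
  then show thesis using that c by blast
qed

lemma upper_borel_mult: "a \<in> upper_borel n \<Longrightarrow> b \<in> upper_borel n \<Longrightarrow> a * b \<in> upper_borel n"
  unfolding tri_upper_borel[symmetric] by (rule tri_mult[OF elimination_order_less])

lemma lower_borel_transpose: "a \<in> lower_borel n \<longleftrightarrow> a \<in> carrier_mat n n \<and> transpose_mat a \<in> upper_borel n"
  using det_transpose[of a n]
  by (auto simp: lower_borel_def upper_borel_def invertible_mat_iff_det[of _ n])

lemma lower_borel_mult: "a \<in> lower_borel n \<Longrightarrow> b \<in> lower_borel n \<Longrightarrow> a * b \<in> lower_borel n"
  unfolding tri_lower_borel[symmetric] by (rule tri_mult[OF elimination_order_greater])

lemma lower_borel_inverse:
  assumes b: "b \<in> lower_borel n"
  obtains c where "c \<in> lower_borel n" "b * c = 1\<^sub>m n" "c * b = 1\<^sub>m n"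
proof -
  have bc: "b \<in> carrier_mat n n" and bt: "transpose_mat b \<in> upper_borel n" using b by (auto simp: lower_borel_transpose)
  from upper_borel_inverse[OF bt] obtain c where c: "c \<in> upper_borel n" "transpose_mat b * c = 1\<^sub>m n" "c * transpose_mat b = 1\<^sub>m n" .
  have cc: "c \<in> carrier_mat n n" using upper_borelD[OF c(1)] by simp
  have "transpose_mat c * b = 1\<^sub>m n"
    using transpose_mult[of "transpose_mat b" n n c n] c(2) cc bc by simp
  moreover have "b * transpose_mat c = 1\<^sub>m n"
    using transpose_mult[of c n n "transpose_mat b" n] c(3) cc bc by simp
  moreover have "transpose_mat c \<in> lower_borel n" using c(1) cc by (simp add: lower_borel_transpose)
  ultimately show thesis using that by blast
qed

lemma lower_upper_leading_minor:
  assumes l: "l \<in> lower_borel n" and u: "u \<in> upper_borel n" and p: "p \<le> n"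
  shows "left_minor (l * u) p (\<lambda>i. i) \<noteq> 0"
proof -
  note U = upper_borelD[OF u]
  have lc: "l \<in> carrier_mat n n" and lt: "transpose_mat l \<in> upper_borel n" using l by (auto simp: lower_borel_transpose)
  have lz: "l $$ (i, j) = 0" if "i < j" "j < n" for i j
    using upper_borelD(2)[OF lt] lc that by (auto simp: upper_triangular_def)
  have ld: "l $$ (i, i) \<noteq> 0" if "i < n" for i using upper_borelD(4)[OF lt that] lc that by simp
  have rc: "row_choice n p (\<lambda>i. i)" using p by (simp add: row_choice_def)
  let ?l = "mat p p (\<lambda>(i, j). l $$ (i, j))"
  have "det ?l = prod_list (diag_mat ?l)"
    by (rule det_lower_triangular[of p]) (use lz p in auto)
  also have "\<dots> = (\<Prod>i<p. l $$ (i, i))" by (simp add: prod_list_diag_prod atLeast0LessThan)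
  finally have "left_minor l p (\<lambda>i. i) \<noteq> 0" unfolding left_minor_def using ld p by auto
  moreover have "(\<Prod>j<p. u $$ (j, j)) \<noteq> 0" using U(4) p by auto
  ultimately show ?thesis unfolding left_minor_mult_upper[OF lc U(1,2) rc] by simp
qed

lemma perm_mat_mult_index:
  assumes "w permutes {..<n}" "A \<in> carrier_mat n n" "i < n" "j < n"
  shows "(perm_mat n w * A) $$ (w i, j) = A $$ (i, j)" and "(A * perm_mat n w) $$ (i, j) = A $$ (i, w j)"
proof -
  have wn: "w x < n" if "x < n" for x using permutes_in_image[OF assms(1), of x] that by simp
  have inj: "w x = w y \<longleftrightarrow> x = y" for x y using permutes_inj[OF assms(1)] by (auto dest: injD)
  have "(perm_mat n w * A) $$ (w i, j) = (\<Sum>k<n. if k = i then A $$ (i, j) else 0)"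
    unfolding index_mult_sum[OF perm_mat_carrier assms(2) wn[OF assms(3)] assms(4)]
    by (rule sum.cong) (use assms wn inj in auto)
  then show "(perm_mat n w * A) $$ (w i, j) = A $$ (i, j)" using assms by simp
  have "(A * perm_mat n w) $$ (i, j) = (\<Sum>k<n. if k = w j then A $$ (i, w j) else 0)"
    unfolding index_mult_sum[OF assms(2) perm_mat_carrier assms(3,4)]
    by (rule sum.cong) (use assms wn in auto)
  then show "(A * perm_mat n w) $$ (i, j) = A $$ (i, w j)" using assms wn by simp
qed

lemma rank_count_inv:
  assumes w: "w permutes {..<n}"
  shows "rank_count (inv_into UNIV w) p q = rank_count w q p"
proof -
  let ?A = "{x. x < q \<and> inv_into UNIV w x < p}" and ?B = "{x. x < p \<and> w x < q}"
  have "?A = w ` ?B"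
  proof (intro equalityI subsetI)
    fix x assume "x \<in> ?A"
    then have "inv_into UNIV w x \<in> ?B" "x = w (inv_into UNIV w x)" using permutes_inverses[OF w] by auto
    then show "x \<in> w ` ?B" by blast
  qed (use permutes_inverses[OF w] in auto)
  then show ?thesis using card_image[OF inj_on_subset[OF permutes_inj[OF w] subset_UNIV], of ?B] by (simp add: rank_count_def)
qed

text \<open>A nonzero leading minor of \<open>a\<^sup>-\<^sup>1 a'\<close> has a nonzero Leibniz term, which is a bijection
  comparing \<open>v\<^sup>-\<^sup>1\<close> and \<open>w\<^sup>-\<^sup>1\<close> pointwise.\<close>

lemma bruhat_le_of_intersection:
  assumes v: "v permutes {..<n}" and w: "w permutes {..<n}"
    and a: "a \<in> lower_borel n" and b: "b \<in> upper_borel n" and a': "a' \<in> upper_borel n" and b': "b' \<in> upper_borel n"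
    and eq: "a * perm_mat n v * b = a' * perm_mat n w * b'"
  shows "bruhat_le n v w"
proof (rule bruhat_le_of_rank[OF v w])
  fix p q assume pq: "p \<le> n" "q \<le> n"
  obtain ai where ai: "ai \<in> lower_borel n" "ai * a = 1\<^sub>m n" using lower_borel_inverse[OF a] by metis
  obtain bi where bi: "bi \<in> upper_borel n" "b' * bi = 1\<^sub>m n" using upper_borel_inverse[OF b'] by metis
  have c: "a \<in> carrier_mat n n" "b \<in> carrier_mat n n" "a' \<in> carrier_mat n n" "b' \<in> carrier_mat n n"
    "ai \<in> carrier_mat n n" "bi \<in> carrier_mat n n"
    using a b a' b' ai bi by (auto simp: lower_borel_def upper_borel_def)
  \<comment> \<open>Moving the outer factors across turns the equation into
    \<open>perm_mat n v * u = Z * perm_mat n w\<close>. So \<open>Z\<close> is \<open>u\<close> with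
    permuted rows and columns, while as a lower times an upper triangular matrix it has nonzero
    leading minors.\<close>
  define u where "u = b * bi"
  define Z where "Z = ai * a'"
  have u: "u \<in> upper_borel n" unfolding u_def by (rule upper_borel_mult[OF b bi(1)])
  have uc: "u \<in> carrier_mat n n" and Zc: "Z \<in> carrier_mat n n" using c by (simp_all add: u_def Z_def)
  have "ai * (a * perm_mat n v * b) * bi = ai * (a' * perm_mat n w * b') * bi" unfolding eq by (rule refl)
  moreover have "ai * (a * perm_mat n v * b) * bi = (ai * a) * (perm_mat n v * u)"
    using c by (simp add: u_def mult_assoc[of _ n])
  moreover have "ai * (a' * perm_mat n w * b') * bi = Z * perm_mat n w * (b' * bi)"
    using c by (simp add: Z_def mult_assoc[of _ n])
  ultimately have PZ: "perm_mat n v * u = Z * perm_mat n w" using ai(2) bi(2) uc Zc by simp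
  note V = permutes_inverses[OF v] and W = permutes_inverses[OF w]
  have invn: "inv_into UNIV v x < n" "inv_into UNIV w x < n" if "x < n" for x
    using permutes_in_image[OF permutes_inv[OF v], of x] permutes_in_image[OF permutes_inv[OF w], of x] that by auto
  have Zu: "Z $$ (i, j) = u $$ (inv_into UNIV v i, inv_into UNIV w j)" if ij: "i < n" "j < n" for i j
  proof -
    have "(perm_mat n v * u) $$ (v (inv_into UNIV v i), inv_into UNIV w j) = u $$ (inv_into UNIV v i, inv_into UNIV w j)"
      by (rule perm_mat_mult_index(1)[OF v uc invn(1)[OF ij(1)] invn(2)[OF ij(2)]])
    moreover have "(Z * perm_mat n w) $$ (i, inv_into UNIV w j) = Z $$ (i, w (inv_into UNIV w j))"
      by (rule perm_mat_mult_index(2)[OF w Zc ij(1) invn(2)[OF ij(2)]])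
    ultimately show ?thesis using PZ V(1) W(1) by simp
  qed
  have "left_minor Z p (\<lambda>i. i) \<noteq> 0" unfolding Z_def by (rule lower_upper_leading_minor[OF ai(1) a' pq(1)])
  then have "(\<Sum>\<sigma> | \<sigma> permutes {0..<p}. of_int (sign \<sigma>) * (\<Prod>i = 0..<p. mat p p (\<lambda>(i, j). Z $$ (i, j)) $$ (i, \<sigma> i))) \<noteq> 0"
    unfolding left_minor_def by (subst (asm) det_def'[of _ p]) simp_all
  from sum.not_neutral_contains_not_neutral[OF this] obtain \<sigma> where \<sigma>: "\<sigma> permutes {0..<p}"
    and "of_int (sign \<sigma>) * (\<Prod>i = 0..<p. mat p p (\<lambda>(i, j). Z $$ (i, j)) $$ (i, \<sigma> i)) \<noteq> 0" by blast
  then have nz: "(\<Prod>i = 0..<p. mat p p (\<lambda>(i, j). Z $$ (i, j)) $$ (i, \<sigma> i)) \<noteq> 0" by (metis mult_zero_right)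
  have \<sigma>p: "\<sigma> i < p \<longleftrightarrow> i < p" for i using permutes_in_image[OF \<sigma>, of i] by simp
  have le: "inv_into UNIV v i \<le> inv_into UNIV w (\<sigma> i)" if i: "i < p" for i
  proof (rule ccontr)
    assume "\<not> inv_into UNIV v i \<le> inv_into UNIV w (\<sigma> i)"
    then have "u $$ (inv_into UNIV v i, inv_into UNIV w (\<sigma> i)) = 0"
      using upper_borelD(2)[OF u] uc invn i pq(1) by (auto simp: upper_triangular_def)
    moreover have "i < n" "\<sigma> i < n" "\<sigma> i < p" using i \<sigma>p[of i] pq(1) by auto
    ultimately have "mat p p (\<lambda>(i, j). Z $$ (i, j)) $$ (i, \<sigma> i) = 0" using Zu[of i "\<sigma> i"] i by simp
    then show False using nz i by auto
  qed
  \<comment> \<open>By the pointwise inequality, an index counted for the inverse of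
    \<open>w\<close> comes through \<open>\<sigma>\<close> from one counted for the inverse of
    \<open>v\<close>.\<close>
  have "{x. x < p \<and> inv_into UNIV w x < q} \<subseteq> \<sigma> ` {x. x < p \<and> inv_into UNIV v x < q}"
  proof
    fix x assume x: "x \<in> {x. x < p \<and> inv_into UNIV w x < q}"
    define i where "i = inv_into UNIV \<sigma> x"
    have xi: "x = \<sigma> i" unfolding i_def using permutes_inverses(1)[OF \<sigma>] by simp
    then have "i < p" using x \<sigma>p by simp
    moreover have "inv_into UNIV v i < q" using le[OF \<open>i < p\<close>] x xi by simp
    ultimately show "x \<in> \<sigma> ` {x. x < p \<and> inv_into UNIV v x < q}" using xi by blast
  qed
  from card_mono[OF _ this] have "rank_count (inv_into UNIV w) q p \<le> card (\<sigma> ` {x. x < p \<and> inv_into UNIV v x < q})"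
    unfolding rank_count_def by simp
  also have "\<dots> \<le> rank_count (inv_into UNIV v) q p" unfolding rank_count_def by (rule card_image_le) simp
  finally show "rank_count w p q \<le> rank_count v p q" unfolding rank_count_inv[OF w] rank_count_inv[OF v] .
qed

subsection \<open>Signed permutation matrices\<close>

lemma row_choice_image_unique:
  assumes f: "row_choice n k f" and f': "row_choice n k f'" and im: "f ` {..<k} = f' ` {..<k}" and "i < k"
  shows "f i = f' i"
proof -
  have sd: "sorted (map f [0..<k])" "distinct (map f [0..<k])" if f: "row_choice n k f" for f
  proof -
    show "sorted (map f [0..<k])"
      unfolding sorted_iff_nth_mono using row_choice_less[OF f] by (auto simp: le_less)
    show "distinct (map f [0..<k])"
      using row_choice_inj[OF f] by (simp add: distinct_map atLeast0LessThan)
  qed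
  have "map f [0..<k] = map f' [0..<k]"
    by (rule sorted_distinct_set_unique[OF sd(1)[OF f] sd(2)[OF f] sd(1)[OF f'] sd(2)[OF f']])
      (use im in \<open>simp add: atLeast0LessThan\<close>)
  then show ?thesis using \<open>i < k\<close> by simp
qed

lemma left_minor_cong: "(\<And>i. i < k \<Longrightarrow> f i = f' i) \<Longrightarrow> left_minor A k f = left_minor A k f'"
  unfolding left_minor_def by (intro arg_cong[where f = det] eq_matI) auto

lemma perm_mat_unitary:
  assumes w: "w permutes {..<n}"
  shows "perm_mat n w \<in> unitary_group n"
proof (rule unitary_groupI)
  have wn: "w x < n" if "x < n" for x using permutes_in_image[OF w, of x] that by simp
  have inj: "w x = w y \<longleftrightarrow> x = y" for x y using permutes_inj[OF w] by (auto dest: injD)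
  show "mat_adjoint (perm_mat n w) * perm_mat n w = 1\<^sub>m n"
  proof (rule square_eqI[of _ n])
    fix i j assume ij: "i < n" "j < n"
    have "(mat_adjoint (perm_mat n w) * perm_mat n w) $$ (i, j) = mat_adjoint (perm_mat n w) $$ (i, w j)"
      by (rule perm_mat_mult_index(2)[OF w _ ij]) simp
    also have "\<dots> = (if w j = w i then 1 else 0)"
      using ij wn by (subst mat_adjoint_index) (auto simp: perm_mat_def)
    finally show "(mat_adjoint (perm_mat n w) * perm_mat n w) $$ (i, j) = 1\<^sub>m n $$ (i, j)"
      using ij inj by simp
  qed simp_all
qed simp

text \<open>A chosen row outside \<open>w\<close> applied to the first \<open>k\<close> indices is
  zero in the first \<open>k\<close> columns. Hence for each size only one row set gives a nonzero
  flag minor.\<close>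

lemma perm_mat_minor_image:
  assumes w: "w permutes {..<n}" and f: "row_choice n k f" and nz: "left_minor (perm_mat n w) k f \<noteq> 0"
  shows "f ` {..<k} = w ` {..<k}"
proof -
  have kn: "k \<le> n" using row_choice_le[OF f] .
  let ?M = "mat k k (\<lambda>(i, j). perm_mat n w $$ (f i, j))"
  have "f i \<in> w ` {..<k}" if i: "i < k" for i
  proof (rule ccontr)
    assume "f i \<notin> w ` {..<k}"
    then have "?M $$ (i, j) = 0" if "j < k" for j
      using that i kn row_choice_bound[OF f i] by auto
    then have "det ?M = 0"
      using laplace_expansion_row[of ?M k i] i by simp
    then show False using nz by (simp add: left_minor_def)
  qed
  then have "f ` {..<k} \<subseteq> w ` {..<k}" by auto
  moreover have "card (f ` {..<k}) = card (w ` {..<k})"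
    using card_image[OF row_choice_inj[OF f]] card_image[OF inj_on_subset[OF permutes_inj[OF w] subset_UNIV], of "{..<k}"] by simp
  ultimately show ?thesis by (intro card_subset_eq) auto
qed

lemma perm_mat_minor_real:
  assumes f: "row_choice n k f"
  shows "left_minor (perm_mat n w) k f \<in> \<real>"
proof -
  have kn: "k \<le> n" using row_choice_le[OF f] .
  have "left_minor (perm_mat n w) k f =
      (\<Sum>p | p permutes {0..<k}. of_int (sign p) * (\<Prod>i = 0..<k. mat k k (\<lambda>(i, j). perm_mat n w $$ (f i, j)) $$ (i, p i)))"
    unfolding left_minor_def by (rule det_def') simp
  also have "\<dots> \<in> \<real>"
  proof (intro sum_in_Reals Reals_mult prod_in_Reals)
    fix p i assume "p \<in> {p. p permutes {0..<k}}" "i \<in> {0..<k}"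
    then have "p i < k" "i < k" using permutes_in_image[of p "{0..<k}" i] by auto
    then show "mat k k (\<lambda>(i, j). perm_mat n w $$ (f i, j)) $$ (i, p i) \<in> \<real>"
      using row_choice_bound[OF f] kn by simp
  qed simp
  finally show ?thesis .
qed

text \<open>Only one flag minor of each size \<open>k\<close> is nonzero; let \<open>s k\<close> be
  its sign. With \<open>d j = s (Suc j) * s j\<close> the product of the first \<open>k\<close>
  signs telescopes to \<open>s k\<close>, which corrects that minor.\<close>

lemma signed_perm_mat_exists:
  assumes w: "w permutes {..<n}"
  shows "\<exists>d. (\<forall>j. d j \<in> {1, - 1}) \<and> tnn_flag n (perm_mat n w * mat_diag n d)"
proof -
  let ?P = "perm_mat n w"
  have "det ?P \<noteq> 0" using unitary_groupD(4)[OF perm_mat_unitary[OF w]] .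
  then have "\<forall>k. \<exists>f. k \<le> n \<longrightarrow> row_choice n k f \<and> left_minor ?P k f \<noteq> 0"
    using exists_nonzero_left_minor[OF perm_mat_carrier] by blast
  then obtain F where F: "\<And>k. k \<le> n \<Longrightarrow> row_choice n k (F k)" "\<And>k. k \<le> n \<Longrightarrow> left_minor ?P k (F k) \<noteq> 0" by metis
  define m where "m k = left_minor ?P k (F k)" for k
  define s where "s k = (if 0 < m k then 1 else - 1 :: complex)" for k
  define d where "d j = s (Suc j) * s j" for j
  have ss: "s k * s k = 1" "s k \<in> {1, - 1}" for k by (auto simp: s_def)
  have s0: "s 0 = 1" by (simp add: s_def m_def left_minor_def less_complex_def)
  have ms: "0 \<le> m k * s k" if "k \<le> n" for k
    using perm_mat_minor_real[OF F(1)[OF that], of w] F(2)[OF that]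
    by (auto simp: s_def m_def less_complex_def less_eq_complex_def complex_is_Real_iff complex_eq_iff)
  have prod: "(\<Prod>j<k. d j) = s k" for k
  proof (induction k)
    case (Suc k)
    have "(\<Prod>j<Suc k. d j) = s k * (s (Suc k) * s k)" using Suc by (simp add: d_def)
    also have "\<dots> = (s k * s k) * s (Suc k)" by (simp only: mult.commute mult.left_commute)
    finally show ?case unfolding ss by simp
  qed (simp add: s0)
  have "tnn_flag n (?P * mat_diag n d)"
    unfolding tnn_flag_def
  proof (intro allI impI)
    fix k f assume f: "row_choice n k f"
    have kn: "k \<le> n" using row_choice_le[OF f] .
    have "left_minor (?P * mat_diag n d) k f = left_minor ?P k f * (\<Prod>j<k. mat_diag n d $$ (j, j))"
      by (rule left_minor_mult_upper[OF perm_mat_carrier _ _ f]) (auto simp: upper_triangular_def)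
    also have "(\<Prod>j<k. mat_diag n d $$ (j, j)) = (\<Prod>j<k. d j)" using kn by (intro prod.cong) auto
    finally have eq: "left_minor (?P * mat_diag n d) k f = left_minor ?P k f * s k" unfolding prod .
    show "0 \<le> left_minor (?P * mat_diag n d) k f"
    proof (cases "left_minor ?P k f = 0")
      case False
      have "f ` {..<k} = F k ` {..<k}"
        using perm_mat_minor_image[OF w f False] perm_mat_minor_image[OF w F(1)[OF kn] F(2)[OF kn]] by simp
      then have "left_minor ?P k f = m k"
        unfolding m_def by (intro left_minor_cong row_choice_image_unique[OF f F(1)[OF kn]])
      then show ?thesis using eq ms[OF kn] by simp
    qed (simp add: eq)
  qed
  moreover have "d j \<in> {1, - 1}" for j using ss(2)[of j] ss(2)[of "Suc j"] by (auto simp: d_def)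
  ultimately show ?thesis by blast
qed

text \<open>Two candidates differ by a diagonal matrix of signs on the right, which
  \<open>unimodular_diag_one\<close> shows to be trivial. So the definite description is met, and it
  equals \<open>perm_mat n w\<close> up to signs of columns.\<close>

lemma signed_perm_mat_eq:
  assumes w: "w permutes {..<n}"
  shows "\<exists>d. (\<forall>j. d j \<in> {1, - 1}) \<and> signed_perm_mat n w = perm_mat n w * mat_diag n d"
proof -
  obtain d where d: "\<And>j. d j \<in> {1, - 1}" and tnn: "tnn_flag n (perm_mat n w * mat_diag n d)"
    using signed_perm_mat_exists[OF w] by blast
  have wn: "w x < n" if "x < n" for x using permutes_in_image[OF w, of x] that by simp
  let ?P = "perm_mat n w" and ?A = "perm_mat n w * mat_diag n d"
  have Ac: "?A \<in> carrier_mat n n" by simp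
  have dd: "d j * d j = 1" for j using d[of j] by auto
  have detA: "det ?A \<noteq> 0"
  proof -
    have "mat_diag n d * mat_diag n d = 1\<^sub>m n" by (simp add: dd)
    then have "det (mat_diag n d) \<noteq> 0" by (intro inverse_det_nonzero[of _ n "mat_diag n d"]) simp_all
    then show ?thesis
      using unitary_groupD(4)[OF perm_mat_unitary[OF w]] det_mult[of ?P n "mat_diag n d"] by simp
  qed
  have "signed_perm_mat n w = ?A"
    unfolding signed_perm_mat_def
  proof (rule the_equality)
    show "?A \<in> carrier_mat n n \<and> (\<forall>i<n. \<forall>j<n. if i = w j then ?A $$ (i, j) \<in> {1, - 1} else ?A $$ (i, j) = 0) \<and> left_minors_nonneg n ?A"
      using left_minors_nonneg_iff[OF Ac] tnn d by (auto simp: index_mult_diag[of _ n n])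
  next
    fix B assume B: "B \<in> carrier_mat n n \<and> (\<forall>i<n. \<forall>j<n. if i = w j then B $$ (i, j) \<in> {1, - 1} else B $$ (i, j) = 0) \<and> left_minors_nonneg n B"
    then have Bc: "B \<in> carrier_mat n n" and Bt: "tnn_flag n B" using left_minors_nonneg_iff by blast+
    have B1: "B $$ (w j, j) \<in> {1, - 1}" if "j < n" for j using B wn[OF that] that by (metis (full_types))
    have B0: "B $$ (i, j) = 0" if "i < n" "j < n" "i \<noteq> w j" for i j using B that by (metis (full_types))
    define e where "e j = d j * B $$ (w j, j)" for j
    have Be: "B = ?A * mat_diag n e"
    proof (rule square_eqI[OF Bc])
      fix i j assume ij: "i < n" "j < n"
      have "(?A * mat_diag n e) $$ (i, j) = ?A $$ (i, j) * e j" by (rule index_mult_diag[OF Ac ij])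
      also have "\<dots> = ?P $$ (i, j) * d j * (d j * B $$ (w j, j))"
        unfolding index_mult_diag[OF perm_mat_carrier ij] e_def by (rule refl)
      also have "\<dots> = ?P $$ (i, j) * (d j * d j) * B $$ (w j, j)" by (simp only: mult.assoc)
      also have "\<dots> = B $$ (i, j)" unfolding dd using ij B0[OF ij] by auto
      finally show "B $$ (i, j) = (?A * mat_diag n e) $$ (i, j)" by simp
    qed simp
    have "e i = 1" if "i < n" for i
    proof (rule unimodular_diag_one[OF Ac detA tnn _ _ that])
      show "cmod (e i) = 1" if "i < n" for i using d[of i] B1[OF that] by (auto simp: e_def)
      show "tnn_flag n (?A * mat_diag n e)" using Bt Be by simp
    qed
    then have "mat_diag n e = 1\<^sub>m n" by (intro square_eqI[of _ n]) auto
    then show "B = ?A" using Be Ac by simp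
  qed
  then show ?thesis using d by blast
qed

section \<open>Locating orbit points in cells\<close>

lemma diag_upper_borel:
  assumes "\<And>i. i < n \<Longrightarrow> d i \<noteq> 0"
  shows "mat_diag n d \<in> upper_borel n"
proof -
  have up: "upper_triangular (mat_diag n d)" by (auto simp: upper_triangular_def)
  have "det (mat_diag n d) \<noteq> 0"
    unfolding upper_triangular_det[OF mat_diag_dim up] using assms by simp
  then show ?thesis using up invertible_mat_iff_det[OF mat_diag_dim] by (simp add: upper_borel_def)
qed

lemma perm_mat_signed:
  assumes w: "w permutes {..<n}"
  shows "\<exists>D\<in>upper_borel n. perm_mat n w = signed_perm_mat n w * D \<and> signed_perm_mat n w \<in> carrier_mat n n"
proof -
  obtain d where d: "\<And>j. d j \<in> {1, - 1}" and s: "signed_perm_mat n w = perm_mat n w * mat_diag n d"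
    using signed_perm_mat_eq[OF w] by blast
  have dd: "d j * d j = 1" for j using d[of j] by auto
  have "signed_perm_mat n w * mat_diag n d = perm_mat n w * (mat_diag n d * mat_diag n d)"
    unfolding s by (rule mult_assoc[of _ n]) simp_all
  also have "\<dots> = perm_mat n w" by (simp add: dd)
  finally have "perm_mat n w = signed_perm_mat n w * mat_diag n d" by simp
  moreover have "d j \<noteq> 0" for j using d[of j] by auto
  then have "mat_diag n d \<in> upper_borel n" by (rule diag_upper_borel)
  ultimately show ?thesis using s by (intro bexI[of _ "mat_diag n d"]) auto
qed

text \<open>The pair \<open>(v, w)\<close> is read off from the two Bruhat decompositions of
  \<open>g0\<close>; that both hold for one matrix gives comparability. Any \<open>g\<close>
  obtained from \<open>g0\<close> by triangular factors as stated stays in both double cosets, and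
  column signs are absorbed into the right factor.\<close>

lemma cell_exists:
  assumes g0: "g0 \<in> unitary_nonneg n"
  obtains v w where "bruhat_le n v w"
    "\<And>g l u d e. g \<in> unitary_nonneg n \<Longrightarrow> l \<in> lower_borel n \<Longrightarrow> u \<in> upper_borel n \<Longrightarrow> d \<in> upper_borel n \<Longrightarrow>
      e \<in> upper_borel n \<Longrightarrow> g = l * g0 * d \<Longrightarrow> g = u * g0 * e \<Longrightarrow> orbit_point n lam g \<in> cell n lam v w"
proof -
  note G = unitary_groupD[of g0 n]
  have gu: "g0 \<in> unitary_group n" using g0 by (simp add: unitary_nonneg_iff)
  obtain a b v where a: "a \<in> lower_borel n" and b: "b \<in> upper_borel n" and v: "v permutes {..<n}" and g1: "g0 = a * perm_mat n v * b"
    using bruhat_lower[OF G(1)[OF gu] G(4)[OF gu]] by blast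
  obtain a' b' w where a': "a' \<in> upper_borel n" and b': "b' \<in> upper_borel n" and w: "w permutes {..<n}" and g2: "g0 = a' * perm_mat n w * b'"
    using bruhat_upper[OF G(1)[OF gu] G(4)[OF gu]] by blast
  obtain D where D: "D \<in> upper_borel n" "perm_mat n v = signed_perm_mat n v * D" and sv: "signed_perm_mat n v \<in> carrier_mat n n"
    using perm_mat_signed[OF v] by blast
  obtain D' where D': "D' \<in> upper_borel n" "perm_mat n w = signed_perm_mat n w * D'" and sw: "signed_perm_mat n w \<in> carrier_mat n n"
    using perm_mat_signed[OF w] by blast
  have lc: "l \<in> carrier_mat n n" if "l \<in> lower_borel n" for l using that by (simp add: lower_borel_def)
  have uc: "l \<in> carrier_mat n n" if "l \<in> upper_borel n" for l using that by (simp add: upper_borel_def)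
  have le: "bruhat_le n v w"
    by (rule bruhat_le_of_intersection[OF v w a b a' b']) (use g1 g2 in simp)
  show thesis
  proof (rule that[OF le])
    fix g l u d e
    assume g: "g \<in> unitary_nonneg n" and l: "l \<in> lower_borel n" and u: "u \<in> upper_borel n" and d: "d \<in> upper_borel n"
      and e: "e \<in> upper_borel n" and gl: "g = l * g0 * d" and gr: "g = u * g0 * e"
    have "g = (l * a) * signed_perm_mat n v * (D * b * d)"
      unfolding gl g1 D(2) using lc[OF l] lc[OF a] uc[OF D(1)] uc[OF b] uc[OF d] sv by (simp add: mult_assoc[of _ n])
    moreover have "l * a \<in> lower_borel n" "D * b * d \<in> upper_borel n"
      by (intro lower_borel_mult l a) (intro upper_borel_mult D(1) b d)
    ultimately have 1: "g \<in> {a * signed_perm_mat n v * b | a b. a \<in> lower_borel n \<and> b \<in> upper_borel n}" by blast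
    have "g = (u * a') * signed_perm_mat n w * (D' * b' * e)"
      unfolding gr g2 D'(2) using uc[OF u] uc[OF a'] uc[OF D'(1)] uc[OF b'] uc[OF e] sw by (simp add: mult_assoc[of _ n])
    moreover have "u * a' \<in> upper_borel n" "D' * b' * e \<in> upper_borel n"
      by (intro upper_borel_mult u a') (intro upper_borel_mult D'(1) b' e)
    ultimately have 2: "g \<in> {a * signed_perm_mat n w * b | a b. a \<in> upper_borel n \<and> b \<in> upper_borel n}" by blast
    show "orbit_point n lam g \<in> cell n lam v w"
      unfolding cell_def using g 1 2 by blast
  qed
qed

lemma pos_upper_borel: "c \<in> pos_upper n \<Longrightarrow> c \<in> upper_borel n"
  using pos_upper_det[of c n] invertible_mat_iff_det[of c n] by (simp add: pos_upper_def upper_borel_def)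

lemma pos_upper_adjoint_borel:
  assumes c: "c \<in> pos_upper n"
  shows "mat_adjoint c \<in> lower_borel n"
proof -
  have cc: "c \<in> carrier_mat n n" using c by (simp add: pos_upper_def)
  let ?t = "transpose_mat (mat_adjoint c)"
  have tc: "?t \<in> carrier_mat n n" using cc by simp
  have e: "?t $$ (i, j) = cnj (c $$ (i, j))" if "i < n" "j < n" for i j using cc that by simp
  have "0 < ?t $$ (i, i)" if "i < n" for i
    using c e[OF that that] that by (auto simp: pos_upper_def less_complex_def)
  moreover have "upper_triangular ?t" using c tc e by (auto simp: pos_upper_def upper_triangular_def)
  ultimately have "?t \<in> pos_upper n" using tc by (simp add: pos_upper_def)
  then show ?thesis using pos_upper_borel cc by (simp add: lower_borel_transpose)
qed

lemma exp_diag_upper_borel: "exp_diag n lam t \<in> upper_borel n"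
  unfolding exp_diag_def by (rule diag_upper_borel) simp

text \<open>Cancelling unitary factors in \<open>h c = exp(t \<Lambda>) h0\<close> gives the adjoint
  of \<open>h\<close> with \<open>c\<close> on its left; taking adjoints first gives it with the
  inverse of the adjoint of \<open>c\<close>, which is lower triangular. Conjugation by
  \<open>delta\<close> preserves triangularity and fixes diagonal matrices.\<close>

lemma flow_factorizations:
  assumes h: "h \<in> unitary_group n" and h0: "h0 \<in> unitary_group n" and c: "c \<in> pos_upper n"
    and hc: "h * c = exp_diag n lam t * h0"
  shows "\<exists>u\<in>upper_borel n. dconj n (mat_adjoint h) = u * dconj n (mat_adjoint h0) * exp_diag n lam (- t)"
    and "\<exists>l\<in>lower_borel n. dconj n (mat_adjoint h) = l * dconj n (mat_adjoint h0) * exp_diag n lam t"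
proof -
  note H = unitary_groupD[OF h] and H0 = unitary_groupD[OF h0]
  have cc: "c \<in> carrier_mat n n" using c by (simp add: pos_upper_def)
  have dE: "dconj n (exp_diag n lam s) = exp_diag n lam s" for s by (simp add: exp_diag_def)
  have "mat_adjoint h * (h * c) * mat_adjoint h0 * exp_diag n lam (- t) = (mat_adjoint h * h) * (c * (mat_adjoint h0 * exp_diag n lam (- t)))"
    using H(1) H0(1) cc by (simp add: mult_assoc[of _ n])
  also have "\<dots> = c * mat_adjoint h0 * exp_diag n lam (- t)" using H(3) H0(1) cc by (simp add: mult_assoc[of _ n])
  finally have 1: "mat_adjoint h * (h * c) * mat_adjoint h0 * exp_diag n lam (- t) = c * mat_adjoint h0 * exp_diag n lam (- t)" .
  have "mat_adjoint h * (exp_diag n lam t * h0) * mat_adjoint h0 * exp_diag n lam (- t) =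
      mat_adjoint h * (exp_diag n lam t * ((h0 * mat_adjoint h0) * exp_diag n lam (- t)))"
    using H(1) H0(1) by (simp add: mult_assoc[of _ n])
  also have "\<dots> = mat_adjoint h"
    using H(1) H0(2) exp_diag_inverse[of n lam "- t"] by simp
  finally have "mat_adjoint h = c * mat_adjoint h0 * exp_diag n lam (- t)" using 1 unfolding hc by simp
  then have "dconj n (mat_adjoint h) = dconj n c * dconj n (mat_adjoint h0) * exp_diag n lam (- t)"
    using H0(1) cc by (simp add: dconj_mult dE)
  then show "\<exists>u\<in>upper_borel n. dconj n (mat_adjoint h) = u * dconj n (mat_adjoint h0) * exp_diag n lam (- t)"
    using pos_upper_borel[OF dconj_pos_upper[OF c]] by blast
  have "mat_adjoint c * mat_adjoint h = mat_adjoint h0 * exp_diag n lam t"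
    using arg_cong[OF hc, of mat_adjoint] H(1) H0(1) cc by (simp add: mat_adjoint_mult[of _ n n _ n] exp_diag_adjoint)
  from arg_cong[OF this, of "dconj n"]
  have e: "dconj n (mat_adjoint c) * dconj n (mat_adjoint h) = dconj n (mat_adjoint h0) * exp_diag n lam t"
    using H(1) H0(1) cc by (simp add: dconj_mult dE)
  have "mat_adjoint (dconj n c) \<in> lower_borel n" by (rule pos_upper_adjoint_borel[OF dconj_pos_upper[OF c]])
  then have "dconj n (mat_adjoint c) \<in> lower_borel n" using cc by (simp add: dconj_adjoint)
  from lower_borel_inverse[OF this] obtain l where l: "l \<in> lower_borel n" "l * dconj n (mat_adjoint c) = 1\<^sub>m n" by metis
  have lc: "l \<in> carrier_mat n n" using l(1) by (simp add: lower_borel_def)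
  have "l * (dconj n (mat_adjoint c) * dconj n (mat_adjoint h)) = (l * dconj n (mat_adjoint c)) * dconj n (mat_adjoint h)"
    using lc cc H(1) by (simp add: mult_assoc[of _ n])
  then have "dconj n (mat_adjoint h) = l * (dconj n (mat_adjoint h0) * exp_diag n lam t)"
    unfolding e l(2) using H(1) by simp
  then have "dconj n (mat_adjoint h) = l * dconj n (mat_adjoint h0) * exp_diag n lam t"
    using lc H0(1) by (simp add: mult_assoc[of _ n])
  then show "\<exists>l\<in>lower_borel n. dconj n (mat_adjoint h) = l * dconj n (mat_adjoint h0) * exp_diag n lam t"
    using l(1) by blast
qed

subsection \<open>The flow on the orbit\<close>

lemma skew_adjoint: "U \<in> skew_hermitian n \<Longrightarrow> mat_adjoint U = - U"
  by (simp add: skew_hermitian_def)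

lemma uminus_mult_bracket:
  fixes A B C :: "complex mat"
  assumes "A \<in> carrier_mat n n" "B \<in> carrier_mat n n"
  shows "- A * B + B * A = bracket B A"
  by (rule square_eqI[of _ n])
    (use assms in \<open>simp_all add: bracket_def index_mult_sum[of _ n n _ n] sum_negf minus_carrier_mat\<close>)

text \<open>With \<open>P = mat_adjoint h * spectrum_diag n lam * h\<close> and
  \<open>h' = h U\<close> one gets \<open>P' = [P, U]\<close>, and \<open>U\<close> is the
  projection of \<open>- \<i> P\<close>. Since the projection and the bracket both commute with sign
  conjugation, the equation carries over to \<open>dconj n P\<close>.\<close>

lemma toda_derivative:
  assumes h: "\<And>t. h t \<in> unitary_group n"
    and dh: "has_mat_derivative n h (h t * U) t" and U: "U = proj_form n (mat_adjoint (h t) * Diag n lam * h t)"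
  shows "has_mat_derivative n (\<lambda>t. orbit_point n lam (dconj n (mat_adjoint (h t))))
    (bracket (orbit_point n lam (dconj n (mat_adjoint (h t))))
      (proj_u n (- \<i> \<cdot>\<^sub>m orbit_point n lam (dconj n (mat_adjoint (h t)))))) t"
proof -
  let ?S = "spectrum_diag n lam"
  note H = unitary_groupD[OF h]
  define P where "P t = mat_adjoint (h t) * ?S * h t" for t
  have Pc: "P t \<in> carrier_mat n n" for t using H(1)[of t] by (simp add: P_def)
  have Uc: "U \<in> carrier_mat n n" and Us: "U \<in> skew_hermitian n" unfolding U by (simp_all add: proj_form_skew)
  have L: "orbit_point n lam (dconj n (mat_adjoint (h t))) = dconj n (P t)" for t
    unfolding P_def by (rule orbit_point_dconj_adjoint[OF h])
  have "has_mat_derivative n P (mat_adjoint (h t * U) * ?S * h t + mat_adjoint (h t) * ?S * (h t * U)) t"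
    unfolding P_def
    by (rule has_mat_derivative_mult[OF has_mat_derivative_right_mult[OF has_mat_derivative_adjoint[OF dh H(1)]] dh])
      (use H(1) in simp_all)
  also have "mat_adjoint (h t * U) * ?S * h t + mat_adjoint (h t) * ?S * (h t * U) = - U * P t + P t * U"
  proof -
    have "- (U * mat_adjoint (h t)) * (?S * h t) = - (U * mat_adjoint (h t) * (?S * h t))"
      by (rule square_eqI[of _ n]) (use H(1)[of t] Uc in \<open>simp_all add: index_mult_sum[of _ n n _ n] sum_negf\<close>)
    then show ?thesis
      using H(1)[of t] Uc by (simp add: P_def mat_adjoint_mult[of _ n n _ n] mult_assoc[of _ n] skew_adjoint[OF Us])
  qed
  also have "\<dots> = bracket (P t) U" by (rule uminus_mult_bracket[OF Uc Pc])
  finally have dP: "has_mat_derivative n P (bracket (P t) U) t" .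
  have "- \<i> \<cdot>\<^sub>m dconj n (P t) = dconj n (mat_adjoint (h t) * Diag n lam * h t)"
  proof -
    have "?S = \<i> \<cdot>\<^sub>m Diag n lam" by (rule spectrum_diag_eq[symmetric])
    then have "P t = \<i> \<cdot>\<^sub>m (mat_adjoint (h t) * Diag n lam * h t)"
      using H(1)[of t] by (simp add: P_def mult_smult_distrib[of _ n n _ n] mult_smult_assoc_mat[of _ n n _ n])
    then show ?thesis using H(1)[of t] by (intro square_eqI[of _ n]) (simp_all add: algebra_simps)
  qed
  then have "proj_u n (- \<i> \<cdot>\<^sub>m dconj n (P t)) = dconj n U"
    using proj_u_eq[of "dconj n (mat_adjoint (h t) * Diag n lam * h t)" n] H(1)[of t]
      proj_form_dconj[of "mat_adjoint (h t) * Diag n lam * h t" n] U by simp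
  then have "bracket (dconj n (P t)) (proj_u n (- \<i> \<cdot>\<^sub>m dconj n (P t))) = dconj n (bracket (P t) U)"
    using dconj_bracket[OF Pc Uc] by simp
  then show ?thesis unfolding L using has_mat_derivative_dconj[OF dP Pc] by simp
qed

text \<open>The same curve \<open>h\<close> acts here from the other side: differentiating
  \<open>h S mat_adjoint h\<close>, with \<open>S\<close> the fixed spectrum, brings out
  \<open>[U, S]\<close> conjugated by \<open>h\<close>, the form in which the Kaehler gradient was
  computed.\<close>

lemma gradient_derivative:
  assumes lam: "strictly_decreasing lam" "lam \<in> carrier_vec n" and h: "\<And>t. h t \<in> unitary_group n"
    and dh: "has_mat_derivative n h (h t * U) t" and Us: "U \<in> skew_hermitian n"
  shows "has_mat_derivative n (\<lambda>t. orbit_point n lam (h t)) (frame (h t) (bracket U (spectrum_diag n lam))) t"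
proof -
  let ?S = "spectrum_diag n lam"
  note H = unitary_groupD[OF h]
  have Uc: "U \<in> carrier_mat n n" using Us by (rule skew_hermitian_carrier)
  have "has_mat_derivative n (\<lambda>t. h t * ?S * mat_adjoint (h t))
      (h t * U * ?S * mat_adjoint (h t) + h t * ?S * mat_adjoint (h t * U)) t"
    by (rule has_mat_derivative_mult[OF has_mat_derivative_right_mult[OF dh] has_mat_derivative_adjoint[OF dh H(1)]])
      (use H(1) in simp_all)
  also have "h t * U * ?S * mat_adjoint (h t) + h t * ?S * mat_adjoint (h t * U) =
      h t * (U * ?S + ?S * (- U)) * mat_adjoint (h t)"
    using H(1)[of t] Uc
    by (simp add: mat_adjoint_mult[of _ n n _ n] mult_assoc[of _ n] skew_adjoint[OF Us]
        mult_add_distrib_mat[of _ n n _ n] add_mult_distrib_mat[of _ n n _ _ n])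
  also have "U * ?S + ?S * (- U) = bracket U ?S"
  proof (rule square_eqI[of _ n])
    fix i j assume ij: "i < n" "j < n"
    have "- U \<in> carrier_mat n n" using Uc by simp
    then show "(U * ?S + ?S * (- U)) $$ (i, j) = bracket U ?S $$ (i, j)"
      using carrier_matD[OF Uc] carrier_matD[OF spectrum_diag_carrier[of n lam]] ij index_mult_sum[of ?S n n "- U" n]
        index_mult_sum[of ?S n n U n] Uc
      by (simp add: bracket_def sum_negf)
  qed (use Uc in \<open>simp_all add: bracket_def minus_carrier_mat\<close>)
  finally show ?thesis
    unfolding orbit_point_eq[OF h] frame_def[OF lam h orbit_point_eq[OF h]] .
qed

theorem theorem8p6:
  fixes n :: nat and lam :: "real Matrix.vec" and N :: "complex mat"
  assumes "lam \<in> carrier_vec n"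
    and "strictly_decreasing lam"
    and "N = - \<i> \<cdot>\<^sub>m Diag n lam"
  shows "(\<forall>L0 L. L0 \<in> orbit_nonneg n lam \<longrightarrow> toda_flow n L0 L \<longrightarrow>
            (\<forall>t. L t \<in> orbit_nonneg n lam) \<and>
            (\<exists>C\<in>cells n lam. \<forall>t. L t \<in> C))
       \<and> (\<forall>L0 L. L0 \<in> orbit_nonneg n lam \<longrightarrow> toda_flow n L0 L \<longrightarrow>
            twist n lam L0 \<in> orbit_nonneg n lam \<and>
            kaehler_gradient_flow n lam N (twist n lam L0) (\<lambda>t. twist n lam (L t)))"
proof -
  note lam = assms(2,1)
  have main: "((\<forall>t. L t \<in> orbit_nonneg n lam) \<and> (\<exists>C\<in>cells n lam. \<forall>t. L t \<in> C)) \<and>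
      twist n lam L0 \<in> orbit_nonneg n lam \<and>
      kaehler_gradient_flow n lam N (twist n lam L0) (\<lambda>t. twist n lam (L t))"
    if L0: "L0 \<in> orbit_nonneg n lam" and L: "toda_flow n L0 L" for L0 L
  proof -
    from L0 obtain g0 where g0: "g0 \<in> unitary_nonneg n" and L0g: "L0 = orbit_point n lam g0"
      by (auto simp: orbit_nonneg_def)
    \<comment> \<open>The representative of the twisted initial point. Sign-conjugated adjunction is
      an involution, so \<open>g0\<close> is recovered from it in the same way.\<close>
    define h0 where "h0 = dconj n (mat_adjoint g0)"
    have h0nn: "h0 \<in> unitary_nonneg n" unfolding h0_def by (rule dconj_adjoint_nonneg[OF g0])
    then have h0: "h0 \<in> unitary_group n" and h0t: "tnn_flag n h0" by (auto simp: unitary_nonneg_iff)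
    have g0u: "g0 \<in> unitary_group n" using g0 by (simp add: unitary_nonneg_iff)
    have g0h: "dconj n (mat_adjoint h0) = g0"
      using unitary_groupD(1)[OF g0u] by (simp add: h0_def dconj_adjoint)
    obtain h c where h: "\<And>t. h t \<in> unitary_group n" and c: "\<And>t. c t \<in> pos_upper n"
      and hc: "\<And>t. h t * c t = exp_diag n lam t * h0" and h00: "h 0 = h0"
      and dh: "\<And>t. has_mat_derivative n h (h t * proj_form n (mat_adjoint (h t) * Diag n lam * h t)) t"
      using qr_flow[OF h0, of lam] by blast
    \<comment> \<open>The entries \<open>exp (t lam_i)\<close> are positive for every real
      \<open>t\<close>, which settles both time directions at once.\<close>
    have "tnn_flag n (h t)" for t
    proof (rule tnn_flag_qr[OF unitary_groupD(1)[OF h] c])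
      show "tnn_flag n (h t * c t)"
        unfolding hc exp_diag_def
        by (rule tnn_flag_diag_mult[OF unitary_groupD(1)[OF h0] h0t]) (simp add: less_eq_complex_def)
    qed
    then have hnn: "h t \<in> unitary_nonneg n" for t using h by (simp add: unitary_nonneg_iff)
    define g where "g t = dconj n (mat_adjoint (h t))" for t
    have gnn: "g t \<in> unitary_nonneg n" for t unfolding g_def by (rule dconj_adjoint_nonneg[OF hnn])
    have "toda_flow n L0 (\<lambda>t. orbit_point n lam (g t))"
      unfolding toda_flow_def
    proof (intro conjI allI)
      show "orbit_point n lam (g 0) = L0" by (simp add: g_def h00 g0h L0g)
      show "orbit_point n lam (g t) \<in> carrier_mat n n" for t
        using gnn[of t] unitary_groupD(1)[of "g t" n] by (simp add: unitary_nonneg_iff orbit_point_eq)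
      show "has_mat_derivative n (\<lambda>t. orbit_point n lam (g t))
          (bracket (orbit_point n lam (g t)) (proj_u n (- \<i> \<cdot>\<^sub>m orbit_point n lam (g t)))) t" for t
        unfolding g_def by (rule toda_derivative[OF h dh refl])
    qed
    \<comment> \<open>From here on the given flow is the explicit one, so positivity, the cell and
      the twist can all be computed on \<open>g t\<close>.\<close>
    then have Lg: "L t = orbit_point n lam (g t)" for t by (rule toda_flow_unique[OF L])
    have gh: "dconj n (mat_adjoint (g t)) = h t" for t
      using unitary_groupD(1)[OF h[of t]] by (simp add: g_def dconj_adjoint)
    have tw: "twist n lam (L t) = orbit_point n lam (h t)" for t
      unfolding Lg twist_orbit_point[OF lam gnn] gh by (rule refl)
    have tw0: "twist n lam L0 = orbit_point n lam h0"
      unfolding L0g twist_orbit_point[OF lam g0] h0_def by (rule refl)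
    have 1: "\<forall>t. L t \<in> orbit_nonneg n lam" unfolding Lg orbit_nonneg_def using gnn by blast
    obtain v w where le: "bruhat_le n v w"
      and cell: "\<And>g l u d e. g \<in> unitary_nonneg n \<Longrightarrow> l \<in> lower_borel n \<Longrightarrow> u \<in> upper_borel n \<Longrightarrow> d \<in> upper_borel n \<Longrightarrow>
        e \<in> upper_borel n \<Longrightarrow> g = l * g0 * d \<Longrightarrow> g = u * g0 * e \<Longrightarrow> orbit_point n lam g \<in> cell n lam v w"
      using cell_exists[OF g0, of lam thesis] by blast
    have "L t \<in> cell n lam v w" for t
    proof -
      obtain u where u: "u \<in> upper_borel n" "g t = u * g0 * exp_diag n lam (- t)"
        using flow_factorizations(1)[OF h h0 c hc[of t]] unfolding g0h g_def by blast
      obtain l where l: "l \<in> lower_borel n" "g t = l * g0 * exp_diag n lam t"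
        using flow_factorizations(2)[OF h h0 c hc[of t]] unfolding g0h g_def by blast
      show ?thesis
        unfolding Lg by (rule cell[OF gnn l(1) u(1) exp_diag_upper_borel exp_diag_upper_borel l(2) u(2)])
    qed
    then have 2: "\<exists>C\<in>cells n lam. \<forall>t. L t \<in> C" unfolding cells_def using le by blast
    have 3: "twist n lam L0 \<in> orbit_nonneg n lam" unfolding tw0 orbit_nonneg_def using h0nn by blast
    have 4: "kaehler_gradient_flow n lam N (twist n lam L0) (\<lambda>t. twist n lam (L t))"
      unfolding kaehler_gradient_flow_def tw tw0
    proof (intro conjI allI)
      show "orbit_point n lam (h 0) = orbit_point n lam h0" by (simp add: h00)
      fix t
      show "orbit_point n lam (h t) \<in> orbit n lam" unfolding orbit_def using h by blast
      show "\<exists>G. is_kaehler_gradient n (\<lambda>A. kappa n A N) (orbit_point n lam (h t)) G \<and>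
          has_mat_derivative n (\<lambda>t. orbit_point n lam (h t)) G t"
        unfolding assms(3)
        using kaehler_gradient_frame[OF lam h orbit_point_eq[OF h]] gradient_derivative[OF lam h dh proj_form_skew] by blast
    qed
    show ?thesis using 1 2 3 4 by blast
  qed
  show ?thesis using main by blast
qed

end
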